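(* Let $A\in L^2_{\mathrm{loc}}(\mathbb{R}^3;\mathbb{R}^3)$ be such that $B:=\operatorname{curl}A\in L^2_{\mathrm{loc}}(\mathbb{R}^3;\mathbb{R}^3)$. Assume that there exists a number $c\in[0,1)$ satisfying $$4\sqrt3\,c<1\qquad\text{and}\qquad 2c+6\sqrt3\,c+\sqrt2\,(\sqrt3\,c)^{3/2}<1$$ such that, for all four-vectors $u$ with components in $C_0^\infty(\mathbb{R}^3)$, $$\int_{\mathbb{R}^3}r^2|B|^2|u|^2\le c^2\int_{\mathbb{R}^3}|\nabla_{\!A}u|^2 .$$ If in addition $A\in W^{1,3}_{\mathrm{loc}}(\mathbb{R}^3)$, then the Dirac operator $H_{\mathrm D}(A)=-i\alpha\cdot\nabla_{\!A}+\tfrac12\boldsymbol\beta$ in $L^2(\mathbb{R}^3;\mathbb{C}^4)$ has no eigenvalues, i.e. $\sigma_{\mathrm p}(H_{\mathrm D}(A))=\varnothing$.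
   Context: Notation: $r(x):=|x|$; $\nabla_{\!A}:=\nabla+iA$ acts componentwise, and $|\nabla_{\!A}u|^2:=\sum_j|\nabla_{\!A}u_j|^2$ for vector-valued $u$. The Dirac matrices are taken in the standard representation: $\alpha=(\boldsymbol\alpha_1,\boldsymbol\alpha_2,\boldsymbol\alpha_3)$ with $$\boldsymbol\alpha_\mu=\begin{pmatrix}\mathbf 0&\boldsymbol\sigma_\mu\\ \boldsymbol\sigma_\mu&\mathbf 0\end{pmatrix},\qquad \boldsymbol\beta=\begin{pmatrix}\mathbf I_{\mathbb{C}^2}&\mathbf 0\\ \mathbf 0&-\mathbf I_{\mathbb{C}^2}\end{pmatrix},\qquad \mu=1,2,3,$$ where $\boldsymbol\sigma_\mu$ are the Pauli matrices, and $\alpha\cdot\nabla_{\!A}=\sum_\mu\boldsymbol\alpha_\mu(\partial_\mu+iA_\mu)$. The domain of $H_{\mathrm D}(A)$ is the magnetic Sobolev space $H^1_A(\mathbb{R}^3;\mathbb{C}^4)=\{u\in L^2(\mathbb{R}^3;\mathbb{C}^4):(\partial_j+iA_j)u\in L^2(\mathbb{R}^3;\mathbb{C}^4),\ j=1,2,3\}$; under the stated assumptions $H_{\mathrm D}(A)$ is a closed symmetric operator. $\sigma_{\mathrm p}$ denotes the set of all eigenvalues. *)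

theory Defs
  imports "HOL-Analysis.Analysis"
begin

text \<open>Elements of Lebesgue spaces are represented by Lebesgue measurable functions
  on \<^typ>\<open>real^3\<close>; functions equal almost everywhere are identified only where it matters
  (in \<open>point_spectrum\<close> below).\<close>

definition L2 :: "(real^3 \<Rightarrow> 'a::euclidean_space) set" where
  "L2 = {f. f \<in> borel_measurable lebesgue \<and> integrable lebesgue (\<lambda>x. norm (f x) ^ 2)}"

definition Lloc :: "nat \<Rightarrow> (real^3 \<Rightarrow> 'a::euclidean_space) set" where
  "Lloc p = {f. f \<in> borel_measurable lebesgue \<and>
     (\<forall>K. compact K \<longrightarrow> set_integrable lebesgue K (\<lambda>x. norm (f x) ^ p))}"

definition partial :: "3 \<Rightarrow> (real^3 \<Rightarrow> 'a::real_normed_vector) \<Rightarrow> real^3 \<Rightarrow> 'a" where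
  "partial k f x = frechet_derivative f (at x) (axis k 1)"

primrec C_k :: "nat \<Rightarrow> (real^3 \<Rightarrow> 'a::real_normed_vector) \<Rightarrow> bool" where
  "C_k 0 f \<longleftrightarrow> continuous_on UNIV f"
| "C_k (Suc n) f \<longleftrightarrow> (\<forall>x. f differentiable at x) \<and> (\<forall>k. C_k n (partial k f))"

definition C0_infinity :: "(real^3 \<Rightarrow> 'a::real_normed_vector) set" where
  "C0_infinity = {f. (\<forall>n. C_k n f) \<and> compact (closure {x. f x \<noteq> 0})}"

text \<open>Distributional derivatives. Real-valued test functions are enough also for complex and
  vector-valued \<open>f\<close>, by linearity.\<close>

definition weak_partial ::
    "3 \<Rightarrow> (real^3 \<Rightarrow> 'a::euclidean_space) \<Rightarrow> (real^3 \<Rightarrow> 'a) \<Rightarrow> bool" where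
  "weak_partial k f g \<longleftrightarrow> f \<in> Lloc 1 \<and> g \<in> Lloc 1 \<and>
     (\<forall>\<phi>::real^3 \<Rightarrow> real. \<phi> \<in> C0_infinity \<longrightarrow>
        (LINT x|lebesgue. partial k \<phi> x *\<^sub>R f x) = - (LINT x|lebesgue. \<phi> x *\<^sub>R g x))"

text \<open>The curl is taken as a distribution, so that the individual derivatives of \<open>A\<close> need not
  be functions: the formula integrates
  \<open>curl (\<phi> A) = \<phi> curl A + \<nabla>\<phi> \<times> A\<close> over the whole space.\<close>

definition weak_curl :: "(real^3 \<Rightarrow> real^3) \<Rightarrow> (real^3 \<Rightarrow> real^3) \<Rightarrow> bool" where
  "weak_curl A B \<longleftrightarrow> A \<in> Lloc 1 \<and> B \<in> Lloc 1 \<and>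
     (\<forall>\<phi>::real^3 \<Rightarrow> real. \<phi> \<in> C0_infinity \<longrightarrow>
        (LINT x|lebesgue. cross3 (\<chi> k. partial k \<phi> x) (A x)) = - (LINT x|lebesgue. \<phi> x *\<^sub>R B x))"

definition W1loc :: "nat \<Rightarrow> (real^3 \<Rightarrow> 'a::euclidean_space) set" where
  "W1loc p = {f. f \<in> Lloc p \<and> (\<forall>k. \<exists>g \<in> Lloc p. weak_partial k f g)}"

definition mag_grad :: "(real^3 \<Rightarrow> real^3) \<Rightarrow> (real^3 \<Rightarrow> complex) \<Rightarrow> real^3 \<Rightarrow> complex^3" where
  "mag_grad A f x = (\<chi> k. partial k f x + \<i> * complex_of_real (A x $ k) * f x)"

definition mag_grad_sq :: "(real^3 \<Rightarrow> real^3) \<Rightarrow> (real^3 \<Rightarrow> complex^4) \<Rightarrow> real^3 \<Rightarrow> real" where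
  "mag_grad_sq A u x = (\<Sum>j\<in>UNIV. norm (mag_grad A (\<lambda>y. u y $ j) x) ^ 2)"

text \<open>\<open>g\<close> is the distribution \<open>(\<partial>\<^sub>k + i A\<^sub>k) u\<close>. For \<open>A\<close> in \<open>Lloc 2\<close> and \<open>u\<close>, \<open>g\<close> in \<open>L2\<close> all terms are
  locally integrable.\<close>

definition is_mag_deriv ::
    "(real^3 \<Rightarrow> real^3) \<Rightarrow> 3 \<Rightarrow> (real^3 \<Rightarrow> complex^4) \<Rightarrow> (real^3 \<Rightarrow> complex^4) \<Rightarrow> bool" where
  "is_mag_deriv A k u g \<longleftrightarrow>
     weak_partial k u (\<lambda>x. g x - (\<i> * complex_of_real (A x $ k)) *s u x)"

definition H1_mag :: "(real^3 \<Rightarrow> real^3) \<Rightarrow> (real^3 \<Rightarrow> complex^4) set" where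
  "H1_mag A = {u. u \<in> L2 \<and> (\<forall>k. \<exists>g \<in> L2. is_mag_deriv A k u g)}"

text \<open>Determined up to a null set whenever such a \<open>g\<close> exists, in particular on \<open>H1_mag A\<close>.\<close>

definition mag_deriv ::
    "(real^3 \<Rightarrow> real^3) \<Rightarrow> 3 \<Rightarrow> (real^3 \<Rightarrow> complex^4) \<Rightarrow> real^3 \<Rightarrow> complex^4" where
  "mag_deriv A k u = (SOME g. g \<in> L2 \<and> is_mag_deriv A k u g)"

definition pauli :: "3 \<Rightarrow> complex^2^2" where
  "pauli \<mu> =
     (if \<mu> = 1 then vector [vector [0, 1], vector [1, 0]]
      else if \<mu> = 2 then vector [vector [0, - \<i>], vector [\<i>, 0]]
      else vector [vector [1, 0], vector [0, - 1]])"

definition block_matrix ::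
    "complex^2^2 \<Rightarrow> complex^2^2 \<Rightarrow> complex^2^2 \<Rightarrow> complex^2^2 \<Rightarrow> complex^4^4" where
  "block_matrix P Q R S = vector
     [vector [P$1$1, P$1$2, Q$1$1, Q$1$2],
      vector [P$2$1, P$2$2, Q$2$1, Q$2$2],
      vector [R$1$1, R$1$2, S$1$1, S$1$2],
      vector [R$2$1, R$2$2, S$2$1, S$2$2]]"

definition dirac_alpha :: "3 \<Rightarrow> complex^4^4" where
  "dirac_alpha \<mu> = block_matrix 0 (pauli \<mu>) (pauli \<mu>) 0"

definition dirac_beta :: "complex^4^4" where
  "dirac_beta = block_matrix (mat 1) 0 0 (- mat 1)"

definition dirac_op ::
    "(real^3 \<Rightarrow> real^3) \<Rightarrow> (real^3 \<Rightarrow> complex^4) \<Rightarrow> real^3 \<Rightarrow> complex^4" where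
  "dirac_op A u x =
     (- \<i>) *s (\<Sum>\<mu>\<in>UNIV. dirac_alpha \<mu> *v mag_deriv A \<mu> u x) + (1/2) *s (dirac_beta *v u x)"

text \<open>Being nonzero, and the eigenvalue equation, are meant in \<open>L2\<close>, hence almost everywhere.\<close>

definition point_spectrum ::
    "(real^3 \<Rightarrow> complex^4) set \<Rightarrow> ((real^3 \<Rightarrow> complex^4) \<Rightarrow> real^3 \<Rightarrow> complex^4) \<Rightarrow> complex set" where
  "point_spectrum D T =
     {z. \<exists>u \<in> D. \<not> (AE x in lebesgue. u x = 0) \<and> (AE x in lebesgue. T u x = z *s u x)}"

end

theory Submission
  imports Defs "HOL-Computational_Algebra.Polynomial"
begin

text \<open>
  Let \<open>J\<close> be multiplication by \<open>i\<close> on spinors, \<open>D\<^sub>k = \<partial>\<^sub>k + A\<^sub>k J\<close> the magnetic derivatives and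
  \<open>T = \<Sum>\<^sub>k \<alpha>\<^sub>k D\<^sub>k\<close>. The eigenvalue equation reads \<open>T u = M u\<close> with the constant matrix
  \<open>M = J (z - \<beta>/2)\<close>. All pairings below use the real inner product, for which \<open>T\<close> is skew. Pairing
  the equation with \<open>u \<noteq> 0\<close> shows that \<open>z\<close> is real. Then \<open>T (M u) = - \<lambda> u\<close> with \<open>\<lambda> = z\<^sup>2 - 1/4\<close>, because
  \<open>\<beta>\<close> anticommutes with the \<open>\<alpha>\<^sub>k\<close>, and so \<open>\<parallel>M u\<parallel>\<^sup>2 = \<lambda> \<parallel>u\<parallel>\<^sup>2\<close>.

  The proof is a virial argument for the first order operator \<open>T\<close>. Commuting \<open>T\<close> with the magnetic
  dilation \<open>x \<sqdot> D\<close> gives \<open>T\<close> back, up to a multiplication operator of size \<open>\<bar>x\<bar> \<bar>B\<bar>\<close>. Pairing the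
  commutator with \<open>u\<close> and \<open>M u\<close>, the equation leaves only
  \<open>\<parallel>M u\<parallel>\<^sup>2 \<le> 6 \<integral> \<bar>x\<bar> \<bar>B\<bar> \<bar>u\<bar> \<bar>M u\<bar>\<close>.
  The right hand side is small. The assumptions on \<open>c\<close> force \<open>c \<le> 1/12\<close>. Squaring \<open>T\<close> produces
  the magnetic Dirichlet form and a field term, which the magnetic Hardy inequality and the
  hypothesis on \<open>B\<close> bound by half of that form (\<open>kin_le_T\<close>); hence \<open>\<parallel>D u\<parallel>\<^sup>2 \<le> 2 \<parallel>T u\<parallel>\<^sup>2\<close> and
  \<open>\<parallel>\<bar>x\<bar> B u\<parallel>\<^sup>2 \<le> \<parallel>M u\<parallel>\<^sup>2 / 72\<close>. Together these give \<open>\<parallel>M u\<parallel>\<^sup>2 \<le> (17/24) \<parallel>M u\<parallel>\<^sup>2\<close>, so \<open>M u = 0\<close>. Now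
  \<open>D u = 0\<close>, and the Hardy inequality gives \<open>u = 0\<close>.

  To make this rigorous, every identity and inequality is proved for test functions
  (\<open>magnetic_commutator\<close>, \<open>magnetic_Hardy\<close>, \<open>virial_bound\<close>), where the commutators of the \<open>D\<^sub>k\<close> only
  involve the distributional curl of \<open>A\<close>, and is then carried over to \<open>u\<close> by density
  (\<open>test_functions_dense\<close>). The field term need not converge: it is bounded already for test
  functions by quantities that do. The dilation field \<open>x\<close> is replaced by \<open>\<rho>(x/n) x\<close> with a bump
  function \<open>\<rho>\<close>, \<open>\<rho>(0) = 1\<close>; its Jacobian is bounded uniformly in \<open>n\<close> and tends to the identity, so
  that square integrability of \<open>u\<close> and \<open>D u\<close> suffices to remove the cutoff.

  Density rests on the gauge covariance of the truncation \<open>F(v) = v / sqrt (1 + \<bar>v\<bar>\<^sup>2/n)\<close>: from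
  \<open>F'(v) (J v) = J (F v)\<close> it follows that the magnetic derivative of \<open>F u\<close> is \<open>F'(u) (D u)\<close>, although
  neither the gradient of \<open>u\<close> nor \<open>A u\<close> has to be square integrable. For bounded compactly
  supported functions \<open>A u\<close> is square integrable, and ordinary mollification finishes the proof.
\<close>

section \<open>Partial derivatives and the classes \<open>C\<^sup>k\<close>\<close>

lemma has_derivative_partials:
  fixes f :: "real^3 \<Rightarrow> 'a::real_normed_vector"
  assumes "f differentiable at x"
  shows "(f has_derivative (\<lambda>h. \<Sum>k\<in>UNIV. h $ k *\<^sub>R partial k f x)) (at x)"
proof -
  have D: "(f has_derivative frechet_derivative f (at x)) (at x)"
    using assms by (simp add: frechet_derivative_works)
  interpret bounded_linear "frechet_derivative f (at x)"
    using D by (rule has_derivative_bounded_linear)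
  have "frechet_derivative f (at x) h = (\<Sum>k\<in>UNIV. h $ k *\<^sub>R partial k f x)" for h
  proof -
    have h: "h = (\<Sum>k\<in>UNIV. h $ k *\<^sub>R axis k 1)"
      by (metis (no_types, lifting) basis_expansion scalar_mult_eq_scaleR sum.cong)
    show ?thesis
      by (subst h) (simp add: sum scaleR partial_def)
  qed
  then have "frechet_derivative f (at x) = (\<lambda>h. \<Sum>k\<in>UNIV. h $ k *\<^sub>R partial k f x)" by blast
  with D show ?thesis by simp
qed

lemma partial_eqI: "(f has_derivative D) (at x) \<Longrightarrow> partial k f x = D (axis k 1)"
  using frechet_derivative_at[of f D x] by (simp add: partial_def)

lemma C_k_differentiable: "C_k (Suc n) f \<Longrightarrow> f differentiable at x"
  by simp

lemma C_k_SucD: "C_k (Suc n) f \<Longrightarrow> C_k n f"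
proof (induction n arbitrary: f)
  case 0
  then show ?case
    by (auto simp: differentiable_imp_continuous_within intro!: continuous_at_imp_continuous_on)
qed auto

lemma C_k_mono: "C_k n f \<Longrightarrow> m \<le> n \<Longrightarrow> C_k m f"
proof (induction n)
  case (Suc n)
  show ?case
  proof (cases "m = Suc n")
    case False
    then have "m \<le> n" using Suc.prems by simp
    then show ?thesis using Suc.IH C_k_SucD[OF Suc.prems(1)] by simp
  qed (use Suc in simp)
qed simp

lemma C_k_continuous: "C_k n f \<Longrightarrow> continuous_on UNIV f"
  using C_k_mono[of n f 0] by simp

lemma C_k_bounded_linear:
  assumes L: "bounded_linear L"
  shows "C_k n f \<Longrightarrow> C_k n (\<lambda>x. L (f x))"
    and "f differentiable at x \<Longrightarrow> partial k (\<lambda>x. L (f x)) x = L (partial k f x)"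
proof -
  interpret L: bounded_linear L by fact
  have D: "((\<lambda>x. L (f x)) has_derivative (\<lambda>h. L (\<Sum>k\<in>UNIV. h $ k *\<^sub>R partial k f x))) (at x)"
    if "f differentiable at x" for f x
    using L.has_derivative has_derivative_partials[OF that] by blast
  have P: "partial k (\<lambda>x. L (f x)) x = L (partial k f x)"
    if "f differentiable at x" for f x k
    by (subst partial_eqI[OF D[OF that]])
       (simp add: axis_def if_distrib if_distribR sum.delta cong: if_cong)
  show "f differentiable at x \<Longrightarrow> partial k (\<lambda>x. L (f x)) x = L (partial k f x)" by (rule P)
  show "C_k n f \<Longrightarrow> C_k n (\<lambda>x. L (f x))"
  proof (induction n arbitrary: f)
    case 0 then show ?case by (auto intro: L.continuous_on)
  next
    case (Suc n)
    have "partial k (\<lambda>x. L (f x)) = (\<lambda>x. L (partial k f x))" for k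
      using P Suc.prems by auto
    moreover have "(\<lambda>x. L (f x)) differentiable at x" for x
      by (rule differentiableI[OF D]) (use Suc.prems in simp)
    ultimately show ?case using Suc by simp
  qed
qed

lemma partial_add:
  "f differentiable at x \<Longrightarrow> g differentiable at x \<Longrightarrow>
    partial k (\<lambda>x. f x + g x) x = partial k f x + partial k g x"
  using partial_eqI[OF has_derivative_add[OF has_derivative_partials has_derivative_partials], of f x g]
  by (simp add: axis_def if_distrib if_distribR sum.delta cong: if_cong)

lemma C_k_add: "C_k n f \<Longrightarrow> C_k n g \<Longrightarrow> C_k n (\<lambda>x. f x + g x)"
proof (induction n arbitrary: f g)
  case 0 then show ?case by (auto intro: continuous_on_add)
next
  case (Suc n)
  have "partial k (\<lambda>x. f x + g x) = (\<lambda>x. partial k f x + partial k g x)" for k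
    using partial_add Suc.prems by fastforce
  then show ?case using Suc by (auto intro: differentiable_add)
qed

lemma partial_const: "partial k (\<lambda>x. c) = (\<lambda>x. 0)"
  using partial_eqI[OF has_derivative_const] by fastforce

lemma C_k_const: "C_k n (\<lambda>x. c)"
  by (induction n arbitrary: c) (auto simp: partial_const)

lemma C_k_sum: "(\<And>i. i \<in> I \<Longrightarrow> C_k n (f i)) \<Longrightarrow> C_k n (\<lambda>x. \<Sum>i\<in>I. f i x)"
proof (induction I rule: infinite_finite_induct)
  case (insert i I)
  then show ?case using C_k_add[of n "f i" "\<lambda>x. \<Sum>i\<in>I. f i x"] by simp
qed (auto simp: C_k_const)

lemma bounded_bilinear_differentiable:
  assumes "bounded_bilinear b" "f differentiable at x" "g differentiable at x"
  shows "(\<lambda>x. b (f x) (g x)) differentiable at x"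
  using bounded_bilinear.FDERIV[OF assms(1)] assms(2,3) unfolding differentiable_def by blast

lemma partial_bilinear:
  assumes b: "bounded_bilinear b" and f: "f differentiable at x" and g: "g differentiable at x"
  shows "partial k (\<lambda>x. b (f x) (g x)) x = b (partial k f x) (g x) + b (f x) (partial k g x)"
  using partial_eqI[OF bounded_bilinear.FDERIV[OF b has_derivative_partials[OF f] has_derivative_partials[OF g]], of k]
  by (simp add: axis_def if_distrib if_distribR sum.delta add.commute cong: if_cong)

lemma C_k_bilinear:
  assumes b: "bounded_bilinear b"
  shows "C_k n f \<Longrightarrow> C_k n g \<Longrightarrow> C_k n (\<lambda>x. b (f x) (g x))"
proof (induction n arbitrary: f g)
  case 0 then show ?case by (auto intro: bounded_bilinear.continuous_on[OF b])
next
  case (Suc n)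
  have "partial k (\<lambda>x. b (f x) (g x)) = (\<lambda>x. b (partial k f x) (g x) + b (f x) (partial k g x))" for k
    using partial_bilinear[OF b] Suc.prems by fastforce
  moreover have "C_k n f" "C_k n g" using Suc.prems C_k_SucD by blast+
  ultimately show ?case
    using Suc by (auto intro!: C_k_add bounded_bilinear_differentiable[OF b])
qed

lemmas C_k_scaleR = C_k_bilinear[OF bounded_bilinear_scaleR]
lemmas C_k_inner = C_k_bilinear[OF bounded_bilinear_inner]
lemmas C_k_mult = C_k_bilinear[OF bounded_bilinear_mult]
lemmas partial_scaleR = partial_bilinear[OF bounded_bilinear_scaleR]
lemmas partial_inner = partial_bilinear[OF bounded_bilinear_inner]
lemmas partial_mult = partial_bilinear[OF bounded_bilinear_mult]

lemma has_derivative_coord: "((\<lambda>x::real^3. x $ i) has_derivative (\<lambda>h. h $ i)) (at x)"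
  by (rule bounded_linear_imp_has_derivative) (rule bounded_linear_vec_nth)

lemma partial_coord: "partial k (\<lambda>x. x $ i) x = (if k = i then 1 else 0)"
  by (subst partial_eqI[OF has_derivative_coord]) (simp add: axis_def)

lemma C_k_coord: "C_k n (\<lambda>x. x $ i)"
proof (cases n)
  case (Suc m)
  have "partial k (\<lambda>x. x $ i) = (\<lambda>x. if k = i then 1 else 0)" for k by (auto simp: partial_coord)
  then show ?thesis
    using Suc has_derivative_coord by (auto simp: differentiable_def C_k_const)
qed (auto intro: continuous_intros)

lemma has_derivative_affine:
  fixes f :: "real^3 \<Rightarrow> 'a::real_normed_vector"
  assumes "f differentiable at (a + s *\<^sub>R x)"
  shows "((\<lambda>x. f (a + s *\<^sub>R x)) has_derivative
    (\<lambda>h. \<Sum>k\<in>UNIV. (s *\<^sub>R h) $ k *\<^sub>R partial k f (a + s *\<^sub>R x))) (at x)"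
  by (rule has_derivative_compose[of "\<lambda>x. a + s *\<^sub>R x" "\<lambda>h. s *\<^sub>R h", OF _ has_derivative_partials[OF assms]])
     (auto intro!: derivative_eq_intros)

lemma partial_affine:
  fixes f :: "real^3 \<Rightarrow> 'a::real_normed_vector"
  assumes "f differentiable at (a + s *\<^sub>R x)"
  shows "partial k (\<lambda>x. f (a + s *\<^sub>R x)) x = s *\<^sub>R partial k f (a + s *\<^sub>R x)"
  by (subst partial_eqI[OF has_derivative_affine[OF assms]])
     (simp add: axis_def if_distrib if_distribR sum.delta cong: if_cong)

lemma C_k_affine:
  fixes f :: "real^3 \<Rightarrow> 'a::real_normed_vector"
  shows "C_k n f \<Longrightarrow> C_k n (\<lambda>x. f (a + s *\<^sub>R x))"
proof (induction n arbitrary: f)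
  case 0
  then show ?case by (auto intro!: continuous_on_compose2[of UNIV f] continuous_intros)
next
  case (Suc n)
  have "partial k (\<lambda>x. f (a + s *\<^sub>R x)) = (\<lambda>x. s *\<^sub>R partial k f (a + s *\<^sub>R x))" for k
    using partial_affine Suc.prems by fastforce
  moreover have "(\<lambda>x. f (a + s *\<^sub>R x)) differentiable at x" for x
    by (rule differentiableI[OF has_derivative_affine]) (use Suc.prems in simp)
  moreover have "C_k n (\<lambda>x. s *\<^sub>R partial k f (a + s *\<^sub>R x))" for k
    by (rule C_k_bounded_linear[OF bounded_linear_scaleR_right]) (use Suc in simp)
  ultimately show ?case by simp
qed

text \<open>The induction on the order differentiates the outer function again and again, so the
  statement is about a whole sequence of successive derivatives.\<close>

lemma C_k_compose_real:
  fixes D :: "nat \<Rightarrow> real \<Rightarrow> real" and f :: "real^3 \<Rightarrow> real"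
  assumes D: "\<And>m t. (D m has_real_derivative D (Suc m) t) (at t)"
  shows "C_k n f \<Longrightarrow> C_k n (\<lambda>x. D m (f x))"
proof (induction n arbitrary: m)
  case 0
  have "continuous_on UNIV (D m)"
    using D by (intro continuous_at_imp_continuous_on) (auto intro: DERIV_isCont)
  then show ?case using 0 by (auto intro: continuous_on_compose2)
next
  case (Suc n)
  have d: "((\<lambda>x. D m (f x)) has_derivative (\<lambda>h. D (Suc m) (f x) * (\<Sum>k\<in>UNIV. h $ k *\<^sub>R partial k f x))) (at x)" for x
    using has_derivative_compose[OF has_derivative_partials D[unfolded has_field_derivative_def]] Suc.prems by auto
  have "partial k (\<lambda>x. D m (f x)) = (\<lambda>x. D (Suc m) (f x) * partial k f x)" for k
    by (rule ext, subst partial_eqI[OF d])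
       (simp add: axis_def if_distrib if_distribR sum.delta cong: if_cong)
  moreover have "C_k n f" using Suc.prems C_k_SucD by blast
  ultimately show ?case using Suc d by (auto simp: differentiable_def intro: C_k_mult)
qed

section \<open>Test functions and integration by parts\<close>

lemma C0_infinity_iff: "f \<in> C0_infinity \<longleftrightarrow> (\<forall>n. C_k n f) \<and> bounded {x. f x \<noteq> 0}"
  by (simp add: C0_infinity_def compact_closure)

lemma C0_C_k: "f \<in> C0_infinity \<Longrightarrow> C_k n f"
  by (simp add: C0_infinity_def)

lemma C0_differentiable: "f \<in> C0_infinity \<Longrightarrow> f differentiable at x"
  using C0_C_k[of f "Suc 0"] by simp

lemma C0_continuous: "f \<in> C0_infinity \<Longrightarrow> continuous_on UNIV f"
  using C0_C_k[of f 0] by simp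

lemma C0_bounded_support: "f \<in> C0_infinity \<Longrightarrow> bounded {x. f x \<noteq> 0}"
  by (simp add: C0_infinity_iff)

lemma partial_zero_outside_support:
  assumes "x \<notin> closure {x. f x \<noteq> 0}" shows "partial k f x = 0"
proof -
  have "(f has_derivative (\<lambda>h. 0)) (at x)"
    by (rule has_derivative_transform_within_open[OF has_derivative_const[of 0], of "- closure {x. f x \<noteq> 0}"])
       (use assms closure_subset[of "{x. f x \<noteq> 0}"] in auto)
  from partial_eqI[OF this] show ?thesis by simp
qed

lemma bounded_support_partial:
  assumes "bounded {x. f x \<noteq> 0}" shows "bounded {x. partial k f x \<noteq> 0}"
  by (rule bounded_subset[OF bounded_closure[OF assms]]) (use partial_zero_outside_support in auto)

lemma C0_partial: "f \<in> C0_infinity \<Longrightarrow> partial k f \<in> C0_infinity"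
  unfolding C0_infinity_iff by (metis bounded_support_partial C_k.simps(2))

lemma C0_bounded_linear:
  assumes L: "bounded_linear L" and f: "f \<in> C0_infinity"
  shows "(\<lambda>x. L (f x)) \<in> C0_infinity"
proof -
  have "{x. L (f x) \<noteq> 0} \<subseteq> {x. f x \<noteq> 0}" using linear_0[OF bounded_linear.linear[OF L]] by auto
  from bounded_subset[OF C0_bounded_support[OF f] this] show ?thesis
    using C_k_bounded_linear(1)[OF L C0_C_k[OF f]] by (simp add: C0_infinity_iff)
qed

lemma C0_bilinear:
  assumes b: "bounded_bilinear b" and "f \<in> C0_infinity" "\<And>n. C_k n g"
  shows "(\<lambda>x. b (f x) (g x)) \<in> C0_infinity"
proof -
  have "{x. b (f x) (g x) \<noteq> 0} \<subseteq> {x. f x \<noteq> 0}" using bounded_bilinear.zero_left[OF b] by auto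
  from bounded_subset[OF C0_bounded_support[OF assms(2)] this] show ?thesis
    using C_k_bilinear[OF b C0_C_k[OF assms(2)] assms(3)] by (simp add: C0_infinity_iff)
qed

lemmas C0_mult = C0_bilinear[OF bounded_bilinear_mult]
lemmas C0_inner = C0_bilinear[OF bounded_bilinear_inner]

lemma C0_affine:
  assumes s: "s \<noteq> 0" and f: "f \<in> C0_infinity"
  shows "(\<lambda>x. f (a + s *\<^sub>R x)) \<in> C0_infinity"
proof -
  obtain M where M: "\<And>x. f x \<noteq> 0 \<Longrightarrow> norm x \<le> M"
    using C0_bounded_support[OF f] by (auto simp: bounded_iff)
  have "norm x \<le> (M + norm a) / \<bar>s\<bar>" if "f (a + s *\<^sub>R x) \<noteq> 0" for x
  proof -
    have "norm (s *\<^sub>R x) \<le> norm (a + s *\<^sub>R x) + norm a"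
      using norm_triangle_ineq4[of "a + s *\<^sub>R x" a] by simp
    also have "\<dots> \<le> M + norm a" using M[OF that] by simp
    finally show ?thesis using s by (simp add: pos_le_divide_eq mult.commute)
  qed
  then have "bounded {x. f (a + s *\<^sub>R x) \<noteq> 0}" unfolding bounded_iff by blast
  then show ?thesis using C_k_affine[OF C0_C_k[OF f]] by (simp add: C0_infinity_iff)
qed

text \<open>The \<open>m\<close>-th derivative of \<open>exp (- 1/t)\<close> for positive \<open>t\<close> is \<open>P\<^sub>m (1/t) exp (- 1/t)\<close> with these
  polynomials \<open>P\<^sub>m\<close>.\<close>

primrec bump_poly :: "nat \<Rightarrow> real poly" where
  "bump_poly 0 = 1"
| "bump_poly (Suc m) = [:0, 0, 1:] * (bump_poly m - pderiv (bump_poly m))"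

definition bump_deriv :: "nat \<Rightarrow> real \<Rightarrow> real" where
  "bump_deriv m t = (if t > 0 then poly (bump_poly m) (1 / t) * exp (- (1 / t)) else 0)"

lemma poly_times_exp_minus_tendsto_0: "((\<lambda>x. poly p x * exp (- x)) \<longlongrightarrow> (0::real)) at_top"
proof -
  have "((\<lambda>x. \<Sum>i\<le>degree p. coeff p i * (x ^ i / exp x)) \<longlongrightarrow> (\<Sum>i\<le>degree p. coeff p i * 0)) at_top"
    by (intro tendsto_sum tendsto_mult tendsto_const tendsto_power_div_exp_0)
  then show ?thesis
    by (simp add: poly_altdef sum_distrib_right sum_divide_distrib exp_minus field_simps)
qed

text \<open>At \<open>0\<close> the difference quotient is again a polynomial in \<open>1/t\<close> times \<open>exp (- 1/t)\<close>, hence tends to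
  \<open>0\<close>; away from \<open>0\<close> the formula is differentiated directly.\<close>

lemma bump_deriv_has_derivative: "(bump_deriv m has_real_derivative bump_deriv (Suc m) t) (at t)"
proof -
  consider "t > 0" | "t < 0" | "t = 0" by linarith
  then show ?thesis
  proof cases
    case 1
    have "((\<lambda>t. poly (bump_poly m) (1 / t) * exp (- (1 / t))) has_real_derivative bump_deriv (Suc m) t) (at t)"
      using 1 by (auto intro!: derivative_eq_intros DERIV_chain2[OF poly_DERIV]
          simp: bump_deriv_def field_simps power2_eq_square)
    then show ?thesis
      by (rule has_field_derivative_transform_within_open[of _ _ _ "{0<..}"]) (use 1 in \<open>auto simp: bump_deriv_def\<close>)
  next
    case 2
    have "((\<lambda>t. 0) has_real_derivative bump_deriv (Suc m) t) (at t)"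
      using 2 by (auto simp: bump_deriv_def)
    then show ?thesis
      by (rule has_field_derivative_transform_within_open[of _ _ _ "{..<0}"]) (use 2 in \<open>auto simp: bump_deriv_def\<close>)
  next
    case 3
    have R: "((\<lambda>h. bump_deriv m h / h) \<longlongrightarrow> 0) (at_right 0)"
    proof -
      have "((\<lambda>h. poly (pCons 0 (bump_poly m)) (inverse h) * exp (- inverse h)) \<longlongrightarrow> 0) (at_right 0)"
        by (rule filterlim_compose[OF poly_times_exp_minus_tendsto_0 filterlim_inverse_at_top_right])
      then show ?thesis
        by (rule Lim_transform_eventually)
           (auto simp: eventually_at_filter bump_deriv_def field_simps)
    qed
    have L: "((\<lambda>h. bump_deriv m h / h) \<longlongrightarrow> 0) (at_left 0)"
      by (rule Lim_transform_eventually[OF tendsto_const]) (auto simp: eventually_at_filter bump_deriv_def)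
    have "((\<lambda>h. bump_deriv m h / h) \<longlongrightarrow> 0) (at 0)"
      by (rule filterlim_split_at[OF L R])
    then show ?thesis using 3 by (simp add: DERIV_def bump_deriv_def)
  qed
qed

text \<open>The factor \<open>exp 1\<close> normalises the value at the origin to \<open>1\<close>, so that rescaled bumps converge
  to \<open>1\<close> pointwise.\<close>

definition bump :: "real^3 \<Rightarrow> real" where
  "bump x = exp 1 * bump_deriv 0 (1 - x \<bullet> x)"

lemma bump_nonneg: "0 \<le> bump x" and bump_le_1: "bump x \<le> 1" and bump_0: "bump 0 = 1"
  and bump_eq_0: "norm x \<ge> 1 \<Longrightarrow> bump x = 0"
proof -
  show "0 \<le> bump x" by (simp add: bump_def bump_deriv_def)
  show "bump 0 = 1" by (simp add: bump_def bump_deriv_def exp_minus)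
  show "bump x \<le> 1"
  proof (cases "x \<bullet> x < 1")
    case True
    then have "1 \<le> 1 / (1 - x \<bullet> x)" by (simp add: field_simps)
    then have "exp 1 * exp (- (1 / (1 - x \<bullet> x))) \<le> (1::real)"
        by (simp add: exp_add[symmetric])
    then show ?thesis using True by (simp add: bump_def bump_deriv_def)
  qed (simp add: bump_def bump_deriv_def)
  assume "norm x \<ge> 1"
  then have "x \<bullet> x \<ge> 1" by (simp add: dot_square_norm)
  then show "bump x = 0" by (simp add: bump_def bump_deriv_def)
qed

lemma bump_C0: "bump \<in> C0_infinity"
proof -
  have "C_k n (\<lambda>x::real^3. 1 + (\<Sum>i\<in>UNIV. (x $ i) * ((-1) * (x $ i))))" for n
    by (rule C_k_add[OF C_k_const C_k_sum[OF C_k_mult[OF C_k_coord C_k_mult[OF C_k_const C_k_coord]]]])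
  moreover have "(\<lambda>x::real^3. 1 + (\<Sum>i\<in>UNIV. (x $ i) * ((-1) * (x $ i)))) = (\<lambda>x. 1 - x \<bullet> x)"
    by (auto simp: inner_vec_def sum_negf)
  ultimately have "C_k n (\<lambda>x::real^3. 1 - x \<bullet> x)" for n by simp
  then have "C_k n bump" for n
    unfolding bump_def[abs_def] by (intro C_k_mult[OF C_k_const] C_k_compose_real[where D = bump_deriv, OF bump_deriv_has_derivative])
  moreover have "{x. bump x \<noteq> 0} \<subseteq> cball 0 1" using bump_eq_0 by force
  ultimately show ?thesis using bounded_subset[OF bounded_cball] by (auto simp: C0_infinity_iff)
qed

lemma integrable_compact_support:
  fixes f :: "real^3 \<Rightarrow> 'a::euclidean_space"
  assumes f: "continuous_on UNIV f" and "bounded {x. f x \<noteq> 0}"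
  shows "integrable lborel f" "integrable lebesgue f"
proof -
  let ?K = "closure {x. f x \<noteq> 0}"
  have "compact ?K" using assms(2) by (simp add: compact_closure)
  then have "set_integrable lborel ?K f"
    unfolding set_integrable_def by (intro borel_integrable_compact continuous_on_subset[OF f]) auto
  moreover have "(\<lambda>x. indicator ?K x *\<^sub>R f x) = f"
    using closure_subset[of "{x. f x \<noteq> 0}"] by (fastforce simp: indicator_def)
  ultimately show 1: "integrable lborel f" by (simp add: set_integrable_def)
  then show "integrable lebesgue f" by (simp add: integrable_completion borel_measurable_integrable)
qed

lemma integral_lebesgue_lborel:
  "f \<in> borel_measurable borel \<Longrightarrow> integral\<^sup>L lebesgue f = integral\<^sup>L lborel (f :: real^3 \<Rightarrow> 'a::euclidean_space)"
  by (rule integral_completion) simp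

lemma integral_translation:
  fixes f :: "real^3 \<Rightarrow> 'a::euclidean_space"
  assumes "f \<in> borel_measurable borel"
  shows "(LINT x|lborel. f (c + x)) = (LINT x|lborel. f x)"
proof -
  have "(LINT x|lborel. f x) = integral\<^sup>L (distr lborel borel ((+) c)) f"
    by (simp add: lborel_distr_plus)
  also have "\<dots> = (LINT x|lborel. f (c + x))"
    by (rule integral_distr) (use assms in auto)
  finally show ?thesis ..
qed

lemma uniformly_continuous_compact_support:
  fixes f :: "'b::euclidean_space \<Rightarrow> 'a::real_normed_vector"
  assumes f: "continuous_on UNIV f" and b: "bounded {x. f x \<noteq> 0}" and e: "e > 0"
  obtains d where "d > 0" "\<And>x y. dist x y < d \<Longrightarrow> dist (f x) (f y) < e"
proof -
  obtain M where M: "\<And>x. f x \<noteq> 0 \<Longrightarrow> norm x \<le> M" using b by (auto simp: bounded_iff)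
  have "uniformly_continuous_on (cball 0 (M + 1)) f"
    using f by (intro compact_uniformly_continuous) (auto intro: continuous_on_subset)
  then obtain d where d: "d > 0"
    "\<And>x y. x \<in> cball 0 (M+1) \<Longrightarrow> y \<in> cball 0 (M+1) \<Longrightarrow> dist x y < d \<Longrightarrow> dist (f x) (f y) < e"
    using e unfolding uniformly_continuous_on_def by (metis dist_commute)
  show ?thesis
  proof (rule that[of "min d 1"])
    fix x y :: 'b assume xy: "dist x y < min d 1"
    then have n: "norm x \<le> norm y + 1" "norm y \<le> norm x + 1"
      using norm_triangle_ineq2[of x y] norm_triangle_ineq2[of y x] by (auto simp: dist_norm norm_minus_commute)
    show "dist (f x) (f y) < e"
    proof (cases "x \<in> cball 0 (M+1) \<and> y \<in> cball 0 (M+1)")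
      case True then show ?thesis using d xy by simp
    next
      case False
      then have "f x = 0 \<and> f y = 0" using n M[of x] M[of y] by force
      then show ?thesis using e by simp
    qed
  qed (use d in simp)
qed

text \<open>Compact support makes the partial derivatives uniformly continuous, so the error of the linear
  approximation is \<open>o(\<bar>h\<bar>)\<close> uniformly in the base point. This allows differentiation under
  integrals of translates.\<close>

lemma uniformly_differentiable:
  fixes f :: "real^3 \<Rightarrow> 'a::real_normed_vector"
  assumes f: "C_k (Suc 0) f" and b: "bounded {x. f x \<noteq> 0}" and e: "e > 0"
  obtains d where "d > 0"
    "\<And>z h. norm h < d \<Longrightarrow> norm (f (z + h) - f z - (\<Sum>k\<in>UNIV. h $ k *\<^sub>R partial k f z)) \<le> e * norm h"
proof -
  have "\<exists>d>0. \<forall>x y. dist x y < d \<longrightarrow> dist (partial k f x) (partial k f y) < e / 3" for k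
    using uniformly_continuous_compact_support[of "partial k f" "e/3"] f bounded_support_partial[OF b] e
    by (metis C_k.simps divide_pos_pos zero_less_numeral)
  then obtain D where D: "\<And>k. D k > 0"
    "\<And>k x y. dist x y < D k \<Longrightarrow> dist (partial k f x) (partial k f y) < e / 3" by metis
  let ?d = "Min (range D)"
  have d: "?d > 0" "\<And>k. ?d \<le> D k" using D(1) by auto
  show ?thesis
  proof (rule that[OF d(1)])
    fix z h :: "real^3" assume h: "norm h < ?d"
    let ?f' = "\<lambda>x h. \<Sum>k\<in>UNIV. h $ k *\<^sub>R partial k f x"
    have "norm (f (z + h) - f z - ?f' z (z + h - z)) \<le> norm (z + h - z) * e"
    proof (rule differentiable_bound_linearization[where S = "ball z ?d"])
      show "z + t *\<^sub>R (z + h - z) \<in> ball z ?d" if "t \<in> {0..1}" for t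
      proof -
        have "\<bar>t\<bar> * norm h \<le> 1 * norm h" using that by (intro mult_right_mono) auto
        then show ?thesis using order_le_less_trans[OF _ h, of "\<bar>t\<bar> * norm h"]
          by (simp add: dist_norm del: Min_gr_iff)
      qed
      show "(f has_derivative ?f' x) (at x within ball z ?d)" for x
        using has_derivative_partials f by (auto intro: has_derivative_at_withinI)
      show "z \<in> ball z ?d" using d by simp
      show "onorm (?f' x - ?f' z) \<le> e" if x: "x \<in> ball z ?d" for x
      proof (rule onorm_le)
        fix h :: "real^3"
        have "norm ((?f' x - ?f' z) h) = norm (\<Sum>k\<in>UNIV. h $ k *\<^sub>R (partial k f x - partial k f z))"
          by (simp add: sum_subtractf scaleR_diff_right)
        also have "\<dots> \<le> (\<Sum>k\<in>(UNIV::3 set). norm h * (e / 3))"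
        proof (intro sum_norm_le)
          fix k :: 3
          have "norm (partial k f x - partial k f z) \<le> e / 3"
            using D(2)[of z x k] x d(2)[of k] by (simp add: dist_norm norm_minus_commute)
          moreover have "\<bar>h $ k\<bar> \<le> norm h" by (rule component_le_norm_cart)
          ultimately show "norm (h $ k *\<^sub>R (partial k f x - partial k f z)) \<le> norm h * (e / 3)"
            unfolding norm_scaleR by (intro mult_mono) auto
        qed
        also have "\<dots> = e * norm h" by simp
        finally show "norm ((?f' x - ?f' z) h) \<le> e * norm h" .
      qed
    qed
    then show "norm (f (z + h) - f z - ?f' z h) \<le> e * norm h" by (simp add: mult.commute)
  qed
qed

text \<open>By translation invariance \<open>f (x + h e\<^sub>k) - f x\<close> has integral \<open>0\<close>. It equals \<open>h \<partial>\<^sub>k f x\<close> up to an error of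
  at most \<open>e h\<close>, supported in a fixed ball.\<close>

lemma integral_partial_eq_0:
  fixes f :: "real^3 \<Rightarrow> 'a::euclidean_space"
  assumes f: "C_k (Suc 0) f" and b: "bounded {x. f x \<noteq> 0}"
  shows "(LINT x|lebesgue. partial k f x) = 0"
proof -
  have cf: "continuous_on UNIV f" and cp: "continuous_on UNIV (partial k f)"
    using C_k_continuous[OF f] f by simp_all
  have intf: "integrable lborel f" "integrable lborel (partial k f)"
    using integrable_compact_support cf cp b bounded_support_partial by blast+
  have meas: "f \<in> borel_measurable borel" "partial k f \<in> borel_measurable borel"
    using cf cp by (auto intro: borel_measurable_continuous_onI)
  obtain M where M: "\<And>x. f x \<noteq> 0 \<Longrightarrow> norm x \<le> M" using b by (auto simp: bounded_iff)
  have M': "partial k f x = 0" if "norm x > M" for x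
  proof (rule partial_zero_outside_support)
    have "closure {x. f x \<noteq> 0} \<subseteq> cball 0 M" by (rule closure_minimal) (use M in auto)
    then show "x \<notin> closure {x. f x \<noteq> 0}" using that by auto
  qed
  let ?V = "measure lborel (cball (0::real^3) (M + 1))"
  let ?I = "LINT x|lborel. partial k f x"
  have "norm ?I \<le> e * ?V" if e: "e > 0" for e
  proof -
    obtain d where d: "d > 0"
      "\<And>z h. norm h < d \<Longrightarrow> norm (f (z + h) - f z - (\<Sum>k\<in>UNIV. h $ k *\<^sub>R partial k f z)) \<le> e * norm h"
      by (rule uniformly_differentiable[OF f b e]) blast
    define h where "h = min (d/2) 1"
    have h: "h > 0" "h < d" "h \<le> 1" using d(1) by (auto simp: h_def)
    let ?h = "h *\<^sub>R axis k (1::real) :: real^3"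
    let ?g = "\<lambda>x. f (?h + x) - f x - h *\<^sub>R partial k f x"
    have nh: "norm ?h = h" using h by (simp add: norm_axis_1)
    have s: "(\<Sum>j\<in>UNIV. ?h $ j *\<^sub>R partial j f x) = h *\<^sub>R partial k f x" for x
      by (simp add: axis_def if_distrib if_distribR sum.delta cong: if_cong)
    have bd: "norm (?g x) \<le> indicator (cball 0 (M + 1)) x *\<^sub>R (e * h)" for x
    proof (cases "x \<in> cball 0 (M + 1)")
      case True
      then show ?thesis using d(2)[of ?h x] h unfolding nh s by (simp add: add.commute)
    next
      case False
      then have "norm x > M + 1" by simp
      moreover have "norm x \<le> norm (?h + x) + h"
        using norm_triangle_ineq4[of "?h + x" ?h] nh by simp
      ultimately have "norm (?h + x) > M" "norm x > M" using h by auto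
      then have "?g x = 0" using M[of x] M[of "?h + x"] M'[of x] by force
      then show ?thesis using False by simp
    qed
    have it: "integrable lborel (\<lambda>x. f (?h + x))"
    proof (rule integrable_compact_support)
      have "norm x \<le> M + 1" if "f (?h + x) \<noteq> 0" for x
        using norm_triangle_ineq4[of "?h + x" ?h] nh M[OF that] h by simp
      then show "bounded {x. f (?h + x) \<noteq> 0}" unfolding bounded_iff by blast
      show "continuous_on UNIV (\<lambda>x. f (?h + x))"
        by (intro continuous_on_compose2[OF cf] continuous_intros) auto
    qed
    have "(LINT x|lborel. ?g x) = - (h *\<^sub>R ?I)"
      using intf it integral_translation[OF meas(1), of ?h] by simp
    then have "h * norm ?I = norm (LINT x|lborel. ?g x)" using h by simp
    also have "\<dots> \<le> (LINT x|lborel. indicator (cball 0 (M + 1)) (x::real^3) *\<^sub>R (e * h))"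
    proof (rule order_trans[OF Bochner_Integration.integral_norm_bound Bochner_Integration.integral_mono[OF _ _ bd]])
      show "integrable lborel (\<lambda>x. norm (?g x))" using intf it by auto
      show "integrable lborel (\<lambda>x::real^3. indicator (cball 0 (M + 1)) x *\<^sub>R (e * h))"
        by (auto intro!: integrable_real_indicator emeasure_bounded_finite)
    qed
    also have "\<dots> = h * (e * ?V)" by simp
    finally show "norm ?I \<le> e * ?V" using h by simp
  qed
  then have *: "norm ?I \<le> e * ?V" if "e > 0" for e using that by blast
  have "norm ?I \<le> 0 + e" if "e > 0" for e
  proof -
    have V0: "?V + 1 > 0" by (rule add_nonneg_pos) (rule measure_nonneg, simp)
    have "norm ?I \<le> e / (?V + 1) * ?V" using that V0 by (intro *) simp
    also have "\<dots> \<le> e / (?V + 1) * (?V + 1)" using that V0 by (intro mult_left_mono) auto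
    also have "\<dots> = e" using V0 by simp
    finally show ?thesis by simp
  qed
  then have "norm ?I \<le> 0" by (rule field_le_epsilon)
  then show ?thesis using integral_lebesgue_lborel[OF meas(2)] by simp
qed

section \<open>Square integrable functions\<close>

definition L2sq :: "(real^3 \<Rightarrow> 'a::euclidean_space) \<Rightarrow> real" where
  "L2sq f = (LINT x|lebesgue. norm (f x) ^ 2)"

lemma L2_measurable[measurable_dest]: "f \<in> L2 \<Longrightarrow> f \<in> borel_measurable lebesgue"
  by (simp add: L2_def)

lemma L2_integrable: "f \<in> L2 \<Longrightarrow> integrable lebesgue (\<lambda>x. norm (f x) ^ 2)"
  by (simp add: L2_def)

lemma L2sq_nonneg: "0 \<le> L2sq f"
  by (simp add: L2sq_def)

lemma L2_bound:
  assumes f: "f \<in> L2" and g[measurable]: "g \<in> borel_measurable lebesgue"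
    and le: "AE x in lebesgue. norm (g x) \<le> C * norm (f x)"
  shows "g \<in> L2"
proof -
  have "integrable lebesgue (\<lambda>x. norm (g x) ^ 2)"
  proof (rule Bochner_Integration.integrable_bound[OF integrable_mult_right[OF L2_integrable[OF f], of "C^2"]])
    show "AE x in lebesgue. norm (norm (g x) ^ 2) \<le> norm (C^2 * norm (f x) ^ 2)"
      using le
    proof eventually_elim
      case (elim x)
      then have "norm (g x) ^ 2 \<le> (C * norm (f x)) ^ 2" by (intro power_mono) auto
      then show ?case by (simp add: power_mult_distrib)
    qed
  qed simp
  then show ?thesis by (simp add: L2_def g)
qed

lemma sq_norm_add_le: "norm (a + b) ^ 2 \<le> 2 * norm a ^ 2 + 2 * norm (b::'a::real_normed_vector) ^ 2"
proof -
  have "norm (a + b) ^ 2 \<le> (norm a + norm b) ^ 2"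
    by (intro power_mono norm_triangle_ineq) simp
  also have "\<dots> \<le> 2 * norm a ^ 2 + 2 * norm b ^ 2"
    using sum_squares_bound[of "norm a" "norm b"] by (simp add: power2_sum)
  finally show ?thesis .
qed

lemma L2_add:
  assumes f: "f \<in> L2" and g: "g \<in> L2"
  shows "(\<lambda>x. f x + g x) \<in> L2" and "L2sq (\<lambda>x. f x + g x) \<le> 2 * L2sq f + 2 * L2sq g"
proof -
  have i: "integrable lebesgue (\<lambda>x. 2 * norm (f x) ^ 2 + 2 * norm (g x) ^ 2)"
    using L2_integrable[OF f] L2_integrable[OF g] by simp
  note [measurable] = L2_measurable[OF f] L2_measurable[OF g]
  have j: "integrable lebesgue (\<lambda>x. norm (f x + g x) ^ 2)"
    by (rule Bochner_Integration.integrable_bound[OF i]) (use sq_norm_add_le in auto)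
  then show "(\<lambda>x. f x + g x) \<in> L2" by (simp add: L2_def)
  have "L2sq (\<lambda>x. f x + g x) \<le> (LINT x|lebesgue. 2 * norm (f x) ^ 2 + 2 * norm (g x) ^ 2)"
    unfolding L2sq_def using i j sq_norm_add_le by (intro integral_mono) auto
  also have "\<dots> = 2 * L2sq f + 2 * L2sq g"
    using L2_integrable[OF f] L2_integrable[OF g] by (simp add: L2sq_def)
  finally show "L2sq (\<lambda>x. f x + g x) \<le> 2 * L2sq f + 2 * L2sq g" .
qed

lemma L2_bounded_linear:
  assumes L: "bounded_linear L" and f: "f \<in> L2"
  shows "(\<lambda>x. L (f x)) \<in> L2"
proof -
  obtain K where K: "\<And>x. norm (L x) \<le> norm x * K" using bounded_linear.bounded[OF L] by blast
  have [measurable]: "L \<in> borel_measurable borel"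
    using L by (intro borel_measurable_continuous_onI) (simp add: linear_continuous_on)
  note [measurable] = L2_measurable[OF f]
  show ?thesis by (rule L2_bound[OF f, of _ K]) (use K in \<open>auto simp: mult.commute\<close>)
qed

lemma L2_diff: "f \<in> L2 \<Longrightarrow> g \<in> L2 \<Longrightarrow> (\<lambda>x. f x - g x) \<in> L2"
  using L2_add(1)[OF _ L2_bounded_linear[OF bounded_linear_minus[OF bounded_linear_ident]]] by fastforce

lemma L2_zero: "(\<lambda>x. 0) \<in> L2"
  by (simp add: L2_def)

lemma L2_sum: "(\<And>i. i \<in> I \<Longrightarrow> f i \<in> L2) \<Longrightarrow> (\<lambda>x. \<Sum>i\<in>I. f i x) \<in> L2"
  by (induction I rule: infinite_finite_induct) (auto simp: L2_zero L2_add)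

lemma continuous_compact_support_L2:
  fixes f :: "real^3 \<Rightarrow> 'a::euclidean_space"
  assumes f: "continuous_on UNIV f" and b: "bounded {x. f x \<noteq> 0}"
  shows "f \<in> L2"
proof -
  have "integrable lebesgue (\<lambda>x. norm (f x) ^ 2)"
    using f b by (intro integrable_compact_support) (auto intro!: continuous_intros)
  moreover have "f \<in> borel_measurable lebesgue"
    using integrable_compact_support[OF f b] by (simp add: borel_measurable_integrable)
  ultimately show ?thesis by (simp add: L2_def)
qed

lemma C0_L2: "f \<in> C0_infinity \<Longrightarrow> (f :: real^3 \<Rightarrow> 'a::euclidean_space) \<in> L2"
  by (simp add: continuous_compact_support_L2 C0_continuous C0_bounded_support)

lemma mult_le_squares: "(a::real) * b \<le> t / 2 * a ^ 2 + b ^ 2 / (2 * t)" if "t > 0"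
proof -
  have "0 \<le> (t * a - b) ^ 2 / (2 * t)" using that by simp
  also have "\<dots> = t / 2 * a ^ 2 + b ^ 2 / (2 * t) - a * b"
    using that by (simp add: field_simps power2_eq_square)
  finally show ?thesis by simp
qed

lemma L2_norm_mult_integrable:
  assumes f: "f \<in> L2" and g: "g \<in> L2"
  shows "integrable lebesgue (\<lambda>x. norm (f x) * norm (g x))"
proof (rule Bochner_Integration.integrable_bound)
  note [measurable] = L2_measurable[OF f] L2_measurable[OF g]
  show "integrable lebesgue (\<lambda>x. 1/2 * norm (f x) ^ 2 + norm (g x) ^ 2 / (2 * 1))"
    using L2_integrable[OF f] L2_integrable[OF g] by simp
  show "(\<lambda>x. norm (f x) * norm (g x)) \<in> borel_measurable lebesgue" by simp
  show "AE x in lebesgue. norm (norm (f x) * norm (g x)) \<le> norm (1/2 * norm (f x) ^ 2 + norm (g x) ^ 2 / (2 * 1))"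
    using mult_le_squares[of 1] by (auto simp: abs_mult)
qed

text \<open>Integrate \<open>a b \<le> t a\<^sup>2/2 + b\<^sup>2/(2t)\<close> and optimise in \<open>t\<close>. Adding a small constant to both
  squared norms keeps the optimal \<open>t\<close> positive and finite.\<close>

lemma L2_Cauchy_Schwarz:
  assumes f: "f \<in> L2" and g: "g \<in> L2"
  shows "(LINT x|lebesgue. norm (f x) * norm (g x)) \<le> sqrt (L2sq f) * sqrt (L2sq g)"
proof -
  let ?I = "LINT x|lebesgue. norm (f x) * norm (g x)"
  have *: "?I \<le> t / 2 * a + b / (2 * t)" if t: "t > 0" and ab: "a \<ge> L2sq f" "b \<ge> L2sq g" for t a b
  proof -
    have "?I \<le> (LINT x|lebesgue. t / 2 * norm (f x) ^ 2 + norm (g x) ^ 2 / (2 * t))"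
      using L2_norm_mult_integrable[OF f g] L2_integrable[OF f] L2_integrable[OF g] mult_le_squares[OF t]
      by (intro integral_mono) auto
    also have "\<dots> = t / 2 * L2sq f + L2sq g / (2 * t)"
      using L2_integrable[OF f] L2_integrable[OF g] by (simp add: L2sq_def)
    also have "\<dots> \<le> t / 2 * a + b / (2 * t)"
      using t ab by (intro add_mono mult_left_mono divide_right_mono) auto
    finally show ?thesis .
  qed
  have **: "?I \<le> sqrt a * sqrt b" if "a \<ge> L2sq f" "b \<ge> L2sq g" "a > 0" "b > 0" for a b
  proof -
    have "?I \<le> (sqrt b / sqrt a) / 2 * a + b / (2 * (sqrt b / sqrt a))" by (rule *) (use that in auto)
    also have "\<dots> = sqrt a * sqrt b"
    proof -
      have "(q / p) / 2 * p^2 + q^2 / (2 * (q / p)) = p * q" if "p > 0" "q > 0" for p q :: real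
        using that by (simp add: field_simps power2_eq_square)
      from this[of "sqrt a" "sqrt b"] show ?thesis using that by simp
    qed
    finally show ?thesis .
  qed
  have "((\<lambda>e. sqrt (L2sq f + e) * sqrt (L2sq g + e)) \<longlongrightarrow> sqrt (L2sq f + 0) * sqrt (L2sq g + 0)) (at_right 0)"
    by (intro tendsto_intros)
  moreover have "eventually (\<lambda>e. ?I \<le> sqrt (L2sq f + e) * sqrt (L2sq g + e)) (at_right 0)"
    unfolding eventually_at_filter
    using L2sq_nonneg[of f] L2sq_nonneg[of g] by (auto intro!: always_eventually ** add_nonneg_pos)
  ultimately show ?thesis
    by (intro tendsto_lowerbound[of _ _ "at_right (0::real)"]) auto
qed

lemma L2_weighted_inner:
  assumes f: "f \<in> L2" and g: "g \<in> L2" and b[measurable]: "b \<in> borel_measurable lebesgue"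
    and C: "\<And>x. \<bar>b x\<bar> \<le> C"
  shows "integrable lebesgue (\<lambda>x. b x * (f x \<bullet> g x))"
    and "\<bar>LINT x|lebesgue. b x * (f x \<bullet> g x)\<bar> \<le> C * (sqrt (L2sq f) * sqrt (L2sq g))"
proof -
  note [measurable] = L2_measurable[OF f] L2_measurable[OF g]
  have bd: "\<bar>b x * (f x \<bullet> g x)\<bar> \<le> C * (norm (f x) * norm (g x))" for x
    unfolding abs_mult using C[of x] Cauchy_Schwarz_ineq2[of "f x" "g x"] by (intro mult_mono) auto
  have i: "integrable lebesgue (\<lambda>x. C * (norm (f x) * norm (g x)))"
    using L2_norm_mult_integrable[OF f g] by simp
  show 1: "integrable lebesgue (\<lambda>x. b x * (f x \<bullet> g x))"
    by (rule Bochner_Integration.integrable_bound[OF i]) (auto intro!: AE_I2 order_trans[OF bd abs_ge_self])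
  have C0: "C \<ge> 0" using C[of 0] by linarith
  have "\<bar>LINT x|lebesgue. b x * (f x \<bullet> g x)\<bar> \<le> (LINT x|lebesgue. \<bar>b x * (f x \<bullet> g x)\<bar>)"
    by (rule integral_abs_bound)
  also have "\<dots> \<le> (LINT x|lebesgue. C * (norm (f x) * norm (g x)))"
    using 1 i bd by (intro integral_mono) auto
  also have "\<dots> \<le> C * (sqrt (L2sq f) * sqrt (L2sq g))"
    using L2_Cauchy_Schwarz[OF f g] C0 by (simp add: mult_left_mono)
  finally show "\<bar>LINT x|lebesgue. b x * (f x \<bullet> g x)\<bar> \<le> C * (sqrt (L2sq f) * sqrt (L2sq g))" .
qed

definition L2lim :: "(nat \<Rightarrow> real^3 \<Rightarrow> 'a::euclidean_space) \<Rightarrow> (real^3 \<Rightarrow> 'a) \<Rightarrow> bool" where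
  "L2lim f F \<longleftrightarrow> F \<in> L2 \<and> (\<forall>n. f n \<in> L2) \<and> (\<lambda>n. L2sq (\<lambda>x. f n x - F x)) \<longlonglongrightarrow> 0"

lemma L2lim_L2: "L2lim f F \<Longrightarrow> F \<in> L2" "L2lim f F \<Longrightarrow> f n \<in> L2"
  by (auto simp: L2lim_def)

lemma L2limI_bound:
  assumes "L2lim g G" "F \<in> L2" "\<And>n. f n \<in> L2"
    and le: "\<And>n. L2sq (\<lambda>x. f n x - F x) \<le> C * L2sq (\<lambda>x. g n x - G x)"
  shows "L2lim f F"
proof -
  have "(\<lambda>n. C * L2sq (\<lambda>x. g n x - G x)) \<longlonglongrightarrow> C * 0"
    using assms(1) by (intro tendsto_mult tendsto_const) (simp add: L2lim_def)
  then have "(\<lambda>n. L2sq (\<lambda>x. f n x - F x)) \<longlonglongrightarrow> 0"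
    by (intro tendsto_sandwich[of "\<lambda>n. 0", OF _ always_eventually[OF allI[OF le]]])
       (auto simp: L2sq_nonneg)
  then show ?thesis using assms by (simp add: L2lim_def)
qed

lemma L2sq_mono:
  assumes f: "f \<in> L2" and g: "g \<in> L2" and le: "AE x in lebesgue. norm (g x) \<le> C * norm (f x)"
  shows "L2sq g \<le> C^2 * L2sq f"
proof -
  have "L2sq g \<le> (LINT x|lebesgue. C^2 * norm (f x) ^ 2)"
    unfolding L2sq_def
  proof (rule integral_mono_AE)
    show "AE x in lebesgue. norm (g x) ^ 2 \<le> C^2 * norm (f x) ^ 2"
      using le by eventually_elim (metis norm_ge_zero power_mono power_mult_distrib)
  qed (use L2_integrable[OF f] L2_integrable[OF g] in auto)
  then show ?thesis by (simp add: L2sq_def)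
qed

lemma L2lim_bounded_linear:
  assumes L: "bounded_linear L" and f: "L2lim f F"
  shows "L2lim (\<lambda>n x. L (f n x)) (\<lambda>x. L (F x))"
proof -
  obtain K where K: "\<And>x. norm (L x) \<le> norm x * K" using bounded_linear.bounded[OF L] by blast
  show ?thesis
  proof (rule L2limI_bound[OF f, of _ _ "K^2"])
    fix n
    have "L2sq (\<lambda>x. L (f n x - F x)) \<le> K^2 * L2sq (\<lambda>x. f n x - F x)"
      using f K by (intro L2sq_mono L2_bounded_linear[OF L] L2_diff) (auto simp: L2lim_L2 mult.commute)
    then show "L2sq (\<lambda>x. L (f n x) - L (F x)) \<le> K^2 * L2sq (\<lambda>x. f n x - F x)"
      by (simp add: linear_diff[OF bounded_linear.linear[OF L]])
  qed (use f in \<open>auto intro!: L2_bounded_linear[OF L] simp: L2lim_L2\<close>)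
qed

lemma L2lim_add:
  assumes f: "L2lim f F" and g: "L2lim g G"
  shows "L2lim (\<lambda>n x. f n x + g n x) (\<lambda>x. F x + G x)"
proof -
  have le: "L2sq (\<lambda>x. f n x + g n x - (F x + G x)) \<le> 2 * L2sq (\<lambda>x. f n x - F x) + 2 * L2sq (\<lambda>x. g n x - G x)" for n
    using L2_add(2)[OF L2_diff[OF L2lim_L2(2,1)[OF f]] L2_diff[OF L2lim_L2(2,1)[OF g]]]
    by (simp add: algebra_simps)
  have "(\<lambda>n. 2 * L2sq (\<lambda>x. f n x - F x) + 2 * L2sq (\<lambda>x. g n x - G x)) \<longlonglongrightarrow> 2 * 0 + 2 * 0"
    using f g by (intro tendsto_intros) (auto simp: L2lim_def)
  then have "(\<lambda>n. L2sq (\<lambda>x. f n x + g n x - (F x + G x))) \<longlonglongrightarrow> 0"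
    by (intro tendsto_sandwich[of "\<lambda>n. 0", OF _ always_eventually[OF allI[OF le]]])
       (auto simp: L2sq_nonneg)
  then show ?thesis using L2lim_L2[OF f] L2lim_L2[OF g] by (auto simp: L2lim_def intro: L2_add)
qed

lemma L2lim_const: "F \<in> L2 \<Longrightarrow> L2lim (\<lambda>n. F) F"
  by (simp add: L2lim_def L2sq_def)

lemma L2lim_sum:
  "(\<And>i. i \<in> I \<Longrightarrow> L2lim (f i) (F i)) \<Longrightarrow> L2lim (\<lambda>n x. \<Sum>i\<in>I. f i n x) (\<lambda>x. \<Sum>i\<in>I. F i x)"
  by (induction I rule: infinite_finite_induct)
     (auto simp: L2lim_const[OF L2_zero] L2lim_add)

lemma L2lim_cong_AE:
  assumes f: "L2lim f F" and G: "AE x in lebesgue. F x = G x" "G \<in> borel_measurable lebesgue"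
  shows "L2lim f G"
proof -
  note [measurable] = L2_measurable[OF L2lim_L2(1)[OF f]] L2_measurable[OF L2lim_L2(2)[OF f]] G(2)
  have "L2sq (\<lambda>x. f n x - G x) = L2sq (\<lambda>x. f n x - F x)" for n
    unfolding L2sq_def using G(1) by (intro integral_cong_AE) auto
  moreover have "G \<in> L2" by (rule L2_bound[OF L2lim_L2(1)[OF f] G(2), of 1]) (use G(1) in auto)
  ultimately show ?thesis using f by (simp add: L2lim_def)
qed

lemma L2lim_bounded_sq:
  assumes f: "L2lim f F"
  shows "L2sq (f n) \<le> 2 * L2sq (\<lambda>x. f n x - F x) + 2 * L2sq F"
  using L2_add(2)[OF L2_diff[OF L2lim_L2(2,1)[OF f]] L2lim_L2(1)[OF f]] by simp

text \<open>Every quadratic form that occurs in the virial argument has a bounded weight, and so passes to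
  the limit by this lemma.\<close>

lemma L2lim_inner:
  assumes f: "L2lim f F" and g: "L2lim g G" and b: "b \<in> borel_measurable lebesgue"
    and C: "\<And>x. \<bar>b x\<bar> \<le> C"
  shows "(\<lambda>n. LINT x|lebesgue. b x * (f n x \<bullet> g n x)) \<longlonglongrightarrow> (LINT x|lebesgue. b x * (F x \<bullet> G x))"
proof -
  note L = L2lim_L2[OF f] L2lim_L2[OF g]
  have C0: "C \<ge> 0" using C[of 0] by linarith
  let ?df = "\<lambda>n x. f n x - F x" and ?dg = "\<lambda>n x. g n x - G x"
  have dL: "?df n \<in> L2" "?dg n \<in> L2" for n using L L2_diff by blast+
  have le: "\<bar>(LINT x|lebesgue. b x * (f n x \<bullet> g n x)) - (LINT x|lebesgue. b x * (F x \<bullet> G x))\<bar>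
     \<le> C * (sqrt (L2sq (?df n)) * sqrt (2 * L2sq (?dg n) + 2 * L2sq G)) + C * (sqrt (L2sq F) * sqrt (L2sq (?dg n)))" for n
  proof -
    have "(LINT x|lebesgue. b x * (f n x \<bullet> g n x)) - (LINT x|lebesgue. b x * (F x \<bullet> G x))
       = (LINT x|lebesgue. b x * (f n x \<bullet> g n x) - b x * (F x \<bullet> G x))"
      by (intro Bochner_Integration.integral_diff[symmetric] L2_weighted_inner(1)[OF _ _ b C] L)
    also have "\<dots> = (LINT x|lebesgue. b x * (?df n x \<bullet> g n x) + b x * (F x \<bullet> ?dg n x))"
      by (intro Bochner_Integration.integral_cong) (auto simp: algebra_simps)
    also have "\<dots> = (LINT x|lebesgue. b x * (?df n x \<bullet> g n x)) + (LINT x|lebesgue. b x * (F x \<bullet> ?dg n x))"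
      by (intro Bochner_Integration.integral_add L2_weighted_inner(1)[OF _ _ b C] L dL)
    finally have "\<bar>(LINT x|lebesgue. b x * (f n x \<bullet> g n x)) - (LINT x|lebesgue. b x * (F x \<bullet> G x))\<bar>
       \<le> \<bar>LINT x|lebesgue. b x * (?df n x \<bullet> g n x)\<bar> + \<bar>LINT x|lebesgue. b x * (F x \<bullet> ?dg n x)\<bar>"
      by (simp only: abs_triangle_ineq)
    also have "\<dots> \<le> C * (sqrt (L2sq (?df n)) * sqrt (L2sq (g n))) + C * (sqrt (L2sq F) * sqrt (L2sq (?dg n)))"
      by (intro add_mono L2_weighted_inner(2)[OF _ _ b C] L dL)
    also have "\<dots> \<le> C * (sqrt (L2sq (?df n)) * sqrt (2 * L2sq (?dg n) + 2 * L2sq G)) + C * (sqrt (L2sq F) * sqrt (L2sq (?dg n)))"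
      using C0 L2lim_bounded_sq[OF g] L2sq_nonneg by (intro add_right_mono mult_left_mono) auto
    finally show ?thesis .
  qed
  have "(\<lambda>n. C * (sqrt (L2sq (?df n)) * sqrt (2 * L2sq (?dg n) + 2 * L2sq G)) + C * (sqrt (L2sq F) * sqrt (L2sq (?dg n))))
     \<longlonglongrightarrow> C * (sqrt 0 * sqrt (2 * 0 + 2 * L2sq G)) + C * (sqrt (L2sq F) * sqrt 0)"
    using f g by (intro tendsto_intros) (auto simp: L2lim_def)
  then have "(\<lambda>n. C * (sqrt (L2sq (?df n)) * sqrt (2 * L2sq (?dg n) + 2 * L2sq G)) + C * (sqrt (L2sq F) * sqrt (L2sq (?dg n)))) \<longlonglongrightarrow> 0"
    by simp
  from tendsto_sandwich[of "\<lambda>n. 0", OF _ always_eventually[OF allI[OF le]] tendsto_const this]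
  have "(\<lambda>n. \<bar>(LINT x|lebesgue. b x * (f n x \<bullet> g n x)) - (LINT x|lebesgue. b x * (F x \<bullet> G x))\<bar>) \<longlonglongrightarrow> 0"
    by simp
  then show ?thesis by (rule LIM_zero_cancel[OF tendsto_rabs_zero_cancel])
qed

lemma L2lim_L2sq:
  assumes "L2lim f F" shows "(\<lambda>n. L2sq (f n)) \<longlonglongrightarrow> L2sq F"
  using L2lim_inner[OF assms assms, of "\<lambda>x. 1" 1]
  by (simp add: L2sq_def power2_norm_eq_inner)

lemma L2lim_AE_subseq:
  assumes f: "L2lim f F"
  obtains r :: "nat \<Rightarrow> nat" where "strict_mono r" "AE x in lebesgue. (\<lambda>n. f (r n) x) \<longlonglongrightarrow> F x"
proof -
  have "\<exists>r::nat\<Rightarrow>nat. strict_mono r \<and> (AE x in lebesgue. (\<lambda>n. norm (f (r n) x - F x) ^ 2) \<longlonglongrightarrow> 0)"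
  proof (rule tendsto_L1_AE_subseq)
    show "integrable lebesgue (\<lambda>x. norm (f n x - F x) ^ 2)" for n
      by (rule L2_integrable[OF L2_diff[OF L2lim_L2(2,1)[OF f]]])
    show "(\<lambda>n. LINT x|lebesgue. norm (norm (f n x - F x) ^ 2)) \<longlonglongrightarrow> 0"
      using f by (simp add: L2lim_def L2sq_def)
  qed
  then obtain r :: "nat \<Rightarrow> nat" where r: "strict_mono r" "AE x in lebesgue. (\<lambda>n. norm (f (r n) x - F x) ^ 2) \<longlonglongrightarrow> 0"
    by blast
  from r(2) have "AE x in lebesgue. (\<lambda>n. f (r n) x) \<longlonglongrightarrow> F x"
  proof eventually_elim
    case (elim x)
    then have "(\<lambda>n. sqrt (norm (f (r n) x - F x) ^ 2)) \<longlonglongrightarrow> sqrt 0" by (intro tendsto_intros)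
    then show ?case by (simp add: tendsto_norm_zero_iff LIM_zero_iff)
  qed
  with r(1) show ?thesis by (rule that)
qed

lemma L2lim_dominated:
  assumes f[measurable]: "\<And>n. f n \<in> borel_measurable lebesgue" and F[measurable]: "F \<in> borel_measurable lebesgue"
    and h: "h \<in> L2" and le: "\<And>n. AE x in lebesgue. norm (f n x) \<le> norm (h x)"
    and lim: "AE x in lebesgue. (\<lambda>n. f n x) \<longlonglongrightarrow> F x"
  shows "L2lim f F"
proof -
  have fL: "f n \<in> L2" for n by (rule L2_bound[OF h f, of _ 1]) (use le in auto)
  have leA: "AE x in lebesgue. \<forall>n. norm (f n x) \<le> norm (h x)" using le by (simp add: AE_all_countable)
  have leF: "AE x in lebesgue. norm (F x) \<le> norm (h x)"
    using leA lim
  proof eventually_elim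
    case (elim x)
    then show ?case by (intro tendsto_upperbound[OF tendsto_norm[OF elim(2)]]) auto
  qed
  have FL: "F \<in> L2" by (rule L2_bound[OF h F, of 1]) (use leF in auto)
  have "(\<lambda>n. LINT x|lebesgue. norm (f n x - F x) ^ 2) \<longlonglongrightarrow> (LINT x::real^3|lebesgue. (0::real))"
  proof (rule integral_dominated_convergence)
    show "integrable lebesgue (\<lambda>x. 4 * norm (h x) ^ 2)" using L2_integrable[OF h] by simp
    show "AE x in lebesgue. (\<lambda>n. norm (f n x - F x) ^ 2) \<longlonglongrightarrow> 0"
      using lim
    proof eventually_elim
      case (elim x)
      then have "(\<lambda>n. norm (f n x - F x) ^ 2) \<longlonglongrightarrow> norm (F x - F x) ^ 2" by (intro tendsto_intros)
      then show ?case by simp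
    qed
    show "AE x in lebesgue. norm (norm (f n x - F x) ^ 2) \<le> 4 * norm (h x) ^ 2" for n
      using leA leF
    proof eventually_elim
      case (elim x)
      have "norm (f n x - F x) \<le> norm (h x) + norm (h x)"
        using elim by (intro order_trans[OF norm_triangle_ineq4 add_mono]) auto
      then have "norm (f n x - F x) ^ 2 \<le> (2 * norm (h x)) ^ 2" by (intro power_mono) auto
      then show ?case by (simp add: power_mult_distrib)
    qed
  qed auto
  then show ?thesis using fL FL by (simp add: L2lim_def L2sq_def)
qed

section \<open>Mollification\<close>

definition conv :: "(real^3 \<Rightarrow> real) \<Rightarrow> (real^3 \<Rightarrow> 'a::euclidean_space) \<Rightarrow> real^3 \<Rightarrow> 'a" where
  "conv \<psi> f z = (LINT y|lebesgue. \<psi> (z - y) *\<^sub>R f y)"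

lemma bounded_range_compact_support:
  fixes f :: "real^3 \<Rightarrow> 'a::real_normed_vector"
  assumes f: "continuous_on UNIV f" and b: "bounded {x. f x \<noteq> 0}"
  obtains C where "C \<ge> 0" "\<And>x. norm (f x) \<le> C"
proof -
  let ?K = "closure {x. f x \<noteq> 0}"
  have "compact (f ` ?K)"
    using b by (intro compact_continuous_image continuous_on_subset[OF f]) (auto simp: compact_closure)
  then obtain C where C: "C > 0" "\<And>y. y \<in> f ` ?K \<Longrightarrow> norm y \<le> C"
    using compact_imp_bounded bounded_pos by metis
  have "norm (f x) \<le> C" for x
    using C closure_subset[of "{x. f x \<noteq> 0}"] by (cases "f x = 0") auto
  then show ?thesis using C(1) by (intro that[of C]) auto
qed

lemma continuous_lebesgue_measurable:
  "continuous_on UNIV f \<Longrightarrow> (f :: real^3 \<Rightarrow> 'a::euclidean_space) \<in> borel_measurable lebesgue"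
  by (intro measurable_completion) (simp add: borel_measurable_continuous_onI)

lemma conv_integrable:
  fixes \<psi> :: "real^3 \<Rightarrow> real" and f :: "real^3 \<Rightarrow> 'a::euclidean_space"
  assumes c: "continuous_on UNIV \<psi>" and b: "bounded {x. \<psi> x \<noteq> 0}" and f: "integrable lebesgue f"
  shows "integrable lebesgue (\<lambda>y. \<psi> (z - y) *\<^sub>R f y)"
proof -
  obtain C where C: "C \<ge> 0" "\<And>x. norm (\<psi> x) \<le> C" by (rule bounded_range_compact_support[OF c b]) blast
  have [measurable]: "(\<lambda>y. \<psi> (z - y)) \<in> borel_measurable lebesgue"
    by (intro continuous_lebesgue_measurable continuous_on_compose2[OF c] continuous_intros) auto
  note [measurable] = borel_measurable_integrable[OF f]
  show ?thesis
  proof (rule Bochner_Integration.integrable_bound[OF integrable_mult_right[OF integrable_norm[OF f], of C]])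
    have "\<bar>\<psi> (z - y)\<bar> * norm (f y) \<le> C * norm (f y)" for y
      using C(2)[of "z - y"] by (intro mult_right_mono) auto
    then show "AE y in lebesgue. norm (\<psi> (z - y) *\<^sub>R f y) \<le> norm (C * norm (f y))"
      using C(1) by (simp add: abs_mult)
  qed simp
qed

text \<open>The uniform linear approximation of \<open>\<psi>\<close> is integrated against \<open>f\<close>.\<close>

lemma conv_has_derivative:
  assumes \<psi>: "C_k (Suc 0) \<psi>" and b: "bounded {x. \<psi> x \<noteq> 0}" and f: "integrable lebesgue f"
  shows "(conv \<psi> f has_derivative (\<lambda>h. \<Sum>k\<in>UNIV. h $ k *\<^sub>R conv (partial k \<psi>) f z)) (at z)"
  unfolding has_derivative_at_alt
proof (intro conjI allI impI)
  show "bounded_linear (\<lambda>h. \<Sum>k\<in>UNIV. h $ k *\<^sub>R conv (partial k \<psi>) f z)"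
    by (intro bounded_linear_sum bounded_linear_scaleR_const bounded_linear_vec_nth)
  let ?I = "LINT y|lebesgue. norm (f y)"
  have I: "?I \<ge> 0" by simp
  fix e :: real assume e: "e > 0"
  have e': "e / (?I + 1) > 0" by (intro divide_pos_pos e add_nonneg_pos I) simp
  obtain d where d: "d > 0"
    "\<And>z h. norm h < d \<Longrightarrow> norm (\<psi> (z + h) - \<psi> z - (\<Sum>k\<in>UNIV. h $ k *\<^sub>R partial k \<psi> z)) \<le> e / (?I + 1) * norm h"
    by (rule uniformly_differentiable[OF \<psi> b e']) blast
  have c: "continuous_on UNIV \<psi>" "\<And>k. continuous_on UNIV (partial k \<psi>)"
    using C_k_continuous[OF \<psi>] \<psi> by simp_all
  note i = conv_integrable[OF c(1) b f] conv_integrable[OF c(2) bounded_support_partial[OF b] f]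
  show "\<exists>d>0. \<forall>y. norm (y - z) < d \<longrightarrow>
      norm (conv \<psi> f y - conv \<psi> f z - (\<Sum>k\<in>UNIV. (y - z) $ k *\<^sub>R conv (partial k \<psi>) f z)) \<le> e * norm (y - z)"
  proof (intro exI[of _ d] conjI d(1) allI impI)
    fix y assume "norm (y - z) < d"
    define h where "h = y - z"
    have h: "norm h < d" "y = z + h" using \<open>norm (y - z) < d\<close> by (auto simp: h_def)
    let ?q = "\<lambda>y. \<psi> (z - y + h) - \<psi> (z - y) - (\<Sum>k\<in>UNIV. h $ k *\<^sub>R partial k \<psi> (z - y))"
    have zh: "z + h - w = z - w + h" for w by simp
    have i1: "integrable lebesgue (\<lambda>w. \<psi> (z - w + h) *\<^sub>R f w)"
      using i(1)[of "z + h"] unfolding zh .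
    have i2: "integrable lebesgue (\<lambda>w. \<Sum>k\<in>UNIV. h $ k *\<^sub>R (partial k \<psi> (z - w) *\<^sub>R f w))"
      by (intro Bochner_Integration.integrable_sum integrable_scaleR_right i)
    have q: "?q w *\<^sub>R f w = \<psi> (z - w + h) *\<^sub>R f w - \<psi> (z - w) *\<^sub>R f w
       - (\<Sum>k\<in>UNIV. h $ k *\<^sub>R (partial k \<psi> (z - w) *\<^sub>R f w))" for w
      by (simp add: scaleR_diff_left scaleR_sum_left)
    have iq: "integrable lebesgue (\<lambda>w. ?q w *\<^sub>R f w)"
      unfolding q by (intro Bochner_Integration.integrable_diff i1 i2 i)
    have i3: "(LINT w|lebesgue. (\<Sum>k\<in>UNIV. h $ k *\<^sub>R (partial k \<psi> (z - w) *\<^sub>R f w)))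
        = (\<Sum>k\<in>UNIV. h $ k *\<^sub>R (LINT w|lebesgue. partial k \<psi> (z - w) *\<^sub>R f w))"
      by (subst Bochner_Integration.integral_sum) (auto intro!: integrable_scaleR_right i simp del: scaleR_scaleR)
    have eq: "conv \<psi> f y - conv \<psi> f z - (\<Sum>k\<in>UNIV. h $ k *\<^sub>R conv (partial k \<psi>) f z)
       = (LINT w|lebesgue. ?q w *\<^sub>R f w)"
      unfolding q conv_def h(2) zh i3[symmetric] using i i1 i2
      by (simp del: scaleR_scaleR)
    have "norm (LINT w|lebesgue. ?q w *\<^sub>R f w) \<le> (LINT w|lebesgue. norm (?q w *\<^sub>R f w))" by (rule integral_norm_bound)
    also have "\<dots> \<le> (LINT w|lebesgue. (e / (?I + 1) * norm h) * norm (f w))"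
    proof (intro integral_mono integrable_norm iq integrable_mult_right f)
      fix w show "norm (?q w *\<^sub>R f w) \<le> (e / (?I + 1) * norm h) * norm (f w)"
        unfolding norm_scaleR using d(2)[OF h(1), of "z - w"] by (intro mult_right_mono) auto
    qed
    also have "\<dots> = e * norm h * (?I / (?I + 1))" by simp
    also have "\<dots> \<le> e * norm h * 1"
    proof (intro mult_left_mono)
      have "?I + 1 > 0" using I by linarith
      then show "?I / (?I + 1) \<le> 1" by (subst pos_divide_le_eq) auto
    qed (use e in auto)
    finally show "norm (conv \<psi> f y - conv \<psi> f z - (\<Sum>k\<in>UNIV. (y - z) $ k *\<^sub>R conv (partial k \<psi>) f z))
       \<le> e * norm (y - z)" unfolding h_def[symmetric] eq by simp
  qed
qed

lemma partial_conv:
  assumes "\<psi> \<in> C0_infinity" "integrable lebesgue f"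
  shows "partial k (conv \<psi> f) = conv (partial k \<psi>) f"
proof
  fix z
  show "partial k (conv \<psi> f) z = conv (partial k \<psi>) f z"
    by (subst partial_eqI[OF conv_has_derivative[OF C0_C_k[OF assms(1)] C0_bounded_support[OF assms(1)] assms(2)]])
       (simp add: axis_def if_distrib if_distribR sum.delta cong: if_cong)
qed

lemma conv_C_k: "\<psi> \<in> C0_infinity \<Longrightarrow> integrable lebesgue f \<Longrightarrow> C_k n (conv \<psi> f)"
proof (induction n arbitrary: \<psi>)
  case 0
  have "conv \<psi> f differentiable at z" for z
    by (rule differentiableI[OF conv_has_derivative[OF C0_C_k C0_bounded_support]]) (use 0 in auto)
  then show ?case by (auto simp: differentiable_imp_continuous_within intro!: continuous_at_imp_continuous_on)
next
  case (Suc n)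
  have "conv \<psi> f differentiable at z" for z
    by (rule differentiableI[OF conv_has_derivative[OF C0_C_k C0_bounded_support]]) (use Suc in auto)
  then show ?case using Suc.IH[OF C0_partial[OF Suc.prems(1)] Suc.prems(2)] partial_conv[OF Suc.prems]
    by simp
qed

lemma conv_eq_0:
  assumes "\<And>x. norm x \<ge> r \<Longrightarrow> \<psi> x = 0" "\<And>x. norm x > M \<Longrightarrow> f x = 0" "norm z > M + r"
  shows "conv \<psi> f z = 0"
proof -
  have "\<psi> (z - y) *\<^sub>R f y = 0" for y
  proof (cases "norm y > M")
    case False
    then have "norm (z - y) \<ge> r" using norm_triangle_ineq2[of z y] assms(3) by simp
    then show ?thesis using assms(1) by simp
  qed (use assms(2) in simp)
  then have "(\<lambda>y. \<psi> (z - y) *\<^sub>R f y) = (\<lambda>y. 0)" by (rule ext)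
  then show ?thesis unfolding conv_def by (simp only: integral_zero)
qed

lemma conv_C0:
  assumes \<psi>: "\<psi> \<in> C0_infinity" and f: "integrable lebesgue f" and b: "bounded {x. f x \<noteq> 0}"
  shows "conv \<psi> f \<in> C0_infinity"
proof -
  obtain M where M: "\<And>x. f x \<noteq> 0 \<Longrightarrow> norm x \<le> M" using b by (auto simp: bounded_iff)
  obtain r where r: "\<And>x. \<psi> x \<noteq> 0 \<Longrightarrow> norm x \<le> r"
    using C0_bounded_support[OF \<psi>] by (auto simp: bounded_iff)
  have "norm z \<le> M + (r + 1)" if "conv \<psi> f z \<noteq> 0" for z
  proof (rule ccontr)
    assume "\<not> norm z \<le> M + (r + 1)"
    then have "conv \<psi> f z = 0" by (intro conv_eq_0[of "r+1" _ M]) (use M r in force)+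
    with that show False by simp
  qed
  then have "bounded {z. conv \<psi> f z \<noteq> 0}" unfolding bounded_iff by blast
  then show ?thesis using conv_C_k[OF \<psi> f] by (simp add: C0_infinity_iff)
qed

text \<open>The function \<open>y \<mapsto> \<psi> (z - y)\<close> is a test function, and its partial derivative carries the opposite
  sign.\<close>

lemma conv_weak_partial:
  assumes \<psi>: "\<psi> \<in> C0_infinity" and w: "weak_partial k u h"
  shows "conv (partial k \<psi>) u = conv \<psi> h"
proof
  fix z
  let ?\<phi> = "\<lambda>y. \<psi> (z + (-1) *\<^sub>R y)"
  have \<phi>: "?\<phi> \<in> C0_infinity" by (rule C0_affine[OF _ \<psi>]) simp
  have p: "partial k ?\<phi> y = - partial k \<psi> (z - y)" for y
    using partial_affine[of \<psi> z "-1" y k] C0_differentiable[OF \<psi>] by simp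
  have "(LINT y|lebesgue. partial k ?\<phi> y *\<^sub>R u y) = - (LINT y|lebesgue. ?\<phi> y *\<^sub>R h y)"
    using w \<phi> unfolding weak_partial_def by blast
  then show "conv (partial k \<psi>) u z = conv \<psi> h z" unfolding p by (simp add: conv_def)
qed

definition mollifier :: "nat \<Rightarrow> real^3 \<Rightarrow> real" where
  "mollifier n x = bump (real (Suc n) *\<^sub>R x) / (LINT y|lborel. bump (real (Suc n) *\<^sub>R y))"

lemma scaled_bump_C0: "s \<noteq> 0 \<Longrightarrow> (\<lambda>x. bump (s *\<^sub>R x)) \<in> C0_infinity"
  using C0_affine[OF _ bump_C0, of s 0] by simp

lemma integral_scaled_bump_pos:
  assumes "s > 0" shows "(LINT x|lborel. bump (s *\<^sub>R x)) > 0"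
proof -
  have "isCont bump 0" using C0_continuous[OF bump_C0] by (simp add: continuous_on_eq_continuous_at)
  then obtain d where d: "d > 0" "\<And>x. dist x 0 < d \<Longrightarrow> dist (bump x) (bump 0) < 1/2"
    unfolding continuous_at_eps_delta by (metis half_gt_zero zero_less_one)
  have i: "integrable lborel (\<lambda>x. bump (s *\<^sub>R x))"
    using scaled_bump_C0[of s] assms by (intro integrable_compact_support C0_continuous C0_bounded_support) auto
  have "0 < measure lborel (ball (0::real^3) (d / s)) * (1/2)" using assms d by (simp add: content_ball_pos)
  also have "\<dots> = (LINT x::real^3|lborel. indicator (ball 0 (d / s)) x * (1/2))" by simp
  also have "\<dots> \<le> (LINT x|lborel. bump (s *\<^sub>R x))"
  proof (rule integral_mono[OF _ i])
    show "integrable lborel (\<lambda>x::real^3. indicator (ball 0 (d / s)) x * (1/2) :: real)"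
      by (auto intro!: integrable_real_indicator emeasure_bounded_finite)
    fix x :: "real^3"
    show "indicator (ball 0 (d / s)) x * (1/2) \<le> bump (s *\<^sub>R x)"
    proof (cases "x \<in> ball 0 (d / s)")
      case True
      then have "norm (s *\<^sub>R x) < d" using assms by (simp add: field_simps)
      then have "\<bar>bump (s *\<^sub>R x) - 1\<bar> < 1/2" using d(2)[of "s *\<^sub>R x"] by (simp add: bump_0 dist_norm)
      then have "1/2 \<le> bump (s *\<^sub>R x)" by arith
      then show ?thesis using True by simp
    qed (simp add: bump_nonneg)
  qed
  finally show ?thesis .
qed

lemma mollifier_nonneg: "mollifier n x \<ge> 0"
  using integral_scaled_bump_pos[of "real (Suc n)"] by (simp add: mollifier_def bump_nonneg)

lemma mollifier_C0: "mollifier n \<in> C0_infinity"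
proof -
  have "(\<lambda>x. bump (real (Suc n) *\<^sub>R x) * (1 / (LINT y|lborel. bump (real (Suc n) *\<^sub>R y)))) \<in> C0_infinity"
    by (intro C0_mult scaled_bump_C0 C_k_const) simp
  then show ?thesis by (simp add: mollifier_def[abs_def])
qed

lemmas mollifier_continuous = C0_continuous[OF mollifier_C0]
lemmas mollifier_bounded_support = C0_bounded_support[OF mollifier_C0]

lemma mollifier_measurable[measurable]: "mollifier n \<in> borel_measurable borel"
  by (intro borel_measurable_continuous_onI mollifier_continuous)

lemma mollifier_eq_0: "norm x \<ge> 1 / real (Suc n) \<Longrightarrow> mollifier n x = 0"
  unfolding mollifier_def by (subst bump_eq_0) (auto simp: field_simps simp del: of_nat_Suc)

lemma integral_mollifier: "(LINT x|lborel. mollifier n x) = 1"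
  using integral_scaled_bump_pos[of "real (Suc n)"] by (simp add: mollifier_def)

lemma integral_mollifier_shift:
  "(LINT y|lborel. mollifier n (z - y)) = 1" "(LINT x|lborel. mollifier n (x - y)) = 1"
proof -
  show "(LINT x|lborel. mollifier n (x - y)) = 1"
    using integral_translation[of "mollifier n" "- y"] by (simp add: integral_mollifier)
  have b: "mollifier n (- x) = mollifier n x" for x by (simp add: mollifier_def bump_def)
  have "mollifier n (z - y) = mollifier n (- z + y)" for y using b[of "z - y"] by simp
  then show "(LINT y|lborel. mollifier n (z - y)) = 1"
    using integral_translation[of "mollifier n" "- z"] by (simp add: integral_mollifier)
qed

lemma mollifier_shift_integrable:
  "integrable lborel (\<lambda>y. mollifier n (z - y))" "integrable lborel (\<lambda>x. mollifier n (x - y))"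
  using integral_mollifier_shift not_integrable_integral_eq by fastforce+

text \<open>Fubini needs joint measurability of \<open>(x, y) \<mapsto> g y\<close> in the product of Borel algebras. Replacing \<open>g\<close>
  by a Borel representative changes neither side, as the convolution does not see null sets.\<close>

lemma conv_integral:
  fixes g :: "real^3 \<Rightarrow> real"
  assumes g: "integrable lebesgue g"
  shows "integrable lebesgue (conv (mollifier n) g)"
    and "(LINT x|lebesgue. conv (mollifier n) g x) = (LINT x|lebesgue. g x)"
proof -
  obtain g' where g'[measurable]: "g' \<in> borel_measurable lborel" and ae: "AE x in lborel. g x = g' x"
    using completion_ex_borel_measurable_real[OF borel_measurable_integrable[OF g]] by blast
  have ae': "AE x in lebesgue. g x = g' x" using ae by (rule AE_completion)
  have gm[measurable]: "g' \<in> borel_measurable lebesgue" by (intro measurable_completion g')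
  note [measurable] = borel_measurable_integrable[OF g]
  have ig: "integrable lborel g'"
  proof -
    have "integrable lebesgue g'" using g by (rule integrable_cong_AE_imp) (use ae' in auto)
    then show ?thesis by (simp add: integrable_completion)
  qed
  let ?F = "\<lambda>y x. mollifier n (x - y) * g' y"
  have int: "integrable (lborel \<Otimes>\<^sub>M lborel) (case_prod ?F)"
  proof (rule lborel_pair.Fubini_integrable)
    show "case_prod ?F \<in> borel_measurable (lborel \<Otimes>\<^sub>M lborel)" by measurable
    show "integrable lborel (\<lambda>y. LINT x|lborel. norm (case_prod ?F (y, x)))"
      using ig by (simp add: abs_mult mollifier_nonneg integral_mollifier_shift)
    show "AE y in lborel. integrable lborel (\<lambda>x. case_prod ?F (y, x))"
      by (simp add: mollifier_shift_integrable)
  qed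
  have c: "conv (mollifier n) g x = (LINT y|lborel. ?F y x)" for x
  proof -
    have [measurable]: "(\<lambda>y. mollifier n (x - y)) \<in> borel_measurable lebesgue"
      by (intro measurable_completion) simp
    have "conv (mollifier n) g x = (LINT y|lebesgue. ?F y x)"
      unfolding conv_def by (intro integral_cong_AE) (use ae' in auto)
    also have "\<dots> = (LINT y|lborel. ?F y x)" by (rule integral_completion) simp
    finally show ?thesis .
  qed
  have "integrable lborel (\<lambda>x. LINT y|lborel. ?F y x)"
    using lborel_pair.integrable_snd[OF int] by simp
  then have i: "integrable lborel (conv (mollifier n) g)" by (simp add: c[abs_def])
  then show "integrable lebesgue (conv (mollifier n) g)"
    by (simp add: integrable_completion borel_measurable_integrable)
  have "(LINT x|lebesgue. conv (mollifier n) g x) = (LINT x|lborel. conv (mollifier n) g x)"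
    using i by (intro integral_completion) (simp add: borel_measurable_integrable)
  also have "\<dots> = (LINT x|lborel. LINT y|lborel. ?F y x)" by (simp add: c)
  also have "\<dots> = (LINT y|lborel. LINT x|lborel. ?F y x)" by (rule lborel_pair.Fubini_integral[OF int])
  also have "\<dots> = (LINT y|lborel. g' y)" by (simp add: integral_mollifier_shift)
  also have "\<dots> = (LINT y|lebesgue. g' y)" by (rule integral_completion[symmetric]) simp
  also have "\<dots> = (LINT y|lebesgue. g y)" by (intro integral_cong_AE) (use ae' in auto)
  finally show "(LINT x|lebesgue. conv (mollifier n) g x) = (LINT x|lebesgue. g x)" .
qed

lemma lebesgue_mollifier_shift:
  "integrable lebesgue (\<lambda>y. mollifier n (z - y))" "(LINT y|lebesgue. mollifier n (z - y)) = 1"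
  using mollifier_shift_integrable(1)[of n z] integral_mollifier_shift(1)[of n z]
  by (simp_all add: integrable_completion integral_completion)

text \<open>The mollifier is a probability density. For \<open>p = 2\<close> the claim says that the variance of
  \<open>\<bar>f\<bar>\<close> with respect to this density is nonnegative.\<close>

lemma conv_Jensen:
  fixes f :: "real^3 \<Rightarrow> 'a::euclidean_space"
  assumes f: "integrable lebesgue f" and p: "p = 1 \<or> p = 2" and fp: "integrable lebesgue (\<lambda>x. norm (f x) ^ p)"
  shows "norm (conv (mollifier n) f z) ^ p \<le> conv (mollifier n) (\<lambda>x. norm (f x) ^ p) z"
proof -
  note ci = conv_integrable[OF mollifier_continuous mollifier_bounded_support]
  let ?m = "conv (mollifier n) (\<lambda>x. norm (f x)) z"
  have "norm (conv (mollifier n) f z) \<le> (LINT y|lebesgue. norm (mollifier n (z - y) *\<^sub>R f y))"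
    unfolding conv_def by (rule integral_norm_bound)
  also have "\<dots> = ?m" by (simp add: conv_def mollifier_nonneg)
  finally have 1: "norm (conv (mollifier n) f z) \<le> ?m" .
  show ?thesis
  proof (cases "p = 1")
    case True with 1 show ?thesis by simp
  next
    case False
    with p have p2: "p = 2" by simp
    have i1: "integrable lebesgue (\<lambda>y. mollifier n (z - y) * norm (f y))"
      using ci[OF integrable_norm[OF f]] by simp
    have i2: "integrable lebesgue (\<lambda>y. mollifier n (z - y) * norm (f y) ^ 2)"
      using ci[OF fp] by (simp add: p2)
    have "0 \<le> (LINT y|lebesgue. mollifier n (z - y) * (norm (f y) - ?m) ^ 2)"
      by (intro Bochner_Integration.integral_nonneg) (simp add: mollifier_nonneg)
    also have "\<dots> = (LINT y|lebesgue. mollifier n (z - y) * norm (f y) ^ 2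
        - 2 * ?m * (mollifier n (z - y) * norm (f y)) + ?m^2 * mollifier n (z - y))"
      by (intro Bochner_Integration.integral_cong) (auto simp: power2_diff algebra_simps)
    also have "\<dots> = conv (mollifier n) (\<lambda>x. norm (f x) ^ 2) z - 2 * ?m * ?m + ?m^2"
      using i1 i2 lebesgue_mollifier_shift by (simp add: conv_def)
    finally have "?m^2 \<le> conv (mollifier n) (\<lambda>x. norm (f x) ^ 2) z" by (simp add: power2_eq_square)
    moreover have "norm (conv (mollifier n) f z) ^ 2 \<le> ?m^2" using 1 by (intro power_mono) auto
    ultimately show ?thesis by (simp add: p2)
  qed
qed

lemma conv_measurable[measurable]:
  "integrable lebesgue f \<Longrightarrow> conv (mollifier n) f \<in> borel_measurable lebesgue"
  by (intro continuous_lebesgue_measurable C_k_continuous[OF conv_C_k[OF mollifier_C0]])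

lemma conv_Young:
  fixes f :: "real^3 \<Rightarrow> 'a::euclidean_space"
  assumes f: "integrable lebesgue f" and p: "p = 1 \<or> p = 2" and fp: "integrable lebesgue (\<lambda>x. norm (f x) ^ p)"
  shows "integrable lebesgue (\<lambda>x. norm (conv (mollifier n) f x) ^ p)"
    and "(LINT x|lebesgue. norm (conv (mollifier n) f x) ^ p) \<le> (LINT x|lebesgue. norm (f x) ^ p)"
proof -
  note [measurable] = conv_measurable[OF f]
  show i: "integrable lebesgue (\<lambda>x. norm (conv (mollifier n) f x) ^ p)"
    by (rule Bochner_Integration.integrable_bound[OF conv_integral(1)[OF fp]])
       (auto intro!: AE_I2 order_trans[OF conv_Jensen[OF assms] abs_ge_self])
  have "(LINT x|lebesgue. norm (conv (mollifier n) f x) ^ p) \<le> (LINT x|lebesgue. conv (mollifier n) (\<lambda>x. norm (f x) ^ p) x)"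
    by (intro integral_mono i conv_integral(1)[OF fp] conv_Jensen[OF assms])
  then show "(LINT x|lebesgue. norm (conv (mollifier n) f x) ^ p) \<le> (LINT x|lebesgue. norm (f x) ^ p)"
    by (simp add: conv_integral(2)[OF fp])
qed

section \<open>Convergence of mollifications\<close>

lemma integrable_indicator_cball: "integrable lebesgue (\<lambda>x::real^3. c * indicator (cball a r) x :: real)"
proof (intro integrable_mult_right integrable_real_indicator)
  show "emeasure lebesgue (cball a r) < \<infinity>"
    using emeasure_bounded_finite[OF bounded_cball, of a r] by simp
qed simp

text \<open>Continuous truncations of the values and of the domain of a function.\<close>

definition clip :: "real \<Rightarrow> 'a::real_normed_vector \<Rightarrow> 'a" where
  "clip m v = (m / max m (norm v)) *\<^sub>R v"

definition cutoff :: "real \<Rightarrow> 'a::real_normed_vector \<Rightarrow> real" where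
  "cutoff m x = max 0 (min 1 (m + 1 - norm x))"

lemma clip_le: "m > 0 \<Longrightarrow> norm (clip m v) \<le> m" "m > 0 \<Longrightarrow> norm (clip m v) \<le> norm v"
proof -
  assume m: "m > 0"
  have M: "0 < max m (norm v)" "m \<le> max m (norm v)" "norm v \<le> max m (norm v)" using m by auto
  have "norm (clip m v) = m * norm v / max m (norm v)" using m by (simp add: clip_def)
  moreover have "m * norm v \<le> m * max m (norm v)" "m * norm v \<le> norm v * max m (norm v)"
    using M m by (auto intro: mult_left_mono simp: mult.commute[of m] intro!: mult_left_mono)
  ultimately show "norm (clip m v) \<le> m" "norm (clip m v) \<le> norm v"
    using M by (simp_all add: pos_divide_le_eq)
qed

lemma clip_eq: "m > 0 \<Longrightarrow> norm v \<le> m \<Longrightarrow> clip m v = v"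
  by (simp add: clip_def max_absorb1)

lemma continuous_clip: "m > 0 \<Longrightarrow> continuous_on UNIV (clip m)"
  unfolding clip_def by (intro continuous_intros) (auto simp: max_def)

lemma cutoff_bounds: "0 \<le> cutoff m x" "cutoff m x \<le> 1" and cutoff_eq: "norm x \<le> m \<Longrightarrow> cutoff m x = 1"
  and cutoff_0: "norm x > m + 1 \<Longrightarrow> cutoff m x = 0"
  by (auto simp: cutoff_def)

lemma continuous_cutoff: "continuous_on UNIV (cutoff m)"
  unfolding cutoff_def by (intro continuous_intros)

lemma norm_diff_power_le:
  assumes "norm (a::'a::real_normed_vector) \<le> c" "norm b \<le> c"
  shows "norm (a - b) ^ p \<le> 2 ^ p * c ^ p"
proof -
  have "norm (a - b) \<le> 2 * c" using norm_triangle_ineq4[of a b] assms by simp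
  then have "norm (a - b) ^ p \<le> (2 * c) ^ p" by (intro power_mono) auto
  then show ?thesis by (simp add: power_mult_distrib)
qed

lemma integral_norm_power_tendsto_0:
  fixes f :: "nat \<Rightarrow> real^3 \<Rightarrow> 'a::euclidean_space"
  assumes [measurable]: "\<And>n. f n \<in> borel_measurable lebesgue" "F \<in> borel_measurable lebesgue"
    and p: "p > 0" and h: "integrable lebesgue (\<lambda>x. h x ^ p)"
    and le: "\<And>n x. norm (f n x) \<le> h x"
    and leF: "AE x in lebesgue. norm (F x) \<le> h x"
    and lim: "AE x in lebesgue. (\<lambda>n. f n x) \<longlonglongrightarrow> F x"
  shows "(\<lambda>n. LINT x|lebesgue. norm (f n x - F x) ^ p) \<longlonglongrightarrow> 0"
    and "integrable lebesgue (\<lambda>x. norm (f n x - F x) ^ p)"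
proof -
  have i: "integrable lebesgue (\<lambda>x. 2 ^ p * h x ^ p)" using h by simp
  have bd: "AE x in lebesgue. norm (norm (f n x - F x) ^ p) \<le> 2 ^ p * h x ^ p" for n
    using leF
  proof eventually_elim
    case (elim x)
    show ?case using norm_diff_power_le[OF le elim, of n p] by simp
  qed
  have "(\<lambda>n. LINT x|lebesgue. norm (f n x - F x) ^ p) \<longlonglongrightarrow> (LINT x::real^3|lebesgue. (0::real))"
  proof (rule integral_dominated_convergence[OF _ _ i _ bd])
    show "AE x in lebesgue. (\<lambda>n. norm (f n x - F x) ^ p) \<longlonglongrightarrow> 0"
      using lim
    proof eventually_elim
      case (elim x)
      then have "(\<lambda>n. norm (f n x - F x) ^ p) \<longlonglongrightarrow> norm (F x - F x) ^ p" by (intro tendsto_intros)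
      then show ?case using p by (simp only: diff_self norm_zero zero_power)
    qed
  qed auto
  then show "(\<lambda>n. LINT x|lebesgue. norm (f n x - F x) ^ p) \<longlonglongrightarrow> 0" by simp
  show "integrable lebesgue (\<lambda>x. norm (f n x - F x) ^ p)"
    by (rule Bochner_Integration.integrable_bound[OF i]) (use bd[of n] in \<open>auto elim!: eventually_mono\<close>)
qed

lemma norm_add_power_le:
  assumes p: "p = 1 \<or> p = 2"
  shows "norm (a + b) ^ p \<le> 2 * norm a ^ p + 2 * norm (b::'a::real_normed_vector) ^ p"
  using p
proof
  assume "p = 1"
  then show ?thesis using norm_triangle_ineq[of a b] by (simp add: order_trans)
qed (simp add: sq_norm_add_le)

text \<open>A measurable function is almost everywhere the limit of continuous functions. Truncating values
  and domain turns this into dominated convergence.\<close>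

lemma continuous_dense_Lp:
  fixes f :: "real^3 \<Rightarrow> 'a::euclidean_space"
  assumes f[measurable]: "f \<in> borel_measurable lebesgue" and p: "p = 1 \<or> p = 2"
    and fp: "integrable lebesgue (\<lambda>x. norm (f x) ^ p)" and e: "e > 0"
  obtains g where "continuous_on UNIV g" "bounded {x. g x \<noteq> 0}"
    "integrable lebesgue (\<lambda>x. norm (f x - g x) ^ p)" "(LINT x|lebesgue. norm (f x - g x) ^ p) < e"
proof -
  have p0: "p > 0" using p by auto
  let ?F = "\<lambda>m x. cutoff (real (Suc m)) x *\<^sub>R clip (real (Suc m)) (f x)"
  have [measurable]: "clip (real (Suc m)) \<in> borel_measurable borel" for m
    by (intro borel_measurable_continuous_onI continuous_clip) simp
  have [measurable]: "(cutoff m :: real^3 \<Rightarrow> real) \<in> borel_measurable lebesgue" for m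
    by (intro continuous_lebesgue_measurable continuous_cutoff)
  have Fm[measurable]: "?F m \<in> borel_measurable lebesgue" for m by measurable
  have Fle: "norm (?F m x) \<le> norm (f x)" for m x
  proof -
    have "norm (?F m x) = cutoff (real (Suc m)) x * norm (clip (real (Suc m)) (f x))"
      using cutoff_bounds[of "real (Suc m)" x] by simp
    also have "\<dots> \<le> 1 * norm (f x)"
      by (intro mult_mono cutoff_bounds clip_le) auto
    finally show ?thesis by simp
  qed
  have Flim: "(\<lambda>m. ?F m x) \<longlonglongrightarrow> f x" for x
  proof (rule tendsto_eventually)
    obtain N :: nat where N: "max (norm x) (norm (f x)) \<le> real N" using real_arch_simple by blast
    have "?F m x = f x" if "m \<ge> N" for m
      using N that by (subst clip_eq, simp, simp, subst cutoff_eq) auto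
    then show "eventually (\<lambda>m. ?F m x = f x) sequentially" by (rule eventually_sequentiallyI)
  qed
  note D1 = integral_norm_power_tendsto_0[OF Fm f p0 fp Fle _ AE_I2[OF Flim]]
  have "eventually (\<lambda>m. (LINT x|lebesgue. norm (?F m x - f x) ^ p) < e / 4) sequentially"
    using D1(1) e by (intro order_tendstoD) auto
  then obtain m where m: "(LINT x|lebesgue. norm (?F m x - f x) ^ p) < e / 4"
    using eventually_happens'[OF sequentially_bot] by blast
  have im: "integrable lebesgue (\<lambda>x. norm (?F m x - f x) ^ p)" by (rule D1(2)) auto
  define M where "M = real (Suc m)"
  have M: "M > 0" by (simp add: M_def)
  have "f measurable_on UNIV" by (rule lebesgue_measurable_imp_measurable_on[OF f]) simp
  then obtain N g where N: "negligible N" and g: "\<And>n. continuous_on UNIV (g n)"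
    and gl: "\<And>x. x \<notin> N \<Longrightarrow> (\<lambda>n::nat. g n x) \<longlonglongrightarrow> f x"
    unfolding measurable_on_def by auto
  let ?G = "\<lambda>n x. cutoff M x *\<^sub>R clip M (g n x)"
  have cont: "continuous_on UNIV (?G n)" for n
    by (intro continuous_on_scaleR continuous_cutoff continuous_on_compose2[OF continuous_clip[OF M] g]) auto
  have "norm x \<le> M + 1" if "?G n x \<noteq> 0" for n x
    using that cutoff_0[of M x] by (auto simp: not_le[symmetric])
  then have bs: "bounded {x. ?G n x \<noteq> 0}" for n unfolding bounded_iff by blast
  let ?h = "\<lambda>x::real^3. M * indicator (cball 0 (M + 1)) x"
  have ih: "integrable lebesgue (\<lambda>x. ?h x ^ p)"
  proof -
    have "(\<lambda>x. ?h x ^ p) = (\<lambda>x. M ^ p * indicator (cball 0 (M + 1)) x)"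
      using p0 by (auto simp: indicator_def)
    moreover have "integrable lebesgue (\<lambda>x::real^3. M ^ p * indicator (cball 0 (M + 1)) x)"
      by (rule integrable_indicator_cball)
    ultimately show ?thesis by simp
  qed
  have cl: "norm (cutoff M x *\<^sub>R clip M v) \<le> ?h x" for x and v :: 'a
  proof (cases "x \<in> cball 0 (M + 1)")
    case True
    have "norm (cutoff M x *\<^sub>R clip M v) = cutoff M x * norm (clip M v)"
      using cutoff_bounds[of M x] by simp
    also have "\<dots> \<le> 1 * M" by (intro mult_mono cutoff_bounds clip_le M) auto
    finally show ?thesis using True by simp
  qed (simp add: cutoff_0)
  have Gle: "norm (?G n x) \<le> ?h x" "norm (?F m x) \<le> ?h x" for n x
    unfolding M_def[symmetric] by (rule cl)+
  have Glim: "AE x in lebesgue. (\<lambda>n. ?G n x) \<longlonglongrightarrow> ?F m x"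
  proof -
    have "AE x in lebesgue. x \<notin> N" using N by (intro AE_not_in) (simp add: negligible_iff_null_sets)
    then show ?thesis
    proof eventually_elim
      case (elim x)
      have "continuous_on UNIV (clip M :: 'a \<Rightarrow> 'a)" by (rule continuous_clip[OF M])
      then have "isCont (clip M) (f x)" by (simp add: continuous_on_eq_continuous_at)
      from isCont_tendsto_compose[OF this gl[OF elim]]
      show ?case by (auto simp: M_def intro!: tendsto_intros)
    qed
  qed
  note D2 = integral_norm_power_tendsto_0[OF continuous_lebesgue_measurable[OF cont] Fm p0 ih Gle(1) AE_I2[OF Gle(2)] Glim]
  have "eventually (\<lambda>n. (LINT x|lebesgue. norm (?G n x - ?F m x) ^ p) < e / 4) sequentially"
    using D2(1) e by (intro order_tendstoD) auto
  then obtain n where n: "(LINT x|lebesgue. norm (?G n x - ?F m x) ^ p) < e / 4"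
    using eventually_happens'[OF sequentially_bot] by blast
  have le: "norm (f x - ?G n x) ^ p \<le> 2 * norm (?F m x - f x) ^ p + 2 * norm (?G n x - ?F m x) ^ p" for x
    using norm_add_power_le[OF p, of "f x - ?F m x" "?F m x - ?G n x"] by (simp add: norm_minus_commute)
  have i: "integrable lebesgue (\<lambda>x. 2 * norm (?F m x - f x) ^ p + 2 * norm (?G n x - ?F m x) ^ p)"
    using im D2(2) by simp
  have [measurable]: "?G n \<in> borel_measurable lebesgue" by (rule continuous_lebesgue_measurable[OF cont])
  have i2: "integrable lebesgue (\<lambda>x. norm (f x - ?G n x) ^ p)"
    by (rule Bochner_Integration.integrable_bound[OF i]) (use le in auto)
  have "(LINT x|lebesgue. norm (f x - ?G n x) ^ p) \<le> (LINT x|lebesgue. 2 * norm (?F m x - f x) ^ p + 2 * norm (?G n x - ?F m x) ^ p)"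
    by (intro integral_mono i i2 le)
  also have "\<dots> < e" using m n im D2(2)[of n] by simp
  finally show ?thesis by (intro that[OF cont bs i2])
qed

lemma conv_uniform_limit:
  fixes g :: "real^3 \<Rightarrow> 'a::euclidean_space"
  assumes g: "continuous_on UNIV g" and b: "bounded {x. g x \<noteq> 0}" and e: "e > 0"
  shows "eventually (\<lambda>n. \<forall>x. norm (conv (mollifier n) g x - g x) \<le> e) sequentially"
proof -
  obtain d where d: "d > 0" "\<And>x y. dist x y < d \<Longrightarrow> dist (g x) (g y) < e"
    by (rule uniformly_continuous_compact_support[OF g b e]) blast
  obtain N where N: "1 / real (Suc N) < d" using d(1) nat_approx_posE by blast
  note ig = integrable_compact_support(2)[OF g b]
  note ci = conv_integrable[OF mollifier_continuous mollifier_bounded_support ig]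
  have "norm (conv (mollifier n) g x - g x) \<le> e" if "n \<ge> N" for n x
  proof -
    have n: "1 / real (Suc n) < d"
      using N that by (smt (verit) frac_le of_nat_0_less_iff of_nat_mono Suc_le_mono zero_less_Suc)
    note mi = lebesgue_mollifier_shift[of n x]
    have eq: "conv (mollifier n) g x - g x = (LINT y|lebesgue. mollifier n (x - y) *\<^sub>R (g y - g x))"
      using ci[of n x] mi by (simp add: conv_def scaleR_diff_right)
    have "norm (conv (mollifier n) g x - g x) \<le> (LINT y|lebesgue. norm (mollifier n (x - y) *\<^sub>R (g y - g x)))"
      unfolding eq
      by (rule integral_norm_bound)
    also have "\<dots> \<le> (LINT y|lebesgue. mollifier n (x - y) * e)"
    proof (intro integral_mono integrable_norm integrable_mult_left mi)
      show "integrable lebesgue (\<lambda>y. mollifier n (x - y) *\<^sub>R (g y - g x))"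
        using ci[of n x] mi by (simp add: scaleR_diff_right)
      fix y
      show "norm (mollifier n (x - y) *\<^sub>R (g y - g x)) \<le> mollifier n (x - y) * e"
      proof (cases "norm (x - y) \<ge> 1 / real (Suc n)")
        case False
        then have "dist y x < d" using n by (simp add: dist_norm norm_minus_commute)
        then show ?thesis using d(2)[of y x] by (simp add: mollifier_nonneg dist_norm mult_left_mono)
      qed (simp add: mollifier_eq_0)
    qed
    also have "\<dots> = e" using mi by simp
    finally show ?thesis .
  qed
  then show ?thesis by (intro eventually_sequentiallyI[of N]) auto
qed

lemma conv_diff:
  "integrable lebesgue f \<Longrightarrow> integrable lebesgue g \<Longrightarrow>
    conv (mollifier n) (\<lambda>x. f x - g x) z = conv (mollifier n) f z - conv (mollifier n) g z"
  unfolding conv_def scaleR_diff_right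
  by (intro Bochner_Integration.integral_diff conv_integrable[OF mollifier_continuous mollifier_bounded_support])

text \<open>For a compactly supported continuous \<open>g\<close> close to \<open>f\<close> the mollifications converge uniformly on a
  fixed ball; the remainder \<open>f - g\<close> is controlled before and after mollification by Young's
  inequality.\<close>

lemma mollification_converges:
  fixes f :: "real^3 \<Rightarrow> 'a::euclidean_space"
  assumes f: "integrable lebesgue f" and p: "p = 1 \<or> p = 2" and fp: "integrable lebesgue (\<lambda>x. norm (f x) ^ p)"
  shows "(\<lambda>n. LINT x|lebesgue. norm (conv (mollifier n) f x - f x) ^ p) \<longlonglongrightarrow> 0"
proof (rule LIMSEQ_I)
  fix e :: real assume e: "e > 0"
  have p0: "p > 0" using p by auto
  note fm[measurable] = borel_measurable_integrable[OF f]
  obtain g where g: "continuous_on UNIV g" "bounded {x. g x \<noteq> 0}"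
    and ifg: "integrable lebesgue (\<lambda>x. norm (f x - g x) ^ p)"
    and fg: "(LINT x|lebesgue. norm (f x - g x) ^ p) < e / 16"
    using continuous_dense_Lp[OF fm p fp, of "e/16"] e by auto
  have ig: "integrable lebesgue g" by (rule integrable_compact_support(2)[OF g])
  obtain M where M: "\<And>x. g x \<noteq> 0 \<Longrightarrow> norm x \<le> M" using g(2) by (auto simp: bounded_iff)
  let ?K = "cball (0::real^3) (M + 1)"
  let ?V = "measure lebesgue ?K"
  have V: "?V \<ge> 0" by (rule measure_nonneg)
  define d where "d = min 1 (e / (16 * (?V + 1)))"
  have d: "d > 0" "d \<le> 1" using e V by (auto simp: d_def intro!: divide_pos_pos add_nonneg_pos)
  have dV: "d * ?V \<le> e / 16"
  proof -
    have "d * ?V \<le> e / (16 * (?V + 1)) * (?V + 1)" using V e by (intro mult_mono) (auto simp: d_def)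
    also have "\<dots> = e / 16"
    proof -
      have "?V + 1 \<noteq> 0" using V by linarith
      then show ?thesis by (metis divide_divide_eq_left' nonzero_eq_divide_eq times_divide_eq_left)
    qed
    finally show ?thesis .
  qed
  from conv_uniform_limit[OF g d(1)] obtain N where
    N: "\<And>n x. n \<ge> N \<Longrightarrow> norm (conv (mollifier n) g x - g x) \<le> d"
    unfolding eventually_sequentially by blast
  show "\<exists>N. \<forall>n\<ge>N. norm ((LINT x|lebesgue. norm (conv (mollifier n) f x - f x) ^ p) - 0) < e"
  proof (intro exI[of _ N] allI impI)
    fix n assume n: "n \<ge> N"
    let ?\<eta> = "conv (mollifier n)"
    have i0: "integrable lebesgue (\<lambda>x. f x - g x)" using f ig by simp
    note Y = conv_Young[OF i0 p ifg, of n]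
    have gb: "norm (?\<eta> g x - g x) ^ p \<le> d * indicator ?K x" for x
    proof (cases "x \<in> ?K")
      case True
      have "norm (?\<eta> g x - g x) ^ p \<le> d ^ p" using N[OF n] by (intro power_mono) auto
      also have "\<dots> \<le> d" using p d by (auto simp: power2_eq_square mult_left_le)
      finally show ?thesis using True by simp
    next
      case False
      have "1 / real (Suc n) \<le> 1" by simp
      then have "?\<eta> g x = 0"
      proof (intro conv_eq_0[of 1 _ M])
        show "mollifier n y = 0" if "norm y \<ge> 1" for y
          using that \<open>1 / real (Suc n) \<le> 1\<close> by (intro mollifier_eq_0) linarith
        show "g y = 0" if "norm y > M" for y using M[of y] that by linarith
        show "norm x > M + 1" using False by simp
      qed
      moreover have "g x = 0" using M[of x] False by auto
      ultimately show ?thesis using False p0 by (simp add: zero_power)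
    qed
    have iK: "integrable lebesgue (\<lambda>x. d * indicator ?K x)"
      by (rule integrable_indicator_cball)
    let ?R = "\<lambda>x. 2 * norm (?\<eta> (\<lambda>x. f x - g x) x) ^ p + 4 * (d * indicator ?K x) + 4 * norm (f x - g x) ^ p"
    have iR: "integrable lebesgue ?R" using Y(1) iK ifg by simp
    have le: "norm (?\<eta> f x - f x) ^ p \<le> ?R x" for x
    proof -
      have "?\<eta> f x - f x = ?\<eta> (\<lambda>x. f x - g x) x + ((?\<eta> g x - g x) + (g x - f x))"
        by (simp add: conv_diff[OF f ig])
      then have "norm (?\<eta> f x - f x) ^ p \<le> 2 * norm (?\<eta> (\<lambda>x. f x - g x) x) ^ p
         + 2 * norm ((?\<eta> g x - g x) + (g x - f x)) ^ p"
        using norm_add_power_le[OF p] by metis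
      also have "norm ((?\<eta> g x - g x) + (g x - f x)) ^ p \<le> 2 * norm (?\<eta> g x - g x) ^ p + 2 * norm (g x - f x) ^ p"
        by (rule norm_add_power_le[OF p])
      finally show ?thesis using gb[of x] by (simp add: norm_minus_commute)
    qed
    note [measurable] = conv_measurable[OF f]
    have i: "integrable lebesgue (\<lambda>x. norm (?\<eta> f x - f x) ^ p)"
      by (rule Bochner_Integration.integrable_bound[OF iR]) (auto intro!: AE_I2 order_trans[OF le abs_ge_self])
    have "(LINT x|lebesgue. norm (?\<eta> f x - f x) ^ p) \<le> (LINT x|lebesgue. ?R x)"
      by (intro integral_mono i iR le)
    also have "\<dots> = 2 * (LINT x|lebesgue. norm (?\<eta> (\<lambda>x. f x - g x) x) ^ p) + 4 * (d * ?V)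
        + 4 * (LINT x|lebesgue. norm (f x - g x) ^ p)"
      using Y(1) iK ifg by simp
    also have "\<dots> < e" using Y(2) dV fg e by linarith
    finally show "norm ((LINT x|lebesgue. norm (?\<eta> f x - f x) ^ p) - 0) < e" by simp
  qed
qed

lemma mollification_L2lim:
  fixes f :: "real^3 \<Rightarrow> 'a::euclidean_space"
  assumes "integrable lebesgue f" "f \<in> L2"
  shows "L2lim (\<lambda>n. conv (mollifier n) f) f"
  unfolding L2lim_def L2sq_def
proof (intro conjI allI)
  note F = assms(1) disjI2[OF refl] L2_integrable[OF assms(2)]
  show "conv (mollifier n) f \<in> L2" for n
    using conv_Young(1)[OF F] conv_measurable[OF assms(1)] by (simp add: L2_def)
  show "(\<lambda>n. LINT x|lebesgue. norm (conv (mollifier n) f x - f x) ^ 2) \<longlonglongrightarrow> 0"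
    by (rule mollification_converges[OF F])
qed (rule assms)

lemma mollification_L1:
  fixes f :: "real^3 \<Rightarrow> 'a::euclidean_space"
  assumes "integrable lebesgue f"
  shows "(\<lambda>n. LINT x|lebesgue. norm (conv (mollifier n) f x - f x)) \<longlonglongrightarrow> 0"
  using mollification_converges[OF assms disjI1[OF refl]] assms by simp

section \<open>Weak derivatives: cutoff and chain rule\<close>

lemma LlocD: "f \<in> Lloc p \<Longrightarrow> f \<in> borel_measurable lebesgue"
  "f \<in> Lloc p \<Longrightarrow> compact K \<Longrightarrow> set_integrable lebesgue K (\<lambda>x. norm (f x) ^ p)"
  by (auto simp: Lloc_def)

lemma compact_lmeasurable_integrable: "compact K \<Longrightarrow> set_integrable lebesgue K (\<lambda>x::real^3. c :: real)"
  unfolding set_integrable_def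
  by (intro integrable_scaleR_left integrable_real_indicator)
     (auto simp: compact_imp_closed dest: emeasure_compact_finite)

lemma Lloc2_Lloc1:
  assumes f: "f \<in> Lloc 2" shows "f \<in> Lloc 1"
  unfolding Lloc_def
proof (intro CollectI conjI allI impI)
  show [measurable]: "f \<in> borel_measurable lebesgue" using f by (rule LlocD)
  fix K :: "(real^3) set" assume K: "compact K"
  have [measurable]: "K \<in> sets lebesgue" using K by (simp add: compact_imp_closed)
  have i: "set_integrable lebesgue K (\<lambda>x. 1 + norm (f x) ^ 2)"
    by (intro set_integral_add compact_lmeasurable_integrable[OF K] LlocD(2)[OF f K])
  show "set_integrable lebesgue K (\<lambda>x. norm (f x) ^ 1)"
    unfolding set_integrable_def
  proof (rule Bochner_Integration.integrable_bound[OF i[unfolded set_integrable_def]])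
    have "norm (f x) \<le> 1 + norm (f x) ^ 2" for x
    proof -
      have "norm (f x) \<le> 1 / 2 + norm (f x) ^ 2 / 2"
        using mult_le_squares[of 1 "1::real" "norm (f x)"] by simp
      moreover have "0 \<le> norm (f x) ^ 2" by simp
      ultimately show ?thesis by linarith
    qed
    then show "AE x in lebesgue. norm (indicat_real K x *\<^sub>R norm (f x) ^ 1) \<le> norm (indicat_real K x *\<^sub>R (1 + norm (f x) ^ 2))"
      by (intro AE_I2) (simp add: indicator_def)
  qed simp
qed

lemma integrable_Lloc1: "integrable lebesgue f \<Longrightarrow> f \<in> Lloc 1"
  unfolding Lloc_def set_integrable_def
proof (intro CollectI conjI allI impI)
  assume f: "integrable lebesgue f"
  then show "f \<in> borel_measurable lebesgue" by (rule borel_measurable_integrable)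
  fix K :: "(real^3) set" assume "compact K"
  then have "K \<in> sets lebesgue" by (simp add: compact_imp_closed)
  then show "integrable lebesgue (\<lambda>x. indicat_real K x *\<^sub>R norm (f x) ^ 1)"
    using integrable_norm[OF f] by (simp add: integrable_mult_indicator[where 'b = real, simplified])
qed

lemma L2_Lloc1:
  assumes f: "f \<in> L2" shows "f \<in> Lloc 1"
proof (rule Lloc2_Lloc1)
  have "integrable lebesgue (\<lambda>x. indicat_real K x *\<^sub>R norm (f x) ^ 2)" if "compact K" for K
    using that by (intro integrable_mult_indicator L2_integrable[OF f]) (simp add: compact_imp_closed)
  then show "f \<in> Lloc 2" using L2_measurable[OF f] by (auto simp: Lloc_def set_integrable_def)
qed

lemma Lloc1_scaleR_integrable:
  fixes f :: "real^3 \<Rightarrow> 'a::euclidean_space"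
  assumes f: "f \<in> Lloc 1" and c: "continuous_on UNIV c" and b: "bounded {x. c x \<noteq> 0}"
  shows "integrable lebesgue (\<lambda>x. (c x :: real) *\<^sub>R f x)"
proof -
  let ?K = "closure {x. c x \<noteq> 0}"
  have K: "compact ?K" using b by (simp add: compact_closure)
  obtain C where C: "C \<ge> 0" "\<And>x. norm (c x) \<le> C" by (rule bounded_range_compact_support[OF c b]) blast
  note [measurable] = LlocD(1)[OF f] continuous_lebesgue_measurable[OF c]
  have i: "integrable lebesgue (\<lambda>x. C * (indicat_real ?K x *\<^sub>R norm (f x) ^ 1))"
    using LlocD(2)[OF f K] unfolding set_integrable_def by (rule integrable_mult_right)
  show ?thesis
  proof (rule Bochner_Integration.integrable_bound[OF i])
    have "norm (c x *\<^sub>R f x) \<le> C * (indicat_real ?K x *\<^sub>R norm (f x) ^ 1)" for x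
    proof (cases "c x = 0")
      case False
      then have "x \<in> ?K" using closure_subset by fastforce
      then show ?thesis using C(2)[of x] by (simp add: mult_right_mono)
    qed (use C(1) in simp)
    then show "AE x in lebesgue. norm (c x *\<^sub>R f x) \<le> norm (C * (indicat_real ?K x *\<^sub>R norm (f x) ^ 1))"
      by (intro AE_I2) (use order_trans[OF _ abs_ge_self] in auto)
  qed simp
qed

lemma L2_bounded_support_integrable:
  fixes f :: "real^3 \<Rightarrow> 'a::euclidean_space"
  assumes f: "f \<in> L2" and z: "\<And>x. norm x > R \<Longrightarrow> f x = 0"
  shows "integrable lebesgue f"
proof -
  have "set_integrable lebesgue (cball 0 R) (\<lambda>x. norm (f x) ^ 1)"
    by (rule LlocD(2)[OF L2_Lloc1[OF f]]) simp
  then have i: "integrable lebesgue (\<lambda>x. indicat_real (cball 0 R) x *\<^sub>R norm (f x) ^ 1)"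
    unfolding set_integrable_def .
  show ?thesis
  proof (rule Bochner_Integration.integrable_bound[OF i L2_measurable[OF f]])
    show "AE x in lebesgue. norm (f x) \<le> norm (indicat_real (cball 0 R) x *\<^sub>R norm (f x) ^ 1)"
      by (intro AE_I2) (use z in \<open>auto simp: indicator_def\<close>)
  qed
qed

lemma weak_partial_cutoff:
  fixes u :: "real^3 \<Rightarrow> 'a::euclidean_space"
  assumes w: "weak_partial k u h" and \<theta>: "\<theta> \<in> C0_infinity"
  shows "weak_partial k (\<lambda>x. \<theta> x *\<^sub>R u x) (\<lambda>x. \<theta> x *\<^sub>R h x + partial k \<theta> x *\<^sub>R u x)"
proof -
  have u: "u \<in> Lloc 1" and h: "h \<in> Lloc 1" using w by (auto simp: weak_partial_def)
  note iu = Lloc1_scaleR_integrable[OF u C0_continuous C0_bounded_support]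
  note ih = Lloc1_scaleR_integrable[OF h C0_continuous C0_bounded_support]
  show ?thesis
    unfolding weak_partial_def
  proof (intro conjI allI impI)
    show "(\<lambda>x. \<theta> x *\<^sub>R u x) \<in> Lloc 1" by (intro integrable_Lloc1 iu \<theta>)
    show "(\<lambda>x. \<theta> x *\<^sub>R h x + partial k \<theta> x *\<^sub>R u x) \<in> Lloc 1"
      by (intro integrable_Lloc1 Bochner_Integration.integrable_add iu ih \<theta> C0_partial)
    fix \<phi> :: "real^3 \<Rightarrow> real" assume \<phi>: "\<phi> \<in> C0_infinity"
    have \<phi>\<theta>: "(\<lambda>x. \<phi> x * \<theta> x) \<in> C0_infinity" by (intro C0_mult \<phi> C0_C_k[OF \<theta>])
    have p\<theta>: "(\<lambda>x. \<phi> x * partial k \<theta> x) \<in> C0_infinity" by (intro C0_mult \<phi> C0_C_k[OF C0_partial[OF \<theta>]])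
    have p: "partial k (\<lambda>x. \<phi> x * \<theta> x) x = partial k \<phi> x * \<theta> x + \<phi> x * partial k \<theta> x" for x
      by (rule partial_mult) (intro C0_differentiable \<phi> \<theta>)+
    have "(LINT x|lebesgue. partial k \<phi> x *\<^sub>R \<theta> x *\<^sub>R u x)
        = (LINT x|lebesgue. partial k (\<lambda>x. \<phi> x * \<theta> x) x *\<^sub>R u x - (\<phi> x * partial k \<theta> x) *\<^sub>R u x)"
      by (simp add: p algebra_simps)
    also have "\<dots> = (LINT x|lebesgue. partial k (\<lambda>x. \<phi> x * \<theta> x) x *\<^sub>R u x) - (LINT x|lebesgue. (\<phi> x * partial k \<theta> x) *\<^sub>R u x)"
      by (intro Bochner_Integration.integral_diff iu C0_partial \<phi>\<theta> p\<theta>)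
    also have "(LINT x|lebesgue. partial k (\<lambda>x. \<phi> x * \<theta> x) x *\<^sub>R u x) = - (LINT x|lebesgue. (\<phi> x * \<theta> x) *\<^sub>R h x)"
      using w \<phi>\<theta> unfolding weak_partial_def by blast
    also have "- (LINT x|lebesgue. (\<phi> x * \<theta> x) *\<^sub>R h x) - (LINT x|lebesgue. (\<phi> x * partial k \<theta> x) *\<^sub>R u x)
        = - (LINT x|lebesgue. (\<phi> x * \<theta> x) *\<^sub>R h x + (\<phi> x * partial k \<theta> x) *\<^sub>R u x)"
      by (subst Bochner_Integration.integral_add[OF ih[OF \<phi>\<theta> \<phi>\<theta>] iu[OF p\<theta> p\<theta>]]) simp
    also have "\<dots> = - (LINT x|lebesgue. \<phi> x *\<^sub>R (\<theta> x *\<^sub>R h x + partial k \<theta> x *\<^sub>R u x))"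
      by (simp add: algebra_simps)
    finally show "(LINT x|lebesgue. partial k \<phi> x *\<^sub>R \<theta> x *\<^sub>R u x) = - (LINT x|lebesgue. \<phi> x *\<^sub>R (\<theta> x *\<^sub>R h x + partial k \<theta> x *\<^sub>R u x))" .
  qed
qed

lemma integral_tendsto_L1:
  fixes f :: "nat \<Rightarrow> real^3 \<Rightarrow> 'a::euclidean_space"
  assumes f: "\<And>n. integrable lebesgue (f n)" and F: "integrable lebesgue F"
    and le: "\<And>n. (LINT x|lebesgue. norm (f n x - F x)) \<le> e n" and e: "e \<longlonglongrightarrow> 0"
  shows "(\<lambda>n. LINT x|lebesgue. f n x) \<longlonglongrightarrow> (LINT x|lebesgue. F x)"
proof (rule LIM_zero_cancel, rule Lim_null_comparison[OF always_eventually[OF allI] e])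
  fix n
  have "norm ((LINT x|lebesgue. f n x) - (LINT x|lebesgue. F x)) = norm (LINT x|lebesgue. f n x - F x)"
    using f F by simp
  also have "\<dots> \<le> (LINT x|lebesgue. norm (f n x - F x))" by (rule integral_norm_bound)
  finally show "norm ((LINT x|lebesgue. f n x) - (LINT x|lebesgue. F x)) \<le> e n" using le[of n] by linarith
qed

text \<open>The chain rule holds for the mollified functions \<open>U\<^sub>n\<close> with derivatives \<open>H\<^sub>n\<close>. The Lipschitz
  function \<open>F\<close> passes to the limit in \<open>L\<^sup>1\<close>. In the derivative, \<open>DF U\<^sub>n (H\<^sub>n - h)\<close> tends to \<open>0\<close> in
  \<open>L\<^sup>1\<close> since \<open>DF\<close> is bounded, and \<open>DF U\<^sub>n h\<close> converges by dominated convergence along a subsequence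
  on which \<open>U\<^sub>n\<close> converges almost everywhere.\<close>

lemma weak_partial_chain_rule:
  fixes u h :: "real^3 \<Rightarrow> 'a::euclidean_space" and F :: "'a \<Rightarrow> 'a"
  assumes w: "weak_partial k u h" and u: "integrable lebesgue u" and h: "integrable lebesgue h"
    and F: "\<And>v. (F has_derivative DF v) (at v)" and F0: "F 0 = 0"
    and DF: "\<And>v w. norm (DF v w) \<le> C * norm w"
    and cDF: "continuous_on UNIV (\<lambda>(v, w). DF v w)"
  shows "weak_partial k (\<lambda>x. F (u x)) (\<lambda>x. DF (u x) (h x))"
proof -
  have C: "C \<ge> 0"
  proof -
    obtain b :: 'a where b: "b \<in> Basis" using nonempty_Basis by blast
    have "0 \<le> norm (DF 0 b)" by simp
    also have "\<dots> \<le> C" using DF[of 0 b] b by simp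
    finally show ?thesis .
  qed
  have lin: "bounded_linear (DF v)" for v using F by (rule has_derivative_bounded_linear)
  have lip: "norm (F v - F w) \<le> C * norm (v - w)" for v w
    by (rule differentiable_bound[where S = UNIV and f' = DF])
       (use F DF in \<open>auto intro: onorm_le has_derivative_at_withinI\<close>)
  have cF: "continuous_on UNIV F"
    using has_derivative_continuous[OF F] by (intro continuous_at_imp_continuous_on) auto
  have [measurable]: "F \<in> borel_measurable borel" by (rule borel_measurable_continuous_onI[OF cF])
  have mDF: "(\<lambda>x. DF (f x) (g x)) \<in> borel_measurable lebesgue"
    if "f \<in> borel_measurable lebesgue" "g \<in> borel_measurable lebesgue" for f g :: "real^3 \<Rightarrow> 'a"
    using borel_measurable_continuous_Pair[OF that cDF[unfolded case_prod_beta', simplified]]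
    by (simp add: case_prod_beta')
  note um[measurable] = borel_measurable_integrable[OF u]
  note hm[measurable] = borel_measurable_integrable[OF h]
  have iFu: "integrable lebesgue (\<lambda>x. F (u x))"
    by (rule Bochner_Integration.integrable_bound[OF integrable_mult_right[OF integrable_norm[OF u], of C]])
       (use lip[of _ 0] C in \<open>auto simp: F0 abs_mult\<close>)
  have iDF: "integrable lebesgue (\<lambda>x. DF (u x) (h x))"
    by (rule Bochner_Integration.integrable_bound[OF integrable_mult_right[OF integrable_norm[OF h], of C] mDF])
       (use DF C in \<open>auto simp: abs_mult\<close>)
  define U where "U n = conv (mollifier n) u" for n
  define H where "H n = conv (mollifier n) h" for n
  have U_smooth: "C_k m (U n)" for m n unfolding U_def by (rule conv_C_k[OF mollifier_C0 u])
  have pU: "partial k (U n) = H n" for n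
    unfolding U_def H_def partial_conv[OF mollifier_C0 u] by (rule conv_weak_partial[OF mollifier_C0 w])
  have iU: "integrable lebesgue (U n)" "integrable lebesgue (H n)" for n
    unfolding U_def H_def using conv_Young(1)[OF u disjI1[OF refl]] conv_Young(1)[OF h disjI1[OF refl]] u h
      conv_measurable[OF u] conv_measurable[OF h]
    by (auto simp: integrable_norm_iff)
  have Ulim: "(\<lambda>n. LINT x|lebesgue. norm (U n x - u x)) \<longlonglongrightarrow> 0"
    unfolding U_def by (rule mollification_L1[OF u])
  have Hlim: "(\<lambda>n. LINT x|lebesgue. norm (H n x - h x)) \<longlonglongrightarrow> 0"
    unfolding H_def by (rule mollification_L1[OF h])
  have "\<exists>r::nat\<Rightarrow>nat. strict_mono r \<and> (AE x in lebesgue. (\<lambda>n. U (r n) x - u x) \<longlonglongrightarrow> 0)"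
    by (rule tendsto_L1_AE_subseq) (use iU u Ulim in auto)
  then obtain r :: "nat \<Rightarrow> nat" where r: "strict_mono r" and aeU: "AE x in lebesgue. (\<lambda>n. U (r n) x - u x) \<longlonglongrightarrow> 0"
    by blast
  note [measurable] = borel_measurable_integrable[OF iU(1)] borel_measurable_integrable[OF iU(2)]
  have cc: "continuous_on UNIV (\<lambda>x. DF (f x) (g x))" if "continuous_on UNIV f" "continuous_on UNIV g"
    for f g :: "real^3 \<Rightarrow> 'a"
    using continuous_on_compose2[OF cDF continuous_on_Pair[OF that]] by simp
  show ?thesis
    unfolding weak_partial_def
  proof (intro conjI allI impI integrable_Lloc1 iFu iDF)
    fix \<phi> :: "real^3 \<Rightarrow> real" assume \<phi>: "\<phi> \<in> C0_infinity"
    obtain K where K: "K \<ge> 0" "\<And>x. norm (\<phi> x) \<le> K"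
      by (rule bounded_range_compact_support[OF C0_continuous[OF \<phi>] C0_bounded_support[OF \<phi>]]) blast
    obtain K' where K': "K' \<ge> 0" "\<And>x. norm (partial k \<phi> x) \<le> K'"
      by (rule bounded_range_compact_support[OF C0_continuous[OF C0_partial[OF \<phi>]] C0_bounded_support[OF C0_partial[OF \<phi>]]]) blast
    note [measurable] = continuous_lebesgue_measurable[OF C0_continuous[OF \<phi>]]
      continuous_lebesgue_measurable[OF C0_continuous[OF C0_partial[OF \<phi>]]]
    have mult_int: "integrable lebesgue (\<lambda>x. c x *\<^sub>R f x)"
      if "integrable lebesgue f" "\<And>x. norm (c x) \<le> B" "c \<in> borel_measurable lebesgue"
      for c :: "real^3 \<Rightarrow> real" and f :: "real^3 \<Rightarrow> 'a" and B
    proof (rule Bochner_Integration.integrable_bound[OF integrable_mult_right[OF integrable_norm[OF that(1)], of B]])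
      note [measurable] = borel_measurable_integrable[OF that(1)] that(3)
      show "(\<lambda>x. c x *\<^sub>R f x) \<in> borel_measurable lebesgue" by simp
      show "AE x in lebesgue. norm (c x *\<^sub>R f x) \<le> norm (B * norm (f x))"
        unfolding norm_scaleR norm_mult
        by (intro AE_I2 mult_mono) (auto intro: order_trans[OF that(2)[unfolded real_norm_def] abs_ge_self])
    qed
    have smooth_id: "(LINT x|lebesgue. partial k \<phi> x *\<^sub>R F (U n x)) = - (LINT x|lebesgue. \<phi> x *\<^sub>R DF (U n x) (H n x))" for n
    proof -
      have dFU: "((\<lambda>x. F (U n x)) has_derivative (\<lambda>y. DF (U n x) (\<Sum>j\<in>UNIV. y $ j *\<^sub>R partial j (U n) x))) (at x)" for x
        by (rule has_derivative_compose[OF has_derivative_partials F]) (use U_smooth[of "Suc 0" n] in simp)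
      have pFU: "partial j (\<lambda>x. F (U n x)) = (\<lambda>x. DF (U n x) (partial j (U n) x))" for j
        by (rule ext, subst partial_eqI[OF dFU])
           (simp add: axis_def if_distrib if_distribR sum.delta cong: if_cong)
      have FU1: "C_k (Suc 0) (\<lambda>x. F (U n x))"
        using U_smooth[of "Suc 0" n] C_k_continuous[OF U_smooth[of 0 n]]
        by (auto simp: pFU intro!: differentiableI[OF dFU] cc)
      have 1: "C_k (Suc 0) (\<lambda>x. \<phi> x *\<^sub>R F (U n x))"
        by (intro C_k_scaleR C0_C_k[OF \<phi>] FU1)
      have 2: "bounded {x. \<phi> x *\<^sub>R F (U n x) \<noteq> 0}"
        by (rule bounded_subset[OF C0_bounded_support[OF \<phi>]]) auto
      have p: "partial k (\<lambda>x. \<phi> x *\<^sub>R F (U n x)) x = partial k \<phi> x *\<^sub>R F (U n x) + \<phi> x *\<^sub>R DF (U n x) (H n x)" for x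
        using partial_scaleR[OF C0_differentiable[OF \<phi>] C_k_differentiable[OF FU1]] by (simp add: pFU pU)
      have cH: "continuous_on UNIV (H n)" unfolding H_def by (rule C_k_continuous[OF conv_C_k[OF mollifier_C0 h, of 0]])
      have b: "bounded {x. \<phi> x *\<^sub>R DF (U n x) (H n x) \<noteq> 0}" "bounded {x. partial k \<phi> x *\<^sub>R F (U n x) \<noteq> 0}"
        by (rule bounded_subset[OF C0_bounded_support[OF \<phi>]], auto)
           (rule bounded_subset[OF C0_bounded_support[OF C0_partial[OF \<phi>]]], auto)
      have i: "integrable lebesgue (\<lambda>x. \<phi> x *\<^sub>R DF (U n x) (H n x))" "integrable lebesgue (\<lambda>x. partial k \<phi> x *\<^sub>R F (U n x))"
        by (intro integrable_compact_support b continuous_intros C0_continuous \<phi> C0_partial cc cH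
              C_k_continuous[OF U_smooth[of 0 n]] C_k_continuous[OF FU1])+
      have "0 = (LINT x|lebesgue. partial k \<phi> x *\<^sub>R F (U n x) + \<phi> x *\<^sub>R DF (U n x) (H n x))"
        using integral_partial_eq_0[OF 1 2, of k] by (simp add: p)
      also have "\<dots> = (LINT x|lebesgue. partial k \<phi> x *\<^sub>R F (U n x)) + (LINT x|lebesgue. \<phi> x *\<^sub>R DF (U n x) (H n x))"
        by (rule Bochner_Integration.integral_add[OF i(2,1)])
      finally show ?thesis by (simp add: eq_neg_iff_add_eq_0)
    qed
    have FUint: "integrable lebesgue (\<lambda>x. F (U n x))" for n
      by (rule Bochner_Integration.integrable_bound[OF integrable_mult_right[OF integrable_norm[OF iU(1)[of n]], of C]])
         (use lip[of _ 0] C in \<open>auto simp: F0 abs_mult\<close>)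
    have DFint: "integrable lebesgue (\<lambda>x. DF (U n x) (f x))" if f: "integrable lebesgue f" for n f
      by (rule Bochner_Integration.integrable_bound[OF integrable_mult_right[OF integrable_norm[OF f], of C] mDF])
         (use DF C borel_measurable_integrable[OF f] in \<open>auto simp: abs_mult\<close>)
    have L: "(\<lambda>n. LINT x|lebesgue. partial k \<phi> x *\<^sub>R F (U n x)) \<longlonglongrightarrow> (LINT x|lebesgue. partial k \<phi> x *\<^sub>R F (u x))"
    proof (rule integral_tendsto_L1)
      show "integrable lebesgue (\<lambda>x. partial k \<phi> x *\<^sub>R F (U n x))" for n by (rule mult_int[OF FUint K'(2)]) simp
      show "integrable lebesgue (\<lambda>x. partial k \<phi> x *\<^sub>R F (u x))" by (rule mult_int[OF iFu K'(2)]) simp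
      show "(\<lambda>n. K' * (C * (LINT x|lebesgue. norm (U n x - u x)))) \<longlonglongrightarrow> 0"
        using tendsto_mult_right_zero[OF tendsto_mult_right_zero[OF Ulim]] .
      fix n
      have "(LINT x|lebesgue. norm (partial k \<phi> x *\<^sub>R F (U n x) - partial k \<phi> x *\<^sub>R F (u x)))
          \<le> (LINT x|lebesgue. K' * (C * norm (U n x - u x)))"
      proof (intro integral_mono)
        show "integrable lebesgue (\<lambda>x. norm (partial k \<phi> x *\<^sub>R F (U n x) - partial k \<phi> x *\<^sub>R F (u x)))"
          by (intro integrable_norm Bochner_Integration.integrable_diff mult_int[OF FUint K'(2)] mult_int[OF iFu K'(2)]) auto
        show "integrable lebesgue (\<lambda>x. K' * (C * norm (U n x - u x)))"
          by (intro integrable_mult_right integrable_norm Bochner_Integration.integrable_diff iU u)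
        fix x
        show "norm (partial k \<phi> x *\<^sub>R F (U n x) - partial k \<phi> x *\<^sub>R F (u x)) \<le> K' * (C * norm (U n x - u x))"
          unfolding scaleR_diff_right[symmetric] norm_scaleR using K' lip[of "U n x" "u x"] K'(2)[of x]
          by (intro mult_mono) auto
      qed
      then show "(LINT x|lebesgue. norm (partial k \<phi> x *\<^sub>R F (U n x) - partial k \<phi> x *\<^sub>R F (u x)))
          \<le> K' * (C * (LINT x|lebesgue. norm (U n x - u x)))" by simp
    qed
    have R1: "(\<lambda>n. LINT x|lebesgue. \<phi> x *\<^sub>R DF (U n x) (H n x - h x)) \<longlonglongrightarrow> (LINT x::real^3|lebesgue. 0 :: 'a)"
    proof (rule integral_tendsto_L1)
      show i: "integrable lebesgue (\<lambda>x. \<phi> x *\<^sub>R DF (U n x) (H n x - h x))" for n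
        by (intro mult_int[OF DFint K(2)] Bochner_Integration.integrable_diff iU h) simp
      show "(\<lambda>n. K * (C * (LINT x|lebesgue. norm (H n x - h x)))) \<longlonglongrightarrow> 0"
        using tendsto_mult_right_zero[OF tendsto_mult_right_zero[OF Hlim]] .
      fix n
      have "(LINT x|lebesgue. norm (\<phi> x *\<^sub>R DF (U n x) (H n x - h x) - 0))
          \<le> (LINT x|lebesgue. K * (C * norm (H n x - h x)))"
      proof (intro integral_mono)
        show "integrable lebesgue (\<lambda>x. norm (\<phi> x *\<^sub>R DF (U n x) (H n x - h x) - 0))"
          unfolding diff_0_right by (rule integrable_norm[OF i])
        show "integrable lebesgue (\<lambda>x. K * (C * norm (H n x - h x)))"
          by (intro integrable_mult_right integrable_norm Bochner_Integration.integrable_diff iU h)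
        fix x
        show "norm (\<phi> x *\<^sub>R DF (U n x) (H n x - h x) - 0) \<le> K * (C * norm (H n x - h x))"
          unfolding diff_0_right norm_scaleR using K(1) K(2)[of x] DF[of "U n x" "H n x - h x"]
          by (intro mult_mono) auto
      qed
      then show "(LINT x|lebesgue. norm (\<phi> x *\<^sub>R DF (U n x) (H n x - h x) - 0))
          \<le> K * (C * (LINT x|lebesgue. norm (H n x - h x)))" by simp
    qed simp
    have R2: "(\<lambda>n. LINT x|lebesgue. \<phi> x *\<^sub>R DF (U (r n) x) (h x)) \<longlonglongrightarrow> (LINT x|lebesgue. \<phi> x *\<^sub>R DF (u x) (h x))"
    proof (rule integral_dominated_convergence)
      show "integrable lebesgue (\<lambda>x. K * (C * norm (h x)))" using h by simp
      show "AE x in lebesgue. norm (\<phi> x *\<^sub>R DF (U (r n) x) (h x)) \<le> K * (C * norm (h x))" for n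
        unfolding norm_scaleR using K DF by (intro AE_I2 mult_mono) auto
      show "AE x in lebesgue. (\<lambda>n. \<phi> x *\<^sub>R DF (U (r n) x) (h x)) \<longlonglongrightarrow> \<phi> x *\<^sub>R DF (u x) (h x)"
        using aeU
      proof eventually_elim
        case (elim x)
        have c: "continuous_on UNIV (\<lambda>v. DF v (h x))"
          using continuous_on_compose2[OF cDF continuous_on_Pair[OF continuous_on_id continuous_on_const]] by simp
        then have "isCont (\<lambda>v. DF v (h x)) (u x)" by (simp add: continuous_on_eq_continuous_at)
        from isCont_tendsto_compose[OF this LIM_zero_cancel[OF elim]] show ?case by (intro tendsto_intros)
      qed
      show "(\<lambda>x. \<phi> x *\<^sub>R DF (u x) (h x)) \<in> borel_measurable lebesgue"
        "(\<lambda>x. \<phi> x *\<^sub>R DF (U (r n) x) (h x)) \<in> borel_measurable lebesgue" for n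
        by (intro borel_measurable_scaleR mDF; simp)+
    qed
    have split: "(LINT x|lebesgue. \<phi> x *\<^sub>R DF (U n x) (H n x))
        = (LINT x|lebesgue. \<phi> x *\<^sub>R DF (U n x) (H n x - h x)) + (LINT x|lebesgue. \<phi> x *\<^sub>R DF (U n x) (h x))" for n
    proof -
      have "\<phi> x *\<^sub>R DF (U n x) (H n x) = \<phi> x *\<^sub>R DF (U n x) (H n x - h x) + \<phi> x *\<^sub>R DF (U n x) (h x)" for x
        using linear_add[OF bounded_linear.linear[OF lin], of "U n x" "H n x - h x" "h x"]
        by (simp add: scaleR_add_right[symmetric])
      then show ?thesis
        by (simp only:) (intro Bochner_Integration.integral_add mult_int[OF DFint K(2)] Bochner_Integration.integrable_diff iU h; simp)
    qed
    have "(\<lambda>n. (LINT x|lebesgue. \<phi> x *\<^sub>R DF (U (r n) x) (H (r n) x - h x)) + (LINT x|lebesgue. \<phi> x *\<^sub>R DF (U (r n) x) (h x)))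
       \<longlonglongrightarrow> (LINT x::real^3|lebesgue. 0 :: 'a) + (LINT x|lebesgue. \<phi> x *\<^sub>R DF (u x) (h x))"
      by (rule tendsto_add[OF LIMSEQ_subseq_LIMSEQ[OF R1 r, unfolded o_def] R2])
    then have "(\<lambda>n. LINT x|lebesgue. \<phi> x *\<^sub>R DF (U (r n) x) (H (r n) x)) \<longlonglongrightarrow> (LINT x|lebesgue. \<phi> x *\<^sub>R DF (u x) (h x))"
      by (simp add: split)
    from tendsto_minus[OF this]
    have "(\<lambda>n. LINT x|lebesgue. partial k \<phi> x *\<^sub>R F (U (r n) x)) \<longlonglongrightarrow> - (LINT x|lebesgue. \<phi> x *\<^sub>R DF (u x) (h x))"
      by (simp add: smooth_id)
    moreover have "(\<lambda>n. LINT x|lebesgue. partial k \<phi> x *\<^sub>R F (U (r n) x)) \<longlonglongrightarrow> (LINT x|lebesgue. partial k \<phi> x *\<^sub>R F (u x))"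
      using LIMSEQ_subseq_LIMSEQ[OF L r] by (simp add: o_def)
    ultimately show "(LINT x|lebesgue. partial k \<phi> x *\<^sub>R F (u x)) = - (LINT x|lebesgue. \<phi> x *\<^sub>R DF (u x) (h x))"
      using LIMSEQ_unique by blast
  qed
qed

section \<open>Density of test functions in the magnetic Sobolev space\<close>

text \<open>A smooth truncation at height \<open>sqrt (n + 1)\<close>. It has the form of a positive scalar function of
  \<open>\<bar>v\<bar>\<close> times \<open>v\<close>, which makes it commute with rotations by a phase.\<close>

definition sat :: "nat \<Rightarrow> 'a::real_inner \<Rightarrow> 'a" where
  "sat n v = inverse (sqrt (1 + v \<bullet> v / real (Suc n))) *\<^sub>R v"

definition sat_deriv :: "nat \<Rightarrow> 'a::real_inner \<Rightarrow> 'a \<Rightarrow> 'a" where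
  "sat_deriv n v w = inverse (sqrt (1 + v \<bullet> v / real (Suc n))) *\<^sub>R w
     - ((v \<bullet> w) / real (Suc n) * inverse (sqrt (1 + v \<bullet> v / real (Suc n))) ^ 3) *\<^sub>R v"

lemma sat_radicand: "1 + v \<bullet> v / real (Suc n) \<ge> 1" "1 + v \<bullet> v / real (Suc n) > 0"
proof -
  have "v \<bullet> v / real (Suc n) \<ge> 0" by (intro divide_nonneg_pos) auto
  then show "1 + v \<bullet> v / real (Suc n) \<ge> 1" "1 + v \<bullet> v / real (Suc n) > 0" by linarith+
qed

lemma inverse_sqrt_has_derivative:
  assumes "1 + t / d > 0" "d > 0"
  shows "((\<lambda>t. inverse (sqrt (1 + t / d))) has_real_derivative - (inverse (sqrt (1 + t / d)) ^ 3 / (2 * d))) (at t)"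
proof -
  have s: "sqrt (1 + t / d) > 0" using assms by simp
  have "((\<lambda>t. inverse (sqrt (1 + t / d))) has_real_derivative
     - (inverse (sqrt (1 + t / d)) * (inverse (sqrt (1 + t / d)) / 2 * (1 / d)) * inverse (sqrt (1 + t / d)))) (at t)"
    using assms s by (auto intro!: derivative_eq_intros)
  moreover have "- (inverse (sqrt (1 + t / d)) * (inverse (sqrt (1 + t / d)) / 2 * (1 / d)) * inverse (sqrt (1 + t / d)))
     = - (inverse (sqrt (1 + t / d)) ^ 3 / (2 * d))"
    by (simp add: power3_eq_cube)
  ultimately show ?thesis by (simp only:)
qed

lemma sat_has_derivative: "(sat n has_derivative sat_deriv n v) (at v)"
proof -
  let ?d = "real (Suc n)"
  let ?q = "\<lambda>v::'a. inverse (sqrt (1 + v \<bullet> v / ?d))"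
  have 1: "((\<lambda>v::'a. v \<bullet> v) has_derivative (\<lambda>w. v \<bullet> w + w \<bullet> v)) (at v)"
    by (intro derivative_eq_intros) auto
  have 2: "(?q has_derivative (\<lambda>w. - (?q v ^ 3 / (2 * ?d)) * (v \<bullet> w + w \<bullet> v))) (at v)"
    by (rule has_derivative_compose[OF 1 inverse_sqrt_has_derivative[unfolded has_field_derivative_def]])
       (use sat_radicand in auto)
  have "((\<lambda>v. ?q v *\<^sub>R v) has_derivative
      (\<lambda>w. ?q v *\<^sub>R w + (- (?q v ^ 3 / (2 * ?d)) * (v \<bullet> w + w \<bullet> v)) *\<^sub>R v)) (at v)"
    by (rule bounded_bilinear.FDERIV[OF bounded_bilinear_scaleR 2 has_derivative_ident])
  moreover have "sat_deriv n v w = ?q v *\<^sub>R w + (- (?q v ^ 3 / (2 * ?d)) * (v \<bullet> w + w \<bullet> v)) *\<^sub>R v" for w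
    by (simp add: sat_deriv_def inner_commute[of w v] del: of_nat_Suc)
  ultimately have "((\<lambda>v. ?q v *\<^sub>R v) has_derivative sat_deriv n v) (at v)"
    by presburger
  then show ?thesis unfolding sat_def[abs_def] .
qed

lemma sat_0: "sat n 0 = 0" and sat_deriv_0: "sat_deriv n v 0 = 0"
  by (simp_all add: sat_def sat_deriv_def)

lemma inverse_sqrt_bounds:
  "0 \<le> inverse (sqrt (1 + v \<bullet> v / real (Suc n)))" "inverse (sqrt (1 + v \<bullet> v / real (Suc n))) \<le> 1"
  "v \<bullet> v / real (Suc n) * inverse (sqrt (1 + v \<bullet> v / real (Suc n))) ^ 2 \<le> 1"
proof -
  let ?t = "v \<bullet> v / real (Suc n)"
  have t: "?t \<ge> 0" by (intro divide_nonneg_pos) auto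
  show "0 \<le> inverse (sqrt (1 + ?t))" using t by simp
  show "inverse (sqrt (1 + ?t)) \<le> 1" using t by (intro inverse_le_1_iff[THEN iffD2]) auto
  have "inverse (sqrt (1 + ?t)) ^ 2 = inverse (1 + ?t)" using t by (simp add: power_inverse)
  then show "?t * inverse (sqrt (1 + ?t)) ^ 2 \<le> 1"
    using divide_le_eq_1_pos[of "1 + ?t" ?t] t by (simp only: divide_inverse[symmetric])
qed

lemma sat_le: "norm (sat n v) \<le> norm v" and sat_le_const: "norm (sat n v) ^ 2 \<le> real (Suc n)"
proof -
  note b = inverse_sqrt_bounds[of v n]
  show "norm (sat n v) \<le> norm v"
    using mult_right_mono[OF b(2), of "norm v"] b(1) by (simp add: sat_def abs_of_nonneg del: of_nat_Suc)
  have "norm (sat n v) ^ 2 = real (Suc n) * (v \<bullet> v / real (Suc n) * inverse (sqrt (1 + v \<bullet> v / real (Suc n))) ^ 2)"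
    by (simp add: sat_def power_mult_distrib power2_norm_eq_inner power_inverse del: of_nat_Suc)
  also have "\<dots> \<le> real (Suc n) * 1" by (intro mult_left_mono b) simp
  finally show "norm (sat n v) ^ 2 \<le> real (Suc n)" by simp
qed

lemma sat_deriv_le: "norm (sat_deriv n v w) \<le> 2 * norm w"
proof -
  let ?q = "inverse (sqrt (1 + v \<bullet> v / real (Suc n)))" and ?d = "real (Suc n)"
  note b = inverse_sqrt_bounds[of v n]
  have "norm (((v \<bullet> w) / ?d * ?q ^ 3) *\<^sub>R v) = \<bar>v \<bullet> w\<bar> * norm v / ?d * ?q ^ 3"
    using b(1) by (simp add: abs_mult del: of_nat_Suc)
  also have "\<dots> \<le> (norm v * norm w) * norm v / ?d * ?q ^ 3"
    using b(1) by (intro mult_right_mono divide_right_mono Cauchy_Schwarz_ineq2) auto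
  also have "\<dots> = (v \<bullet> v / ?d * ?q ^ 2) * ?q * norm w"
    by (simp add: power2_norm_eq_inner[symmetric] power3_eq_cube power2_eq_square del: of_nat_Suc)
  also have "\<dots> \<le> 1 * 1 * norm w"
    using b by (intro mult_mono mult_right_mono) auto
  finally have 1: "norm (((v \<bullet> w) / ?d * ?q ^ 3) *\<^sub>R v) \<le> norm w" by simp
  have "norm (?q *\<^sub>R w) \<le> 1 * norm w"
    unfolding norm_scaleR using b by (intro mult_right_mono) auto
  then show ?thesis
    using 1 norm_triangle_ineq4[of "?q *\<^sub>R w" "((v \<bullet> w) / ?d * ?q ^ 3) *\<^sub>R v"] unfolding sat_deriv_def by linarith
qed

lemma continuous_sat_deriv: "continuous_on UNIV (\<lambda>(v, w). sat_deriv n v w)"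
proof -
  have "sqrt (1 + v \<bullet> v / real (Suc n)) \<noteq> 0" for v :: 'a
    using sat_radicand[of v n] by (metis order_less_irrefl real_sqrt_eq_zero_cancel_iff)
  then show ?thesis unfolding sat_deriv_def case_prod_beta' by (intro continuous_intros) auto
qed

lemma inverse_sqrt_tendsto_1: "(\<lambda>n. inverse (sqrt (1 + c / real (Suc n)))) \<longlonglongrightarrow> 1"
proof -
  have "(\<lambda>n. c * inverse (real (Suc n))) \<longlonglongrightarrow> c * 0" by (intro tendsto_intros LIMSEQ_inverse_real_of_nat)
  then have "(\<lambda>n. c / real (Suc n)) \<longlonglongrightarrow> 0" by (simp add: divide_inverse)
  then have "(\<lambda>n. inverse (sqrt (1 + c / real (Suc n)))) \<longlonglongrightarrow> inverse (sqrt (1 + 0))"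
    by (intro tendsto_intros) auto
  then show ?thesis by simp
qed

lemma sat_tendsto: "(\<lambda>n. sat n v) \<longlonglongrightarrow> v" and sat_deriv_tendsto: "(\<lambda>n. sat_deriv n v w) \<longlonglongrightarrow> w"
proof -
  have "(\<lambda>n. sat n v) \<longlonglongrightarrow> 1 *\<^sub>R v"
    unfolding sat_def by (intro tendsto_intros inverse_sqrt_tendsto_1)
  then show "(\<lambda>n. sat n v) \<longlonglongrightarrow> v" by simp
  have "(\<lambda>n. (v \<bullet> w) * inverse (real (Suc n))) \<longlonglongrightarrow> (v \<bullet> w) * 0" by (intro tendsto_intros LIMSEQ_inverse_real_of_nat)
  then have *: "(\<lambda>n. (v \<bullet> w) / real (Suc n)) \<longlonglongrightarrow> 0" by (simp add: divide_inverse)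
  have "(\<lambda>n. sat_deriv n v w) \<longlonglongrightarrow> 1 *\<^sub>R w - (0 * 1 ^ 3) *\<^sub>R v"
    unfolding sat_deriv_def by (intro tendsto_intros inverse_sqrt_tendsto_1 *)
  then show "(\<lambda>n. sat_deriv n v w) \<longlonglongrightarrow> w" by simp
qed

text \<open>Spinors are treated as a real inner product space together with the multiplication by \<open>i\<close>, so
  that all quadratic forms are real.\<close>

locale complex_structure =
  fixes J :: "'a::euclidean_space \<Rightarrow> 'a"
  assumes J_bounded_linear: "bounded_linear J" and J_skew: "J v \<bullet> w = - (v \<bullet> J w)" and J_J: "J (J v) = - v"
begin

lemma J_linear: "linear J"
  by (rule bounded_linear.linear[OF J_bounded_linear])

lemma inner_J_self: "v \<bullet> J v = 0" "J v \<bullet> v = 0"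
  using J_skew[of v v] by (simp_all add: inner_commute)

lemma norm_J: "norm (J v) = norm v"
  using J_skew[of v "J v"] by (simp add: J_J norm_eq_sqrt_inner)

lemma J_0: "J 0 = 0"
  by (rule linear_0[OF J_linear])

definition mgrad :: "(real^3 \<Rightarrow> real^3) \<Rightarrow> 3 \<Rightarrow> (real^3 \<Rightarrow> 'a) \<Rightarrow> real^3 \<Rightarrow> 'a" where
  "mgrad A k v x = partial k v x + (A x $ k) *\<^sub>R J (v x)"

text \<open>The function \<open>g k\<close> is the magnetic derivative \<open>(\<partial>\<^sub>k + A\<^sub>k J) u\<close> in the sense of distributions.\<close>

definition mag_weak :: "(real^3 \<Rightarrow> real^3) \<Rightarrow> (real^3 \<Rightarrow> 'a) \<Rightarrow> (3 \<Rightarrow> real^3 \<Rightarrow> 'a) \<Rightarrow> bool" where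
  "mag_weak A u g \<longleftrightarrow> u \<in> L2 \<and>
     (\<forall>k. g k \<in> L2 \<and> weak_partial k u (\<lambda>x. g k x - (A x $ k) *\<^sub>R J (u x)))"

definition approximable :: "(real^3 \<Rightarrow> real^3) \<Rightarrow> (real^3 \<Rightarrow> 'a) \<Rightarrow> (3 \<Rightarrow> real^3 \<Rightarrow> 'a) \<Rightarrow> bool" where
  "approximable A u g \<longleftrightarrow> (\<exists>v. (\<forall>n. v n \<in> C0_infinity) \<and> L2lim v u \<and> (\<forall>k. L2lim (\<lambda>n. mgrad A k (v n)) (g k)))"

text \<open>A diagonal sequence.\<close>

lemma approximable_closed:
  assumes a: "\<And>m. approximable A (U m) (G m)" and u: "L2lim U u" and g: "\<And>k. L2lim (\<lambda>m. G m k) (g k)"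
  shows "approximable A u g"
proof -
  have "\<exists>v. v \<in> C0_infinity \<and> L2sq (\<lambda>x. v x - U m x) < inverse (real (Suc m)) \<and>
      (\<forall>k. mgrad A k v \<in> L2 \<and> L2sq (\<lambda>x. mgrad A k v x - G m k x) < inverse (real (Suc m)))" for m
  proof -
    obtain v where v: "\<And>n. v n \<in> C0_infinity" "L2lim v (U m)" "\<And>k. L2lim (\<lambda>n. mgrad A k (v n)) (G m k)"
      using a[of m] unfolding approximable_def by blast
    have e: "0 < inverse (real (Suc m))" by simp
    have 1: "eventually (\<lambda>n. L2sq (\<lambda>x. v n x - U m x) < inverse (real (Suc m))) sequentially"
      using v(2) e unfolding L2lim_def by (intro order_tendstoD(2)[of _ 0]) auto
    have "eventually (\<lambda>n. L2sq (\<lambda>x. mgrad A k (v n) x - G m k x) < inverse (real (Suc m))) sequentially" for k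
      using v(3)[of k] e unfolding L2lim_def by (intro order_tendstoD(2)[of _ 0]) auto
    then have 2: "eventually (\<lambda>n. \<forall>k. L2sq (\<lambda>x. mgrad A k (v n) x - G m k x) < inverse (real (Suc m))) sequentially"
      by (rule eventually_all_finite)
    obtain n where "L2sq (\<lambda>x. v n x - U m x) < inverse (real (Suc m))"
      "\<forall>k. L2sq (\<lambda>x. mgrad A k (v n) x - G m k x) < inverse (real (Suc m))"
      using eventually_happens'[OF sequentially_bot eventually_conj[OF 1 2]] by blast
    then show ?thesis using v(1) L2lim_L2(2)[OF v(3)] by (intro exI[of _ "v n"]) simp
  qed
  then have "\<exists>v. \<forall>m. v m \<in> C0_infinity \<and> L2sq (\<lambda>x. v m x - U m x) < inverse (real (Suc m)) \<and>
      (\<forall>k. mgrad A k (v m) \<in> L2 \<and> L2sq (\<lambda>x. mgrad A k (v m) x - G m k x) < inverse (real (Suc m)))"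
    by (intro choice allI)
  then obtain v where V: "\<forall>m. v m \<in> C0_infinity \<and> L2sq (\<lambda>x. v m x - U m x) < inverse (real (Suc m)) \<and>
      (\<forall>k. mgrad A k (v m) \<in> L2 \<and> L2sq (\<lambda>x. mgrad A k (v m) x - G m k x) < inverse (real (Suc m)))" ..
  have v: "\<And>m. v m \<in> C0_infinity" "\<And>m. L2sq (\<lambda>x. v m x - U m x) < inverse (real (Suc m))"
    "\<And>m k. mgrad A k (v m) \<in> L2" "\<And>m k. L2sq (\<lambda>x. mgrad A k (v m) x - G m k x) < inverse (real (Suc m))"
    using V by simp_all
  have close: "L2lim V F" if V: "\<And>m. V m \<in> L2" and W: "L2lim W F"
    and c: "\<And>m. L2sq (\<lambda>x. V m x - W m x) < inverse (real (Suc m))" for V W :: "nat \<Rightarrow> real^3 \<Rightarrow> 'a" and F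
  proof -
    have le: "L2sq (\<lambda>x. V m x - F x) \<le> 2 * inverse (real (Suc m)) + 2 * L2sq (\<lambda>x. W m x - F x)" for m
      using L2_add(2)[OF L2_diff[OF V[of m] L2lim_L2(2)[OF W, of m]] L2_diff[OF L2lim_L2(2,1)[OF W], of m]] c[of m]
      by simp
    have "(\<lambda>m. 2 * inverse (real (Suc m)) + 2 * L2sq (\<lambda>x. W m x - F x)) \<longlonglongrightarrow> 2 * 0 + 2 * 0"
      using W by (intro tendsto_intros LIMSEQ_inverse_real_of_nat) (auto simp: L2lim_def)
    then have "(\<lambda>m. L2sq (\<lambda>x. V m x - F x)) \<longlonglongrightarrow> 0"
      by (intro tendsto_sandwich[of "\<lambda>n. 0", OF _ always_eventually[OF allI[OF le]]]) (auto simp: L2sq_nonneg)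
    then show ?thesis using V L2lim_L2(1)[OF W] by (simp add: L2lim_def)
  qed
  show ?thesis
    unfolding approximable_def
  proof (intro exI[of _ v] conjI allI)
    show "L2lim v u" by (rule close[OF C0_L2[OF v(1)] u v(2)])
    show "L2lim (\<lambda>n. mgrad A k (v n)) (g k)" for k by (rule close[OF v(3) g v(4)])
  qed (rule v(1))
qed

lemma magnetic_term_L2:
  assumes A: "A \<in> Lloc 2" and w[measurable]: "w \<in> borel_measurable lebesgue"
    and le: "\<And>x. norm (w x) \<le> C * indicator (cball 0 R) x"
  shows "(\<lambda>x. indicator (cball 0 R) x *\<^sub>R A x) \<in> L2"
    and "AE x in lebesgue. norm ((A x $ k) *\<^sub>R w x) \<le> C * norm (indicator (cball 0 R) x *\<^sub>R A x)"
    and "(\<lambda>x. (A x $ k) *\<^sub>R w x) \<in> L2"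
proof -
  note [measurable] = LlocD(1)[OF A]
  have "integrable lebesgue (\<lambda>x. norm (indicat_real (cball 0 R) x *\<^sub>R A x) ^ 2)"
  proof -
    have "integrable lebesgue (\<lambda>x. indicat_real (cball 0 R) x *\<^sub>R norm (A x) ^ 2)"
      using LlocD(2)[OF A compact_cball] by (simp add: set_integrable_def)
    then show ?thesis by (rule back_subst[of "integrable lebesgue"]) (auto simp: indicator_def)
  qed
  moreover have "(\<lambda>x. indicat_real (cball 0 R) x *\<^sub>R A x) \<in> borel_measurable lebesgue"
    by (intro borel_measurable_scaleR borel_measurable_indicator LlocD(1)[OF A]) simp
  ultimately show 1: "(\<lambda>x. indicator (cball 0 R) x *\<^sub>R A x) \<in> L2" by (simp add: L2_def)
  have "norm ((A x $ k) *\<^sub>R w x) \<le> C * norm (indicator (cball 0 R) x *\<^sub>R A x)" for x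
  proof -
    have "norm ((A x $ k) *\<^sub>R w x) \<le> norm (A x) * norm (w x)"
      unfolding norm_scaleR by (intro mult_right_mono component_le_norm_cart) auto
    also have "\<dots> \<le> norm (A x) * (C * indicator (cball 0 R) x)" by (intro mult_left_mono le) auto
    also have "\<dots> = C * norm (indicator (cball 0 R) x *\<^sub>R A x)" by (simp add: indicator_def)
    finally show ?thesis .
  qed
  then show 2: "AE x in lebesgue. norm ((A x $ k) *\<^sub>R w x) \<le> C * norm (indicator (cball 0 R) x *\<^sub>R A x)" by simp
  have [measurable]: "(\<lambda>x. A x $ k) \<in> borel_measurable lebesgue"
    by (rule measurable_compose[OF LlocD(1)[OF A]]) (intro borel_measurable_continuous_onI continuous_intros)
  show "(\<lambda>x. (A x $ k) *\<^sub>R w x) \<in> L2" by (rule L2_bound[OF 1 _ 2]) simp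
qed

lemma J_measurable[measurable]: "J \<in> borel_measurable borel"
  using J_bounded_linear by (intro borel_measurable_continuous_onI) (simp add: linear_continuous_on)

lemma C0_bounded_by_indicator:
  assumes v: "v \<in> C0_infinity"
  obtains C R where "\<And>x. norm (v x) \<le> C * indicator (cball 0 R) x"
proof -
  obtain C where C: "C \<ge> 0" "\<And>x. norm (v x) \<le> C"
    by (rule bounded_range_compact_support[OF C0_continuous[OF v] C0_bounded_support[OF v]]) blast
  obtain R where R: "\<And>x. v x \<noteq> 0 \<Longrightarrow> norm x \<le> R" using C0_bounded_support[OF v] by (auto simp: bounded_iff)
  show ?thesis by (rule that[of C R]) (use C R in \<open>auto simp: indicator_def\<close>)
qed

lemma mgrad_L2:
  assumes A: "A \<in> Lloc 2" and v: "v \<in> C0_infinity"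
  shows "(\<lambda>x. (A x $ k) *\<^sub>R J (v x)) \<in> L2" "mgrad A k v \<in> L2"
proof -
  obtain C R where "\<And>x. norm (v x) \<le> C * indicator (cball 0 R) x" by (rule C0_bounded_by_indicator[OF v]) blast
  then have "\<And>x. norm (J (v x)) \<le> C * indicator (cball 0 R) x" by (simp add: norm_J)
  moreover have [measurable]: "v \<in> borel_measurable lebesgue"
    by (rule continuous_lebesgue_measurable[OF C0_continuous[OF v]])
  ultimately show 1: "(\<lambda>x. (A x $ k) *\<^sub>R J (v x)) \<in> L2" by (intro magnetic_term_L2(3)[OF A]) auto
  show "mgrad A k v \<in> L2"
    unfolding mgrad_def[abs_def] by (intro L2_add C0_L2[OF C0_partial[OF v]] 1)
qed

text \<open>For bounded \<open>u\<close> with compact support \<open>A u\<close> is square integrable, hence so is the ordinary weak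
  gradient, and its mollifications converge. The mollifications \<open>V\<^sub>n\<close> of \<open>u\<close> are uniformly bounded
  with supports in a common ball, so \<open>A V\<^sub>n\<close> converges to \<open>A u\<close> by dominated convergence.\<close>

lemma bounded_compact_approximable:
  assumes A: "A \<in> Lloc 2" and w: "mag_weak A u g"
    and M: "\<And>x. norm (u x) \<le> M" and z: "\<And>x. norm x > R \<Longrightarrow> u x = 0" "\<And>k x. norm x > R \<Longrightarrow> g k x = 0"
  shows "approximable A u g"
proof -
  have u: "u \<in> L2" and g: "\<And>k. g k \<in> L2" using w by (auto simp: mag_weak_def)
  note [measurable] = L2_measurable[OF u]
  let ?h = "\<lambda>k x. g k x - (A x $ k) *\<^sub>R J (u x)"
  have wp: "weak_partial k u (?h k)" for k using w by (simp add: mag_weak_def)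
  have ub: "norm (J (u x)) \<le> M * indicator (cball 0 R) x" for x
    using M z(1)[of x] by (auto simp: norm_J indicator_def)
  have hL: "?h k \<in> L2" for k by (intro L2_diff g magnetic_term_L2(3)[OF A _ ub]) simp
  have iu: "integrable lebesgue u" by (rule L2_bounded_support_integrable[OF u z(1)])
  have ih: "integrable lebesgue (?h k)" for k
    by (rule L2_bounded_support_integrable[OF hL, of R]) (simp add: z J_0)
  define V where "V n = conv (mollifier n) u" for n
  have VC: "V n \<in> C0_infinity" for n
    unfolding V_def by (intro conv_C0 mollifier_C0 iu) (use z(1) in \<open>force simp: bounded_iff not_less[symmetric]\<close>)
  have pV: "partial k (V n) = conv (mollifier n) (?h k)" for k n
    unfolding V_def partial_conv[OF mollifier_C0 iu] by (rule conv_weak_partial[OF mollifier_C0 wp])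
  have Vlim: "L2lim V u" unfolding V_def by (rule mollification_L2lim[OF iu u])
  have plim: "L2lim (\<lambda>n. partial k (V n)) (?h k)" for k
    unfolding pV by (rule mollification_L2lim[OF ih hL])
  have Vb: "norm (J (V n x)) \<le> M * indicator (cball 0 (R + 1)) x" for n x
  proof (cases "x \<in> cball 0 (R + 1)")
    case True
    have "norm (V n x) \<le> conv (mollifier n) (\<lambda>x. norm (u x)) x"
      using conv_Jensen[OF iu disjI1[OF refl], of n x] iu by (simp add: V_def)
    also have "\<dots> \<le> (LINT y|lebesgue. mollifier n (x - y) * M)"
      unfolding conv_def
    proof (intro integral_mono)
      show "integrable lebesgue (\<lambda>y. mollifier n (x - y) *\<^sub>R norm (u y))"
        by (intro conv_integrable mollifier_continuous mollifier_bounded_support integrable_norm iu)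
      show "integrable lebesgue (\<lambda>y. mollifier n (x - y) * M)" using lebesgue_mollifier_shift by simp
      show "mollifier n (x - y) *\<^sub>R norm (u y) \<le> mollifier n (x - y) * M" for y
        using M mollifier_nonneg by (simp add: mult_left_mono)
    qed
    also have "\<dots> = M" using lebesgue_mollifier_shift by simp
    finally show ?thesis using True by (simp add: norm_J)
  next
    case False
    have "1 / real (Suc n) \<le> 1" by simp
    then have "mollifier n y = 0" if "norm y \<ge> 1" for y
      using that by (intro mollifier_eq_0) linarith
    then have "V n x = 0"
      unfolding V_def using False by (intro conv_eq_0[of 1 _ R] z(1)) auto
    then show ?thesis using False by (simp add: J_0)
  qed
  obtain r :: "nat \<Rightarrow> nat" where r: "strict_mono r" and ae: "AE x in lebesgue. (\<lambda>n. V (r n) x) \<longlonglongrightarrow> u x"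
    by (rule L2lim_AE_subseq[OF Vlim])
  have sub: "L2lim (\<lambda>n. f (r n)) F" if "L2lim f F" for f :: "nat \<Rightarrow> real^3 \<Rightarrow> 'a" and F
    using that LIMSEQ_subseq_LIMSEQ[OF _ r, of "\<lambda>n. L2sq (\<lambda>x. f n x - F x)"] by (auto simp: L2lim_def o_def)
  have Vm[measurable]: "V n \<in> borel_measurable lebesgue" for n by (rule L2_measurable[OF C0_L2[OF VC]])
  have mlim: "L2lim (\<lambda>n x. (A x $ k) *\<^sub>R J (V (r n) x)) (\<lambda>x. (A x $ k) *\<^sub>R J (u x))" for k
  proof (rule L2lim_dominated)
    note T = magnetic_term_L2[OF A _ Vb]
    show "(\<lambda>x. (A x $ k) *\<^sub>R J (V (r n) x)) \<in> borel_measurable lebesgue" for n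
      by (rule L2_measurable[OF T(3)]) simp
    show "(\<lambda>x. (A x $ k) *\<^sub>R J (u x)) \<in> borel_measurable lebesgue"
      by (rule L2_measurable[OF magnetic_term_L2(3)[OF A _ ub]]) simp
    show "(\<lambda>x. M *\<^sub>R (indicator (cball 0 (R + 1)) x *\<^sub>R A x)) \<in> L2"
      by (intro L2_bounded_linear[OF bounded_linear_scaleR_right] magnetic_term_L2(1)[OF A _ Vb[of 0]]) simp
    show "AE x in lebesgue. norm ((A x $ k) *\<^sub>R J (V (r n) x)) \<le> norm (M *\<^sub>R (indicator (cball 0 (R + 1)) x *\<^sub>R A x))" for n
      using magnetic_term_L2(2)[OF A _ Vb[of "r n"], of k] by (auto elim!: eventually_mono simp del: scaleR_scaleR intro: order_trans[OF _ mult_right_mono[OF abs_ge_self]])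
    show "AE x in lebesgue. (\<lambda>n. (A x $ k) *\<^sub>R J (V (r n) x)) \<longlonglongrightarrow> (A x $ k) *\<^sub>R J (u x)"
      using ae by eventually_elim (intro tendsto_intros bounded_linear.tendsto[OF J_bounded_linear])
  qed
  have "L2lim (\<lambda>n. mgrad A k (V (r n))) (g k)" for k
    using L2lim_add[OF sub[OF plim[of k]] mlim[of k]] by (simp add: mgrad_def[abs_def])
  then show ?thesis
    unfolding approximable_def using VC sub[OF Vlim] by (intro exI[of _ "\<lambda>n. V (r n)"]) auto
qed

lemma Lloc1_bounded_support_integrable:
  fixes f :: "real^3 \<Rightarrow> 'b::euclidean_space"
  assumes f: "f \<in> Lloc 1" and z: "\<And>x. norm x > R \<Longrightarrow> f x = 0"
  shows "integrable lebesgue f"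
proof (rule Bochner_Integration.integrable_bound)
  show "integrable lebesgue (\<lambda>x. indicat_real (cball 0 R) x *\<^sub>R norm (f x) ^ 1)"
    using LlocD(2)[OF f compact_cball] by (simp add: set_integrable_def)
  show "f \<in> borel_measurable lebesgue" by (rule LlocD[OF f])
  show "AE x in lebesgue. norm (f x) \<le> norm (indicat_real (cball 0 R) x *\<^sub>R norm (f x) ^ 1)"
    by (intro AE_I2) (use z in \<open>auto simp: indicator_def\<close>)
qed

text \<open>The infinitesimal form of gauge covariance: \<open>v\<close> and \<open>J v\<close> are orthogonal, so rotating the phase
  leaves the scalar factor of the truncation unchanged.\<close>

lemma sat_J: "sat_deriv n v (J v) = J (sat n v)"
  by (simp add: sat_def sat_deriv_def inner_J_self linear_cmul[OF J_linear])

text \<open>By \<open>sat_J\<close> the truncated function has the magnetic derivative \<open>DF(u) (g k)\<close>: the potential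
  contributes \<open>A\<^sub>k DF(u) (J u) = A\<^sub>k J (F u)\<close>. This is dominated by \<open>2 \<bar>g k\<bar>\<close> and converges to
  \<open>g k\<close> as the truncation is removed.\<close>

lemma compact_support_approximable:
  assumes A: "A \<in> Lloc 2" and w: "mag_weak A u g"
    and z: "\<And>x. norm x > R \<Longrightarrow> u x = 0" "\<And>k x. norm x > R \<Longrightarrow> g k x = 0"
  shows "approximable A u g"
proof (rule approximable_closed)
  have u: "u \<in> L2" and g: "\<And>k. g k \<in> L2" using w by (auto simp: mag_weak_def)
  note [measurable] = L2_measurable[OF u] L2_measurable[OF g]
  let ?h = "\<lambda>k x. g k x - (A x $ k) *\<^sub>R J (u x)"
  have wp: "weak_partial k u (?h k)" for k using w by (simp add: mag_weak_def)
  have iu: "integrable lebesgue u" by (rule L2_bounded_support_integrable[OF u z(1)])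
  have ih: "integrable lebesgue (?h k)" for k
    by (rule Lloc1_bounded_support_integrable[of _ R]) (use wp[of k] in \<open>auto simp: weak_partial_def z J_0\<close>)
  have lin: "linear (sat_deriv n v)" for n and v :: 'a
    by (rule bounded_linear.linear[OF has_derivative_bounded_linear[OF sat_has_derivative]])
  let ?U = "\<lambda>n x. sat n (u x)" and ?G = "\<lambda>n k x. sat_deriv n (u x) (g k x)"
  have [measurable]: "sat n \<in> borel_measurable (borel :: 'a measure)" for n
    by (intro borel_measurable_continuous_onI continuous_at_imp_continuous_on ballI has_derivative_continuous[OF sat_has_derivative])
  have Um[measurable]: "?U n \<in> borel_measurable lebesgue" for n by simp
  have Gm[measurable]: "?G n k \<in> borel_measurable lebesgue" for n k
    using borel_measurable_continuous_Pair[OF L2_measurable[OF u] L2_measurable[OF g] continuous_sat_deriv[of n, unfolded case_prod_beta']]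
    by simp
  show Ulim: "L2lim ?U u"
    by (rule L2lim_dominated[OF Um L2_measurable[OF u] u]) (auto simp: sat_le sat_tendsto)
  show Glim: "L2lim (\<lambda>n. ?G n k) (g k)" for k
  proof (rule L2lim_dominated[OF Gm L2_measurable[OF g] L2_bounded_linear[OF bounded_linear_scaleR_right[of 2] g]])
    show "AE x in lebesgue. norm (sat_deriv n (u x) (g k x)) \<le> norm (2 *\<^sub>R g k x)" for n
      using sat_deriv_le by auto
  qed (auto simp: sat_deriv_tendsto)
  show "approximable A (?U n) (?G n)" for n
  proof (rule bounded_compact_approximable[OF A, of _ _ "sqrt (real (Suc n))" R])
    show "mag_weak A (?U n) (?G n)"
      unfolding mag_weak_def
    proof (intro conjI allI)
      show "?U n \<in> L2" by (rule L2lim_L2(2)[OF Ulim])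
      fix k
      show "?G n k \<in> L2" by (rule L2lim_L2(2)[OF Glim])
      have "weak_partial k (?U n) (\<lambda>x. sat_deriv n (u x) (?h k x))"
        by (rule weak_partial_chain_rule[OF wp iu ih sat_has_derivative sat_0 sat_deriv_le continuous_sat_deriv])
      moreover have "sat_deriv n (u x) (?h k x) = ?G n k x - (A x $ k) *\<^sub>R J (?U n x)" for x
        by (simp add: linear_diff[OF lin] linear_cmul[OF lin] sat_J)
      ultimately show "weak_partial k (?U n) (\<lambda>x. ?G n k x - (A x $ k) *\<^sub>R J (?U n x))" by simp
    qed
    show "norm (?U n x) \<le> sqrt (real (Suc n))" for x
      by (rule real_le_rsqrt[OF sat_le_const])
  qed (auto simp: z sat_0 sat_deriv_0)
qed

lemma partial_eq_0_outside:
  assumes "\<And>y. norm y \<ge> R \<Longrightarrow> f y = 0" "norm (x::real^3) > R" shows "partial k f x = 0"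
proof (rule partial_zero_outside_support)
  have "closure {x. f x \<noteq> 0} \<subseteq> cball 0 R"
  proof (rule closure_minimal)
    show "{x. f x \<noteq> 0} \<subseteq> cball 0 R" using assms(1) by force
  qed simp
  then show "x \<notin> closure {x. f x \<noteq> 0}" using assms(2) by auto
qed

text \<open>The cutoff \<open>\<rho>(x/n)\<close> reduces to compact support: it adds the term \<open>u \<partial>\<^sub>k \<rho>(x/n) / n\<close> to the magnetic
  derivative, which tends to \<open>0\<close>.\<close>

theorem test_functions_dense:
  assumes A: "A \<in> Lloc 2" and w: "mag_weak A u g"
  shows "approximable A u g"
proof (rule approximable_closed)
  have u: "u \<in> L2" and g: "\<And>k. g k \<in> L2" using w by (auto simp: mag_weak_def)
  note [measurable] = L2_measurable[OF u] L2_measurable[OF g]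
  define s where "s n = inverse (real (Suc n))" for n
  have s: "s n > 0" "s n \<le> 1" for n by (auto simp: s_def inverse_le_1_iff)
  have slim: "s \<longlonglongrightarrow> 0" unfolding s_def by (rule LIMSEQ_inverse_real_of_nat)
  let ?\<theta> = "\<lambda>n x. bump (s n *\<^sub>R x)"
  have \<theta>: "?\<theta> n \<in> C0_infinity" for n by (rule scaled_bump_C0) (use s[of n] in simp)
  have p\<theta>: "partial k (?\<theta> n) x = s n * partial k bump (s n *\<^sub>R x)" for n k x
    using partial_affine[of bump 0 "s n" x k] C0_differentiable[OF bump_C0] by simp
  have "\<exists>C. \<forall>x. norm (partial k bump x) \<le> C" for k
    by (rule bounded_range_compact_support[OF C0_continuous[OF C0_partial[OF bump_C0]] C0_bounded_support[OF C0_partial[OF bump_C0]]]) blast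
  then obtain C where C: "\<And>k x. norm (partial k bump x) \<le> C k" by metis
  have \<theta>m[measurable]: "?\<theta> n \<in> borel_measurable lebesgue" "partial k (?\<theta> n) \<in> borel_measurable lebesgue" for n k
    by (intro continuous_lebesgue_measurable C0_continuous \<theta> C0_partial)+
  let ?U = "\<lambda>n x. ?\<theta> n x *\<^sub>R u x" and ?G = "\<lambda>n k x. ?\<theta> n x *\<^sub>R g k x + partial k (?\<theta> n) x *\<^sub>R u x"
  have bump1: "\<bar>bump x\<bar> \<le> 1" for x using bump_nonneg[of x] bump_le_1[of x] by simp
  have snull: "(\<lambda>n. s n *\<^sub>R x) \<longlonglongrightarrow> 0" for x :: "real^3"
    using tendsto_scaleR[OF slim tendsto_const[of x]] by simp
  have \<theta>lim: "(\<lambda>n. ?\<theta> n x) \<longlonglongrightarrow> 1" for x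
  proof -
    have "isCont bump 0" using C0_continuous[OF bump_C0] by (simp add: continuous_on_eq_continuous_at)
    from isCont_tendsto_compose[OF this snull] show ?thesis by (simp add: bump_0)
  qed
  have cut: "L2lim (\<lambda>n x. ?\<theta> n x *\<^sub>R f x) f" if f: "f \<in> L2" for f :: "real^3 \<Rightarrow> 'a"
  proof (rule L2lim_dominated[OF _ L2_measurable[OF f] f])
    note [measurable] = L2_measurable[OF f]
    show "(\<lambda>x. ?\<theta> n x *\<^sub>R f x) \<in> borel_measurable lebesgue" for n by simp
    show "AE x in lebesgue. norm (?\<theta> n x *\<^sub>R f x) \<le> norm (f x)" for n
      using mult_right_mono[OF bump1 norm_ge_zero] by (intro AE_I2) simp
    show "AE x in lebesgue. (\<lambda>n. ?\<theta> n x *\<^sub>R f x) \<longlonglongrightarrow> f x"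
      using tendsto_scaleR[OF \<theta>lim tendsto_const] by (intro AE_I2) fastforce
  qed
  show Ulim: "L2lim ?U u" by (rule cut[OF u])
  have pb: "\<bar>partial k (?\<theta> n) x\<bar> \<le> C k * s n" for k n x
    using C[of k "s n *\<^sub>R x"] s[of n] by (simp add: p\<theta> abs_mult mult.commute mult_left_mono)
  have plim: "L2lim (\<lambda>n x. partial k (?\<theta> n) x *\<^sub>R u x) (\<lambda>x. 0)" for k
  proof (rule L2lim_dominated[OF _ _ L2_bounded_linear[OF bounded_linear_scaleR_right[of "C k"] u]])
    show "AE x in lebesgue. norm (partial k (?\<theta> n) x *\<^sub>R u x) \<le> norm (C k *\<^sub>R u x)" for n
    proof (intro AE_I2)
      fix x
      have C0: "C k \<ge> 0" using C[of k 0] norm_ge_zero by (rule order_trans[rotated])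
      have "\<bar>partial k (?\<theta> n) x\<bar> \<le> C k * 1"
        by (rule order_trans[OF pb mult_left_mono[OF s(2) C0]])
      then show "norm (partial k (?\<theta> n) x *\<^sub>R u x) \<le> norm (C k *\<^sub>R u x)"
        using C0 by (simp add: mult_right_mono)
    qed
    show "AE x in lebesgue. (\<lambda>n. partial k (?\<theta> n) x *\<^sub>R u x) \<longlonglongrightarrow> 0"
    proof (intro AE_I2)
      fix x
      have "(\<lambda>n. C k * s n) \<longlonglongrightarrow> 0" using tendsto_mult_right_zero[OF slim] .
      then have "(\<lambda>n. partial k (?\<theta> n) x) \<longlonglongrightarrow> 0"
        by (rule Lim_null_comparison[rotated]) (use pb in auto)
      then show "(\<lambda>n. partial k (?\<theta> n) x *\<^sub>R u x) \<longlonglongrightarrow> 0"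
        using tendsto_scaleR[OF _ tendsto_const] by fastforce
    qed
  qed auto
  show Glim: "L2lim (\<lambda>n. ?G n k) (g k)" for k
    using L2lim_add[OF cut[OF g[of k]] plim[of k]] by simp
  show "approximable A (?U n) (?G n)" for n
  proof (rule compact_support_approximable[OF A, of _ _ "real (Suc n)"])
    show "mag_weak A (?U n) (?G n)"
      unfolding mag_weak_def
    proof (intro conjI allI)
      show "?U n \<in> L2" by (rule L2lim_L2(2)[OF Ulim])
      fix k
      show "?G n k \<in> L2" by (rule L2lim_L2(2)[OF Glim])
      have "weak_partial k u (\<lambda>x. g k x - (A x $ k) *\<^sub>R J (u x))" using w by (simp add: mag_weak_def)
      from weak_partial_cutoff[OF this \<theta>[of n]]
      show "weak_partial k (?U n) (\<lambda>x. ?G n k x - (A x $ k) *\<^sub>R J (?U n x))"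
        by (simp add: linear_cmul[OF J_linear] algebra_simps)
    qed
    have t0: "?\<theta> n x = 0" if "norm x \<ge> real (Suc n)" for x
      using that by (intro bump_eq_0) (simp add: s_def field_simps del: of_nat_Suc)
    show "?U n x = 0" if "norm x > real (Suc n)" for x using t0[of x] that by simp
    show "?G n k x = 0" if "norm x > real (Suc n)" for k x
      using t0[of x] partial_eq_0_outside[OF t0 that, where k = k] that by simp
  qed
qed

end

section \<open>The commutator of magnetic derivatives\<close>

lemma partial_line_derivative:
  fixes f :: "real^3 \<Rightarrow> real"
  assumes "f differentiable at (a + s *\<^sub>R axis j 1)"
  shows "((\<lambda>s. f (a + s *\<^sub>R axis j 1)) has_real_derivative partial j f (a + s *\<^sub>R axis j 1)) (at s)"
proof -
  have "((\<lambda>s. a + s *\<^sub>R axis j (1::real)) has_derivative (\<lambda>t. t *\<^sub>R axis j 1)) (at s)"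
    by (auto intro!: derivative_eq_intros)
  from has_derivative_compose[OF this has_derivative_partials[OF assms]]
  have "((\<lambda>s. f (a + s *\<^sub>R axis j 1)) has_derivative
    (\<lambda>t. \<Sum>k\<in>UNIV. (t *\<^sub>R axis j 1) $ k *\<^sub>R partial k f (a + s *\<^sub>R axis j 1))) (at s)" .
  moreover have "(\<lambda>t. \<Sum>k\<in>UNIV. (t *\<^sub>R axis j 1) $ k *\<^sub>R partial k f (a + s *\<^sub>R axis j 1))
      = (*) (partial j f (a + s *\<^sub>R axis j 1))"
    by (rule ext) (simp add: axis_def if_distrib if_distribR sum.delta cong: if_cong)
  ultimately show ?thesis by (simp only: has_field_derivative_def)
qed

text \<open>The mean value theorem is applied first in direction \<open>j\<close> and then in direction \<open>k\<close>. The second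
  difference is symmetric in the two directions, which gives the symmetry of second derivatives.\<close>

lemma second_difference_MVT:
  fixes f :: "real^3 \<Rightarrow> real"
  assumes f: "C_k (Suc (Suc 0)) f" and h: "h > 0"
  obtains s t where "0 < s" "s < h" "0 < t" "t < h"
    "f (x + h *\<^sub>R axis j 1 + h *\<^sub>R axis k 1) - f (x + h *\<^sub>R axis j 1) - f (x + h *\<^sub>R axis k 1) + f x
       = h * (h * partial k (partial j f) (x + s *\<^sub>R axis j 1 + t *\<^sub>R axis k 1))"
proof -
  have d: "f differentiable at y" "partial j f differentiable at y" for y using f by auto
  define g where "g s = f ((x + h *\<^sub>R axis k 1) + s *\<^sub>R axis j 1) - f (x + s *\<^sub>R axis j 1)" for s
  have "\<exists>z>0. z < h \<and> g h - g 0 = (h - 0) * (partial j f ((x + h *\<^sub>R axis k 1) + z *\<^sub>R axis j 1) - partial j f (x + z *\<^sub>R axis j 1))"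
    by (rule MVT2[OF h]) (auto simp: g_def[abs_def] intro!: DERIV_diff partial_line_derivative d)
  then obtain s where s: "0 < s" "s < h"
    "g h - g 0 = h * (partial j f ((x + h *\<^sub>R axis k 1) + s *\<^sub>R axis j 1) - partial j f (x + s *\<^sub>R axis j 1))" by auto
  have "\<exists>z>0. z < h \<and> partial j f ((x + s *\<^sub>R axis j 1) + h *\<^sub>R axis k 1) - partial j f ((x + s *\<^sub>R axis j 1) + 0 *\<^sub>R axis k 1)
      = (h - 0) * partial k (partial j f) ((x + s *\<^sub>R axis j 1) + z *\<^sub>R axis k 1)"
    by (rule MVT2[OF h]) (intro partial_line_derivative d)
  then obtain t where t: "0 < t" "t < h"
    "partial j f ((x + s *\<^sub>R axis j 1) + h *\<^sub>R axis k 1) - partial j f (x + s *\<^sub>R axis j 1)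
      = h * partial k (partial j f) ((x + s *\<^sub>R axis j 1) + t *\<^sub>R axis k 1)" by auto
  show ?thesis
  proof (rule that[OF s(1,2) t(1,2)])
    have "f (x + h *\<^sub>R axis j 1 + h *\<^sub>R axis k 1) - f (x + h *\<^sub>R axis j 1) - f (x + h *\<^sub>R axis k 1) + f x = g h - g 0"
      by (simp add: g_def algebra_simps)
    also have "\<dots> = h * (h * partial k (partial j f) (x + s *\<^sub>R axis j 1 + t *\<^sub>R axis k 1))"
      using s(3) t(3) by (simp add: algebra_simps)
    finally show "f (x + h *\<^sub>R axis j 1 + h *\<^sub>R axis k 1) - f (x + h *\<^sub>R axis j 1) - f (x + h *\<^sub>R axis k 1) + f x
       = h * (h * partial k (partial j f) (x + s *\<^sub>R axis j 1 + t *\<^sub>R axis k 1))" .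
  qed
qed

lemma mixed_partials_real:
  fixes f :: "real^3 \<Rightarrow> real"
  assumes f: "C_k (Suc (Suc 0)) f"
  shows "partial k (partial j f) x = partial j (partial k f) x"
proof -
  have ic: "isCont (partial k (partial j f)) x" for j k
    using f by (auto simp: continuous_on_eq_continuous_at)
  have close: "\<exists>d>0. \<forall>h s t. 0 < s \<and> s < h \<and> 0 < t \<and> t < h \<and> h < d \<longrightarrow>
      \<bar>partial k (partial j f) (x + s *\<^sub>R axis j 1 + t *\<^sub>R axis k 1) - partial k (partial j f) x\<bar> < e" if e: "e > 0" for j k e
  proof -
    obtain d where d: "d > 0" "\<And>y. dist y x < d \<Longrightarrow> dist (partial k (partial j f) y) (partial k (partial j f) x) < e"
      using ic[of k j] e unfolding continuous_at_eps_delta by (metis dist_norm)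
    show ?thesis
    proof (intro exI[of _ "d / 2"] conjI allI impI)
      fix h s t :: real assume a: "0 < s \<and> s < h \<and> 0 < t \<and> t < h \<and> h < d / 2"
      have "norm (s *\<^sub>R axis j (1::real) + t *\<^sub>R axis k 1 :: real^3) \<le> s + t"
        using a norm_triangle_ineq[of "s *\<^sub>R axis j (1::real) :: real^3" "t *\<^sub>R axis k 1"] by (simp add: norm_axis_1)
      then have "dist (x + s *\<^sub>R axis j 1 + t *\<^sub>R axis k 1) x < d"
        using a by (simp add: dist_norm add.assoc)
      from d(2)[OF this] show "\<bar>partial k (partial j f) (x + s *\<^sub>R axis j 1 + t *\<^sub>R axis k 1) - partial k (partial j f) x\<bar> < e"
        by (simp add: dist_norm)
    qed (use d in simp)
  qed
  have "\<bar>partial k (partial j f) x - partial j (partial k f) x\<bar> \<le> 0 + e" if e: "e > 0" for e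
  proof -
    from close[of "e/2" k j] close[of "e/2" j k] e obtain d d' where
      d: "d > 0" "\<And>h s t. 0 < s \<Longrightarrow> s < h \<Longrightarrow> 0 < t \<Longrightarrow> t < h \<Longrightarrow> h < d \<Longrightarrow>
      \<bar>partial k (partial j f) (x + s *\<^sub>R axis j 1 + t *\<^sub>R axis k 1) - partial k (partial j f) x\<bar> < e/2"
     and d': "d' > 0" "\<And>h s t. 0 < s \<Longrightarrow> s < h \<Longrightarrow> 0 < t \<Longrightarrow> t < h \<Longrightarrow> h < d' \<Longrightarrow>
      \<bar>partial j (partial k f) (x + s *\<^sub>R axis k 1 + t *\<^sub>R axis j 1) - partial j (partial k f) x\<bar> < e/2"
      by (metis half_gt_zero)
    define h where "h = min d d' / 2"
    have h: "h > 0" "h < d" "h < d'" using d(1) d'(1) by (auto simp: h_def)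
    obtain s t where st: "0 < s" "s < h" "0 < t" "t < h" and 1:
      "f (x + h *\<^sub>R axis j 1 + h *\<^sub>R axis k 1) - f (x + h *\<^sub>R axis j 1) - f (x + h *\<^sub>R axis k 1) + f x
       = h * (h * partial k (partial j f) (x + s *\<^sub>R axis j 1 + t *\<^sub>R axis k 1))"
      by (rule second_difference_MVT[OF f h(1)])
    obtain s' t' where st': "0 < s'" "s' < h" "0 < t'" "t' < h" and 2:
      "f (x + h *\<^sub>R axis k 1 + h *\<^sub>R axis j 1) - f (x + h *\<^sub>R axis k 1) - f (x + h *\<^sub>R axis j 1) + f x
       = h * (h * partial j (partial k f) (x + s' *\<^sub>R axis k 1 + t' *\<^sub>R axis j 1))"
      by (rule second_difference_MVT[OF f h(1)])
    have "h * (h * partial k (partial j f) (x + s *\<^sub>R axis j 1 + t *\<^sub>R axis k 1))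
        = h * (h * partial j (partial k f) (x + s' *\<^sub>R axis k 1 + t' *\<^sub>R axis j 1))"
      unfolding 1[symmetric] 2[symmetric] by (simp add: algebra_simps)
    then have "partial k (partial j f) (x + s *\<^sub>R axis j 1 + t *\<^sub>R axis k 1) = partial j (partial k f) (x + s' *\<^sub>R axis k 1 + t' *\<^sub>R axis j 1)"
      using h(1) by simp
    then show ?thesis using d(2)[OF st h(2)] d'(2)[OF st' h(3)] by linarith
  qed
  then have "\<bar>partial k (partial j f) x - partial j (partial k f) x\<bar> \<le> 0" by (rule field_le_epsilon)
  then show ?thesis by simp
qed

lemma mixed_partials:
  fixes f :: "real^3 \<Rightarrow> 'a::euclidean_space"
  assumes f: "C_k (Suc (Suc 0)) f"
  shows "partial k (partial j f) x = partial j (partial k f) x"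
proof (rule euclidean_eqI)
  fix b :: 'a
  have bl: "bounded_linear (\<lambda>v. v \<bullet> b)" by (rule bounded_linear_inner_left)
  have d: "f differentiable at y" "partial i f differentiable at y" for i y using f by auto
  have 1: "partial i (\<lambda>x. f x \<bullet> b) = (\<lambda>x. partial i f x \<bullet> b)" for i
    using C_k_bounded_linear(2)[OF bl d(1)] by blast
  have 2: "partial l (partial i (\<lambda>x. f x \<bullet> b)) x = partial l (partial i f) x \<bullet> b" for i l
    unfolding 1 by (rule C_k_bounded_linear(2)[OF bl d(2)])
  show "partial k (partial j f) x \<bullet> b = partial j (partial k f) x \<bullet> b"
    unfolding 2[symmetric] by (rule mixed_partials_real[OF C_k_bounded_linear(1)[OF bl f]])
qed

locale magnetic_field = complex_structure J for J :: "'a::euclidean_space \<Rightarrow> 'a" +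
  fixes A B :: "real^3 \<Rightarrow> real^3"
  assumes A: "A \<in> Lloc 2" and B: "B \<in> Lloc 2" and curl: "weak_curl A B"
begin

abbreviation "D \<equiv> mgrad A"

text \<open>The antisymmetric field tensor \<open>\<partial>\<^sub>j A\<^sub>k - \<partial>\<^sub>k A\<^sub>j\<close>, expressed by the magnetic field.\<close>

definition field :: "3 \<Rightarrow> 3 \<Rightarrow> real^3 \<Rightarrow> real" where
  "field j k x = cross3 (axis j 1) (axis k 1) \<bullet> B x"

lemma abs_field_le: "\<bar>field j k x\<bar> \<le> norm (B x)" and field_same: "field j j x = 0"
proof -
  have "\<bar>field j k x\<bar> \<le> norm (cross3 (axis j 1) (axis k (1::real))) * norm (B x)"
    unfolding field_def by (rule Cauchy_Schwarz_ineq2)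
  also have "norm (cross3 (axis j 1) (axis k (1::real))) ^ 2 \<le> 1 ^ 2"
    by (simp add: norm_cross norm_axis_1)
  then have "norm (cross3 (axis j 1) (axis k (1::real))) \<le> 1" by (simp add: power_le_one_iff)
  then have "norm (cross3 (axis j 1) (axis k (1::real))) * norm (B x) \<le> 1 * norm (B x)" by (intro mult_right_mono) auto
  finally show "\<bar>field j k x\<bar> \<le> norm (B x)" by simp
  show "field j j x = 0" by (simp add: field_def)
qed

lemma A_mult_integrable:
  assumes "continuous_on UNIV c" "bounded {x. c x \<noteq> 0}"
  shows "integrable lebesgue (\<lambda>x. c x * A x $ k)"
  using integrable_bounded_linear[OF bounded_linear_vec_nth[of k] Lloc1_scaleR_integrable[OF Lloc2_Lloc1[OF A] assms]]
  by simp

text \<open>The \<open>(j, k)\<close> component of the distributional equation \<open>curl A = B\<close>, by the identity of Binet and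
  Cauchy for \<open>(\<nabla>\<psi> \<times> A) \<sqdot> (e\<^sub>j \<times> e\<^sub>k)\<close>.\<close>

lemma field_weak:
  assumes \<psi>: "\<psi> \<in> C0_infinity"
  shows "(LINT x|lebesgue. partial j \<psi> x * A x $ k - partial k \<psi> x * A x $ j) = - (LINT x|lebesgue. \<psi> x * field j k x)"
proof -
  let ?c = "cross3 (axis j 1) (axis k (1::real))"
  let ?g = "\<lambda>x. cross3 (\<chi> k. partial k \<psi> x) (A x)"
  have g: "?g x = (\<Sum>i\<in>UNIV. cross3 (axis i 1) (partial i \<psi> x *\<^sub>R A x))" for x
    by (simp add: cross3_def sum_3 vec_eq_iff forall_3 axis_def)
  have bl: "bounded_linear (cross3 (axis i 1))" for i
    using bilinear_cross by (simp add: bilinear_def linear_conv_bounded_linear)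
  have ig: "integrable lebesgue ?g"
    unfolding g
    by (intro Bochner_Integration.integrable_sum integrable_bounded_linear[OF bl] Lloc1_scaleR_integrable Lloc2_Lloc1[OF A]
        C0_continuous C0_bounded_support C0_partial \<psi>)
  have iB: "integrable lebesgue (\<lambda>x. \<psi> x *\<^sub>R B x)"
    by (intro Lloc1_scaleR_integrable Lloc2_Lloc1[OF B] C0_continuous C0_bounded_support \<psi>)
  have "partial j \<psi> x * A x $ k - partial k \<psi> x * A x $ j = ?g x \<bullet> ?c" for x
    by (simp add: dot_cross inner_axis)
  then have "(LINT x|lebesgue. partial j \<psi> x * A x $ k - partial k \<psi> x * A x $ j) = (LINT x|lebesgue. ?g x) \<bullet> ?c"
    using ig by simp
  also have "\<dots> = (- (LINT x|lebesgue. \<psi> x *\<^sub>R B x)) \<bullet> ?c"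
    using curl \<psi> unfolding weak_curl_def by simp
  also have "\<dots> = - (LINT x|lebesgue. \<psi> x * field j k x)"
  proof -
    have "(LINT x|lebesgue. \<psi> x * field j k x) = (LINT x|lebesgue. (\<psi> x *\<^sub>R B x) \<bullet> ?c)"
      by (simp add: field_def inner_commute)
    also have "\<dots> = (LINT x|lebesgue. \<psi> x *\<^sub>R B x) \<bullet> ?c"
      by (rule integral_inner_left) (rule iB)
    finally show ?thesis by simp
  qed
  finally show ?thesis .
qed

lemma D_bounded_linear:
  assumes L: "bounded_linear L" and LJ: "\<And>v. L (J v) = J (L v)" and v: "v \<in> C0_infinity"
  shows "D k (\<lambda>x. L (v x)) x = L (D k v x)"
  using C_k_bounded_linear(2)[OF L C0_differentiable[OF v]] bounded_linear.linear[OF L]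
  by (simp add: mgrad_def linear_add linear_cmul LJ)

text \<open>A weak form of \<open>[D\<^sub>j, D\<^sub>k] = (\<partial>\<^sub>j A\<^sub>k - \<partial>\<^sub>k A\<^sub>j) J\<close>, with one derivative moved to \<open>v\<close> and to the
  weight. The terms quadratic in \<open>A\<close> cancel by antisymmetry in \<open>j\<close> and \<open>k\<close>. The terms linear in \<open>A\<close>
  combine to \<open>A\<^sub>k \<partial>\<^sub>j \<theta> - A\<^sub>j \<partial>\<^sub>k \<theta>\<close> with the test function \<open>\<theta> = \<xi> v \<sqdot> J w\<close>, to which the
  distributional curl applies. The remaining terms form a divergence.\<close>

theorem magnetic_commutator:
  assumes \<xi>: "\<And>n. C_k n \<xi>" and v: "v \<in> C0_infinity" and w: "w \<in> C0_infinity"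
  shows "(LINT x|lebesgue. \<xi> x * (D j v x \<bullet> D k w x - D k v x \<bullet> D j w x)
             + (partial j \<xi> x * (v x \<bullet> D k w x) - partial k \<xi> x * (v x \<bullet> D j w x)))
       = - (LINT x|lebesgue. \<xi> x * (v x \<bullet> J (w x)) * field j k x)"
proof -
  let ?a = "\<lambda>k x. (v x \<bullet> partial k w x) * \<xi> x"
  let ?t = "\<lambda>x. (v x \<bullet> J (w x)) * \<xi> x"
  have Jw: "(\<lambda>x. J (w x)) \<in> C0_infinity" by (rule C0_bounded_linear[OF J_bounded_linear w])
  have a: "?a k \<in> C0_infinity" for k by (intro C0_mult[OF C0_inner[OF v] \<xi>] C0_C_k[OF C0_partial[OF w]])
  have t: "?t \<in> C0_infinity" by (intro C0_mult[OF C0_inner[OF v] \<xi>] C0_C_k[OF Jw])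
  have d\<xi>: "\<xi> differentiable at x" for x using \<xi>[of "Suc 0"] by simp
  note dv = C0_differentiable[OF v] and dw = C0_differentiable[OF w] and dpw = C0_differentiable[OF C0_partial[OF w]]
    and dJw = C0_differentiable[OF Jw]
  have pa: "partial i (?a l) x = (partial i v x \<bullet> partial l w x + v x \<bullet> partial i (partial l w) x) * \<xi> x
      + (v x \<bullet> partial l w x) * partial i \<xi> x" for i l x
    by (subst partial_mult[OF _ d\<xi>])
       (auto intro!: bounded_bilinear_differentiable[OF bounded_bilinear_inner] dv dpw simp: partial_inner[OF dv dpw])
  have pt: "partial i ?t x = (partial i v x \<bullet> J (w x) + v x \<bullet> J (partial i w x)) * \<xi> x
      + (v x \<bullet> J (w x)) * partial i \<xi> x" for i x
    by (subst partial_mult[OF _ d\<xi>])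
       (auto intro!: bounded_bilinear_differentiable[OF bounded_bilinear_inner] dv dJw
         simp: partial_inner[OF dv dJw] C_k_bounded_linear(2)[OF J_bounded_linear dw])
  have ia: "integrable lebesgue (partial i (?a l))" for i l
    by (intro integrable_compact_support C0_continuous C0_bounded_support C0_partial a)
  have it: "integrable lebesgue (\<lambda>x. partial i ?t x * A x $ l)" for i l
    by (intro A_mult_integrable C0_continuous C0_bounded_support C0_partial t)
  have Ja: "J a \<bullet> b = - (a \<bullet> J b)" for a b by (rule J_skew)
  have id: "\<xi> x * (D j v x \<bullet> D k w x - D k v x \<bullet> D j w x)
             + (partial j \<xi> x * (v x \<bullet> D k w x) - partial k \<xi> x * (v x \<bullet> D j w x))
      = (partial j (?a k) x - partial k (?a j) x) + (partial j ?t x * A x $ k - partial k ?t x * A x $ j)" for x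
    unfolding pa pt mgrad_def mixed_partials[OF C0_C_k[OF w], of k j]
    by (simp add: inner_add_left inner_add_right Ja algebra_simps)
  have "(LINT x|lebesgue. \<xi> x * (D j v x \<bullet> D k w x - D k v x \<bullet> D j w x)
             + (partial j \<xi> x * (v x \<bullet> D k w x) - partial k \<xi> x * (v x \<bullet> D j w x)))
     = (LINT x|lebesgue. (partial j (?a k) x - partial k (?a j) x) + (partial j ?t x * A x $ k - partial k ?t x * A x $ j))"
    by (simp only: id)
  also have "\<dots> = (LINT x|lebesgue. partial j (?a k) x - partial k (?a j) x)
      + (LINT x|lebesgue. partial j ?t x * A x $ k - partial k ?t x * A x $ j)"
    by (intro Bochner_Integration.integral_add Bochner_Integration.integrable_diff ia it)
  also have "(LINT x|lebesgue. partial j (?a k) x - partial k (?a j) x) = 0"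
    using ia integral_partial_eq_0[OF C0_C_k[OF a] C0_bounded_support[OF a]] by simp
  also have "(LINT x|lebesgue. partial j ?t x * A x $ k - partial k ?t x * A x $ j) = - (LINT x|lebesgue. ?t x * field j k x)"
    by (rule field_weak[OF t])
  finally show ?thesis by (simp add: mult.commute mult.left_commute)
qed

end

section \<open>Hardy inequality and virial inequality for test functions\<close>

lemma smooth_const: "C_k n (\<lambda>x. 1 :: real)"
  by (rule C_k_const)

lemma L2_inner_integrable: "f \<in> L2 \<Longrightarrow> g \<in> L2 \<Longrightarrow> integrable lebesgue (\<lambda>x. f x \<bullet> g x)"
  using L2_weighted_inner(1)[of f g "\<lambda>x. 1" 1] by simp

context magnetic_field
begin

text \<open>The integrand is the ordinary derivative of \<open>\<xi> v \<sqdot> w\<close>; the potential drops out because \<open>J\<close> is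
  skew.\<close>

lemma D_skew:
  assumes \<xi>: "\<And>n. C_k n \<xi>" and v: "v \<in> C0_infinity" and w: "w \<in> C0_infinity"
  shows "(LINT x|lebesgue. \<xi> x * (D k v x \<bullet> w x) + \<xi> x * (v x \<bullet> D k w x) + partial k \<xi> x * (v x \<bullet> w x)) = 0"
proof -
  let ?a = "\<lambda>x. (v x \<bullet> w x) * \<xi> x"
  have a: "?a \<in> C0_infinity" by (intro C0_mult[OF C0_inner[OF v] \<xi>] C0_C_k[OF w])
  have d\<xi>: "\<xi> differentiable at x" for x using \<xi>[of "Suc 0"] by simp
  note dv = C0_differentiable[OF v] and dw = C0_differentiable[OF w]
  have "partial k ?a x = (partial k v x \<bullet> w x + v x \<bullet> partial k w x) * \<xi> x + (v x \<bullet> w x) * partial k \<xi> x" for x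
    by (subst partial_mult[OF _ d\<xi>])
       (auto intro!: bounded_bilinear_differentiable[OF bounded_bilinear_inner] dv dw simp: partial_inner[OF dv dw])
  then have "\<xi> x * (D k v x \<bullet> w x) + \<xi> x * (v x \<bullet> D k w x) + partial k \<xi> x * (v x \<bullet> w x) = partial k ?a x" for x
    by (simp add: mgrad_def inner_add_left inner_add_right J_skew algebra_simps)
  then show ?thesis using integral_partial_eq_0[OF C0_C_k[OF a] C0_bounded_support[OF a]] by simp
qed

definition kin :: "(real^3 \<Rightarrow> 'a) \<Rightarrow> real" where
  "kin v = (\<Sum>k\<in>UNIV. L2sq (D k v))"

lemma kin_nonneg: "kin v \<ge> 0"
  by (simp add: kin_def sum_nonneg L2sq_nonneg)

lemmas D_L2 = mgrad_L2(2)[OF A]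

lemma kin_integral:
  assumes v: "v \<in> C0_infinity"
  shows "integrable lebesgue (\<lambda>x. \<Sum>k\<in>UNIV. norm (D k v x) ^ 2)"
    and "kin v = (LINT x|lebesgue. (\<Sum>k\<in>UNIV. norm (D k v x) ^ 2))"
  using L2_integrable[OF D_L2[OF v]] by (auto simp: kin_def L2sq_def)

text \<open>A regularisation of \<open>x / \<bar>x\<bar>\<^sup>2\<close>, the field with which completing a square gives the Hardy inequality.\<close>

definition hardy_field :: "real \<Rightarrow> 3 \<Rightarrow> real^3 \<Rightarrow> real" where
  "hardy_field e k x = x $ k / (x \<bullet> x + e)"

lemma hardy_field_derivative:
  assumes "e > 0"
  shows "(hardy_field e k has_derivative (\<lambda>h. (h $ k * (x \<bullet> x + e) - x $ k * (2 * (x \<bullet> h))) / (x \<bullet> x + e) ^ 2)) (at x)"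
proof -
  have ne: "x \<bullet> x + e \<noteq> 0" for x :: "real^3" using assms inner_ge_zero[of x] by linarith
  show ?thesis
    unfolding hardy_field_def[abs_def]
    by (rule derivative_eq_intros has_derivative_coord ne refl)+
       (use ne in \<open>auto simp: fun_eq_iff inner_commute power2_eq_square field_simps\<close>)
qed

lemma hardy_field_C1: assumes e: "e > 0" shows "C_k (Suc 0) (hardy_field e k)"
proof -
  have ne: "x \<bullet> x + e \<noteq> 0" for x :: "real^3" using assms inner_ge_zero[of x] by linarith
  have "partial j (hardy_field e k) = (\<lambda>x. (axis j 1 $ k * (x \<bullet> x + e) - x $ k * (2 * (x \<bullet> axis j 1))) / (x \<bullet> x + e) ^ 2)" for j
    by (rule ext) (rule partial_eqI[OF hardy_field_derivative[OF e]])
  then show ?thesis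
    using ne by (auto intro!: continuous_intros differentiableI[OF hardy_field_derivative[OF e]])
qed

lemma hardy_field_pointwise:
  assumes e: "e > 0"
  shows "1/2 * (\<Sum>k\<in>UNIV. partial k (hardy_field e k) x) - 1/4 * (\<Sum>k\<in>UNIV. hardy_field e k x ^ 2) \<ge> 1/4 * (1 / (x \<bullet> x + e))"
proof -
  let ?q = "x \<bullet> x + e"
  have q: "?q > 0" using e inner_ge_zero[of x] by linarith
  have r: "(\<Sum>k\<in>UNIV. (x $ k) ^ 2) = x \<bullet> x" by (simp add: inner_vec_def power2_eq_square)
  have "(\<Sum>k\<in>UNIV. partial k (hardy_field e k) x) = (\<Sum>k\<in>(UNIV::3 set). (?q - 2 * (x $ k) ^ 2) / ?q ^ 2)"
    by (intro sum.cong refl) (subst partial_eqI[OF hardy_field_derivative[OF e]], simp add: inner_axis power2_eq_square algebra_simps)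
  also have "\<dots> = (3 * ?q - 2 * (x \<bullet> x)) / ?q ^ 2"
    by (simp add: sum_divide_distrib[symmetric] sum_subtractf sum_distrib_left[symmetric] r)
  finally have 1: "(\<Sum>k\<in>UNIV. partial k (hardy_field e k) x) = (3 * ?q - 2 * (x \<bullet> x)) / ?q ^ 2" .
  have 2: "(\<Sum>k\<in>UNIV. hardy_field e k x ^ 2) = (x \<bullet> x) / ?q ^ 2"
    by (simp add: hardy_field_def power_divide sum_divide_distrib[symmetric] r)
  have "1/4 * (1 / ?q) = (1/4 * ?q) / ?q ^ 2" using q by (simp add: power2_eq_square)
  also have "\<dots> \<le> (1/2 * (3 * ?q - 2 * (x \<bullet> x)) - 1/4 * (x \<bullet> x)) / ?q ^ 2"
    using e inner_ge_zero[of x] by (intro divide_right_mono) auto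
  also have "\<dots> = 1/2 * ((3 * ?q - 2 * (x \<bullet> x)) / ?q ^ 2) - 1/4 * ((x \<bullet> x) / ?q ^ 2)"
  proof -
    have "(1/2 * a - 1/4 * b) / c = 1/2 * (a / c) - 1/4 * (b / c)" for a b c :: real
      by (simp add: diff_divide_distrib)
    then show ?thesis .
  qed
  finally show ?thesis unfolding 1 2 .
qed

text \<open>Expand the nonnegative square \<open>\<bar>D v + \<zeta> v / 2\<bar>\<^sup>2\<close> for the field \<open>\<zeta> = x / (\<bar>x\<bar>\<^sup>2 + e)\<close>. The cross term is
  \<open>\<zeta> \<sqdot> \<nabla>\<bar>v\<bar>\<^sup>2 / 2\<close>, without potential, and after integration by parts \<open>div \<zeta> / 2 - \<bar>\<zeta>\<bar>\<^sup>2 / 4\<close> is at least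
  \<open>1 / (4 (\<bar>x\<bar>\<^sup>2 + e))\<close>.\<close>

theorem magnetic_Hardy:
  assumes e: "e > 0" and v: "v \<in> C0_infinity"
  shows "integrable lebesgue (\<lambda>x. norm (v x) ^ 2 / (x \<bullet> x + e))"
    and "(LINT x|lebesgue. norm (v x) ^ 2 / (x \<bullet> x + e)) \<le> 4 * kin v"
proof -
  let ?z = "hardy_field e"
  have ne: "x \<bullet> x + e \<noteq> 0" for x :: "real^3" using e inner_ge_zero[of x] by linarith
  have bs: "bounded {x. norm (v x) ^ 2 / (x \<bullet> x + e) \<noteq> 0}"
    by (rule bounded_subset[OF C0_bounded_support[OF v]]) auto
  show i1: "integrable lebesgue (\<lambda>x. norm (v x) ^ 2 / (x \<bullet> x + e))"
    by (intro integrable_compact_support bs continuous_intros C0_continuous v) (use ne in auto)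
  let ?a = "\<lambda>k x. ?z k x * (v x \<bullet> v x)"
  have a1: "C_k (Suc 0) (?a k)" for k by (intro C_k_mult hardy_field_C1 e C_k_inner C0_C_k v)
  have ab: "bounded {x. ?a k x \<noteq> 0}" for k by (rule bounded_subset[OF C0_bounded_support[OF v]]) auto
  have ia: "integrable lebesgue (partial k (?a k))" for k
    by (intro integrable_compact_support bounded_support_partial ab) (use a1 in simp)
  have dz: "?z k differentiable at x" for k x using hardy_field_C1[OF e, of k] by simp
  have pa: "partial k (?a k) x = partial k (?z k) x * (v x \<bullet> v x) + ?z k x * (2 * (partial k v x \<bullet> v x))" for k x
    by (subst partial_mult[OF dz])
       (auto intro!: bounded_bilinear_differentiable[OF bounded_bilinear_inner] C0_differentiable[OF v]
         simp: partial_inner[OF C0_differentiable[OF v] C0_differentiable[OF v]] inner_commute)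
  have pw: "norm (v x) ^ 2 / (x \<bullet> x + e) \<le> 4 * (\<Sum>k\<in>UNIV. norm (D k v x) ^ 2) + 2 * (\<Sum>k\<in>UNIV. partial k (?a k) x)" for x
  proof -
    have sq: "norm (D k v x + (1/2 * ?z k x) *\<^sub>R v x) ^ 2
       = norm (D k v x) ^ 2 + 1/2 * partial k (?a k) x - 1/2 * partial k (?z k) x * (v x \<bullet> v x) + 1/4 * ?z k x ^ 2 * (v x \<bullet> v x)" for k
    proof -
      have Dv: "D k v x \<bullet> v x = partial k v x \<bullet> v x"
        by (simp add: mgrad_def inner_add_left inner_J_self)
      have "norm (d + c *\<^sub>R a) ^ 2 = norm d ^ 2 + 2 * c * (d \<bullet> a) + c ^ 2 * (a \<bullet> a)" for d a :: 'a and c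
        unfolding power2_norm_eq_inner
        by (simp add: inner_add_left inner_add_right inner_commute[of a d] power2_eq_square[of c] algebra_simps)
      then have "norm (D k v x + (1/2 * ?z k x) *\<^sub>R v x) ^ 2
        = norm (D k v x) ^ 2 + 2 * (1/2 * ?z k x) * (partial k v x \<bullet> v x) + (1/2 * ?z k x) ^ 2 * (v x \<bullet> v x)"
        by (simp only: Dv)
      then show ?thesis by (simp add: pa power2_eq_square field_simps)
    qed
    have "0 \<le> (\<Sum>k\<in>UNIV. norm (D k v x + (1/2 * ?z k x) *\<^sub>R v x) ^ 2)" by (intro sum_nonneg) auto
    also have "\<dots> = (\<Sum>k\<in>UNIV. norm (D k v x) ^ 2) + 1/2 * (\<Sum>k\<in>UNIV. partial k (?a k) x)
      - (1/2 * (\<Sum>k\<in>UNIV. partial k (?z k) x) - 1/4 * (\<Sum>k\<in>UNIV. ?z k x ^ 2)) * (v x \<bullet> v x)"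
      unfolding sq by (simp add: sum_3 algebra_simps)
    also have "\<dots> \<le> (\<Sum>k\<in>UNIV. norm (D k v x) ^ 2) + 1/2 * (\<Sum>k\<in>UNIV. partial k (?a k) x)
      - (1/4 * (1 / (x \<bullet> x + e))) * (v x \<bullet> v x)"
      using mult_right_mono[OF hardy_field_pointwise[OF e, of x], of "v x \<bullet> v x"] by simp
    also have "(1/4 * (1 / (x \<bullet> x + e))) * (v x \<bullet> v x) = 1/4 * (norm (v x) ^ 2 / (x \<bullet> x + e))"
      by (simp only: power2_norm_eq_inner times_divide_eq_left times_divide_eq_right mult_1_left)
    finally show ?thesis by linarith
  qed
  have "(LINT x|lebesgue. norm (v x) ^ 2 / (x \<bullet> x + e))
     \<le> (LINT x|lebesgue. 4 * (\<Sum>k\<in>UNIV. norm (D k v x) ^ 2) + 2 * (\<Sum>k\<in>UNIV. partial k (?a k) x))"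
    by (intro integral_mono i1 pw Bochner_Integration.integrable_add integrable_mult_right
        Bochner_Integration.integrable_sum ia kin_integral v)
  also have "\<dots> = 4 * kin v + 2 * (\<Sum>k\<in>UNIV. LINT x|lebesgue. partial k (?a k) x)"
    using kin_integral[OF v] ia by (simp del: Bochner_Integration.integral_mult_right_zero
        add: Bochner_Integration.integral_add Bochner_Integration.integral_sum)
  also have "\<dots> = 4 * kin v" using integral_partial_eq_0[OF a1 ab] by simp
  finally show "(LINT x|lebesgue. norm (v x) ^ 2 / (x \<bullet> x + e)) \<le> 4 * kin v" .
qed

lemma B_sq_integrable:
  assumes "continuous_on UNIV c" "bounded {x. c x \<noteq> 0}"
  shows "integrable lebesgue (\<lambda>x. c x * norm (B x) ^ 2)" "integrable lebesgue (\<lambda>x. c x * norm (B x))"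
proof -
  have "(\<lambda>x. norm (B x) ^ 2) \<in> Lloc 1" "(\<lambda>x. norm (B x)) \<in> Lloc 1"
    using B Lloc2_Lloc1[OF B] by (auto simp: Lloc_def)
  from this[THEN Lloc1_scaleR_integrable, OF assms]
  show "integrable lebesgue (\<lambda>x. c x * norm (B x) ^ 2)" "integrable lebesgue (\<lambda>x. c x * norm (B x))" by simp_all
qed

lemma weighted_field_integrable:
  assumes v: "v \<in> C0_infinity"
  shows "integrable lebesgue (\<lambda>x. norm x ^ 2 * norm (B x) ^ 2 * norm (v x) ^ 2)"
proof -
  have "integrable lebesgue (\<lambda>x. (norm x ^ 2 * norm (v x) ^ 2) * norm (B x) ^ 2)"
    by (rule B_sq_integrable(1))
       (use C0_continuous[OF v] C0_bounded_support[OF v] in \<open>auto intro!: continuous_intros elim!: bounded_subset\<close>)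
  then show ?thesis by (simp add: mult.assoc mult.commute[of "norm (v _) ^ 2"])
qed

end

text \<open>The anticommuting matrices \<open>\<alpha>\<^sub>j\<close> enter only through their algebra. The constant \<open>1/144\<close> is the
  square of the bound \<open>1/12\<close> on \<open>c\<close>.\<close>

locale magnetic_dirac = magnetic_field J A B for J :: "'a::euclidean_space \<Rightarrow> 'a" and A B +
  fixes \<alpha> :: "3 \<Rightarrow> 'a \<Rightarrow> 'a"
  assumes \<alpha>_bounded_linear: "bounded_linear (\<alpha> j)" and \<alpha>_symmetric: "\<alpha> j v \<bullet> w = v \<bullet> \<alpha> j w"
    and \<alpha>_square: "\<alpha> j (\<alpha> j v) = v" and \<alpha>_anticommute: "j \<noteq> k \<Longrightarrow> \<alpha> j (\<alpha> k v) = - \<alpha> k (\<alpha> j v)"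
    and \<alpha>_J: "\<alpha> j (J v) = J (\<alpha> j v)"
    and subordinate: "f \<in> C0_infinity \<Longrightarrow>
      (LINT x|lebesgue. norm x ^ 2 * norm (B x) ^ 2 * norm (f x) ^ 2) \<le> 1/144 * kin f"
begin

lemma \<alpha>_linear: "linear (\<alpha> j)"
  by (rule bounded_linear.linear[OF \<alpha>_bounded_linear])

lemma norm_\<alpha>: "norm (\<alpha> j v) = norm v"
  using \<alpha>_symmetric[of j v "\<alpha> j v"] by (simp add: \<alpha>_square norm_eq_sqrt_inner)

lemmas \<alpha>_C0 = C0_bounded_linear[OF \<alpha>_bounded_linear]
lemmas D_\<alpha> = D_bounded_linear[OF \<alpha>_bounded_linear \<alpha>_J]

definition T :: "(real^3 \<Rightarrow> 'a) \<Rightarrow> real^3 \<Rightarrow> 'a" where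
  "T v x = (\<Sum>j\<in>UNIV. \<alpha> j (D j v x))"

lemma T_L2: "v \<in> C0_infinity \<Longrightarrow> T v \<in> L2"
  unfolding T_def[abs_def] by (intro L2_sum L2_bounded_linear[OF \<alpha>_bounded_linear] D_L2)

lemma T_skew:
  assumes v: "v \<in> C0_infinity" and w: "w \<in> C0_infinity"
  shows "(LINT x|lebesgue. T v x \<bullet> w x) = - (LINT x|lebesgue. v x \<bullet> T w x)"
proof -
  have i: "integrable lebesgue (\<lambda>x. D j v x \<bullet> \<alpha> j (w x))" "integrable lebesgue (\<lambda>x. v x \<bullet> \<alpha> j (D j w x))" for j
    by (intro L2_inner_integrable D_L2 v C0_L2 \<alpha>_C0 w L2_bounded_linear[OF \<alpha>_bounded_linear])+
  have "(LINT x|lebesgue. D j v x \<bullet> \<alpha> j (w x)) = - (LINT x|lebesgue. v x \<bullet> \<alpha> j (D j w x))" for j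
    using D_skew[OF smooth_const v \<alpha>_C0[OF w], of j j] i[of j] by (simp add: partial_const D_\<alpha>[OF w])
  then show ?thesis
    using i by (simp add: T_def inner_sum_left inner_sum_right \<alpha>_symmetric Bochner_Integration.integral_sum sum_negf)
qed

text \<open>In \<open>\<bar>T v\<bar>\<^sup>2 = \<Sum>\<^sub>j\<^sub>k D\<^sub>j v \<sqdot> \<alpha>\<^sub>j \<alpha>\<^sub>k D\<^sub>k v\<close> the diagonal is the Dirichlet form. By anticommutation the
  terms \<open>(j, k)\<close> and \<open>(k, j)\<close> together are \<open>D\<^sub>j v \<sqdot> D\<^sub>k w - D\<^sub>k v \<sqdot> D\<^sub>j w\<close> with \<open>w = \<alpha>\<^sub>j \<alpha>\<^sub>k v\<close>, a
  commutator of magnetic derivatives. There are three such pairs.\<close>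

lemma kin_le_T_plus_field:
  assumes v: "v \<in> C0_infinity"
  shows "kin v \<le> L2sq (T v) + 3 * (LINT x|lebesgue. norm (v x) ^ 2 * norm (B x))"
proof -
  let ?w = "\<lambda>j k x. \<alpha> j (\<alpha> k (v x))"
  have w: "?w j k \<in> C0_infinity" for j k by (intro \<alpha>_C0 v)
  let ?E = "\<lambda>j k x. D j v x \<bullet> D k (?w j k) x - D k v x \<bullet> D j (?w j k) x"
  let ?b = "LINT x|lebesgue. norm (v x) ^ 2 * norm (B x)"
  have Dw: "D i (?w j k) x = \<alpha> j (\<alpha> k (D i v x))" for i j k x
    by (simp add: D_\<alpha>[OF \<alpha>_C0[OF v]] D_\<alpha>[OF v])
  have iE: "integrable lebesgue (?E j k)" for j k
    by (intro Bochner_Integration.integrable_diff L2_inner_integrable D_L2 v w)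
  have pw: "norm (T v x) ^ 2 = (\<Sum>k\<in>UNIV. norm (D k v x) ^ 2) + 1/2 * (\<Sum>j\<in>UNIV. \<Sum>k\<in>UNIV. ?E j k x)" for x
  proof -
    have n: "norm (T v x) ^ 2 = (\<Sum>j\<in>UNIV. \<Sum>k\<in>UNIV. D j v x \<bullet> \<alpha> j (\<alpha> k (D k v x)))"
      by (simp add: power2_norm_eq_inner T_def inner_sum_left inner_sum_right \<alpha>_symmetric) (rule sum.swap)
    show ?thesis
      unfolding n Dw
      by (simp add: sum_3 \<alpha>_square power2_norm_eq_inner
          \<alpha>_anticommute[of 2 1] \<alpha>_anticommute[of 3 1] \<alpha>_anticommute[of 3 2] algebra_simps)
  qed
  have ib: "integrable lebesgue (\<lambda>x. norm (v x) ^ 2 * norm (B x))"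
    by (rule B_sq_integrable(2)) (use C0_continuous[OF v] C0_bounded_support[OF v] in \<open>auto intro!: continuous_intros\<close>)
  have b0: "?b \<ge> 0" by (intro Bochner_Integration.integral_nonneg) auto
  have E: "\<bar>LINT x|lebesgue. ?E j k x\<bar> \<le> (if j = k then 0 else ?b)" for j k
  proof -
    have eq: "(LINT x|lebesgue. ?E j k x) = - (LINT x|lebesgue. (v x \<bullet> J (?w j k x)) * field j k x)"
      using magnetic_commutator[OF smooth_const v w[of j k], of j k] by (simp add: partial_const)
    show ?thesis
    proof (cases "j = k")
      case False
      have le: "\<bar>(v x \<bullet> J (?w j k x)) * field j k x\<bar> \<le> norm (v x) ^ 2 * norm (B x)" for x
      proof -
        have "\<bar>v x \<bullet> J (?w j k x)\<bar> \<le> norm (v x) ^ 2"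
          using Cauchy_Schwarz_ineq2[of "v x" "J (?w j k x)"] by (simp add: norm_J norm_\<alpha> power2_eq_square)
        then show ?thesis unfolding abs_mult by (intro mult_mono abs_field_le) auto
      qed
      have "\<bar>LINT x|lebesgue. ?E j k x\<bar> \<le> (LINT x|lebesgue. \<bar>(v x \<bullet> J (?w j k x)) * field j k x\<bar>)"
        unfolding eq abs_minus_cancel by (rule integral_abs_bound)
      also have "\<dots> \<le> ?b"
        by (rule integral_mono_AE'[OF ib]) (use le in auto)
      finally show ?thesis using False by simp
    qed (simp add: eq field_same)
  qed
  have "L2sq (T v) = (LINT x|lebesgue. (\<Sum>k\<in>UNIV. norm (D k v x) ^ 2) + 1/2 * (\<Sum>j\<in>UNIV. \<Sum>k\<in>UNIV. ?E j k x))"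
    by (simp only: L2sq_def pw)
  also have "\<dots> = kin v + (LINT x|lebesgue. 1/2 * (\<Sum>j\<in>UNIV. \<Sum>k\<in>UNIV. ?E j k x))"
    unfolding kin_integral(2)[OF v]
    by (intro Bochner_Integration.integral_add kin_integral(1)[OF v] integrable_mult_right Bochner_Integration.integrable_sum iE)
  also have "(LINT x|lebesgue. 1/2 * (\<Sum>j\<in>UNIV. \<Sum>k\<in>UNIV. ?E j k x)) = 1/2 * (\<Sum>j\<in>UNIV. \<Sum>k\<in>UNIV. LINT x|lebesgue. ?E j k x)"
    using iE by (simp only: Bochner_Integration.integral_mult_right_zero Bochner_Integration.integral_sum Bochner_Integration.integrable_sum)
  finally have eq: "L2sq (T v) = kin v + 1/2 * (\<Sum>j\<in>UNIV. \<Sum>k\<in>UNIV. LINT x|lebesgue. ?E j k x)" .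
  have "\<bar>\<Sum>j\<in>UNIV. \<Sum>k\<in>UNIV. LINT x|lebesgue. ?E j k x\<bar> \<le> (\<Sum>j\<in>UNIV. \<Sum>k\<in>(UNIV :: 3 set). (if j = (k :: 3) then 0 else ?b))"
    by (intro order_trans[OF sum_abs] sum_mono E)
  also have "\<dots> = 6 * ?b" by (simp add: sum_3)
  finally show ?thesis using eq by linarith
qed

text \<open>Split \<open>\<bar>B\<bar> \<bar>v\<bar>\<^sup>2 = (\<bar>x\<bar> \<bar>B\<bar> \<bar>v\<bar>) (\<bar>v\<bar> / \<bar>x\<bar>)\<close>: the first factor is small by hypothesis, the second is
  controlled by the Hardy inequality. Replacing \<open>\<bar>x\<bar>\<^sup>2\<close> by \<open>\<bar>x\<bar>\<^sup>2 + e\<close> costs \<open>12 e \<integral> \<bar>B\<bar>\<^sup>2 \<bar>v\<bar>\<^sup>2\<close>.\<close>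

lemma field_term_le: 
  assumes v: "v \<in> C0_infinity"
  shows "(LINT x|lebesgue. norm (v x) ^ 2 * norm (B x)) \<le> kin v / 6"
proof (rule field_le_epsilon)
  fix d :: real assume d: "d > 0"
  note cv = C0_continuous[OF v] and bv = C0_bounded_support[OF v]
  have c: "continuous_on UNIV (\<lambda>x. norm (v x) ^ 2)" by (intro continuous_intros cv)
  have b: "bounded {x. norm (v x) ^ 2 \<noteq> 0}" using bv by simp
  let ?c = "LINT x|lebesgue. norm (v x) ^ 2 * norm (B x) ^ 2"
  have c0: "?c \<ge> 0" by (intro Bochner_Integration.integral_nonneg) auto
  define e where "e = d / (12 * (?c + 1))"
  have c1: "?c + 1 > 0" using c0 by linarith
  have e: "e > 0" unfolding e_def using d c1 by (intro divide_pos_pos mult_pos_pos) auto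
  have ec: "12 * e * ?c \<le> d"
  proof -
    have "12 * e * ?c \<le> 12 * e * (?c + 1)" using e by (intro mult_left_mono) auto
    also have "\<dots> = d"
    proof -
      have "12 * (d / (12 * a)) * a = d" if "a > 0" for a :: real using that by simp
      from this[OF c1] show ?thesis by (simp only: e_def)
    qed
    finally show ?thesis .
  qed
  note i1 = weighted_field_integrable[OF v]
  have i2: "integrable lebesgue (\<lambda>x. norm (v x) ^ 2 * norm (B x) ^ 2)" by (rule B_sq_integrable(1)[OF c b])
  note H = magnetic_Hardy[OF e v]
  have pw: "norm (v x) ^ 2 * norm (B x) \<le> 12 * (norm x ^ 2 * norm (B x) ^ 2 * norm (v x) ^ 2) + 12 * e * (norm (v x) ^ 2 * norm (B x) ^ 2)
      + 1/48 * (norm (v x) ^ 2 / (x \<bullet> x + e))" for x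
  proof -
    let ?q = "x \<bullet> x + e"
    have q: "?q > 0" using e inner_ge_zero[of x] by linarith
    have "norm (v x) ^ 2 * norm (B x) = (sqrt ?q * norm (B x) * norm (v x)) * (norm (v x) / sqrt ?q)"
      using q by (simp add: power2_eq_square)
    \<comment> \<open>the weight 24 balances the constants 1/144 and 4: both parts contribute a twelfth\<close>
    also have "\<dots> \<le> 24 / 2 * (sqrt ?q * norm (B x) * norm (v x)) ^ 2 + (norm (v x) / sqrt ?q) ^ 2 / (2 * 24)"
      by (rule mult_le_squares) simp
    also have "\<dots> = 12 * (norm x ^ 2 * norm (B x) ^ 2 * norm (v x) ^ 2) + 12 * e * (norm (v x) ^ 2 * norm (B x) ^ 2)
      + 1/48 * (norm (v x) ^ 2 / ?q)"
      using q by (simp add: power_mult_distrib power_divide dot_square_norm algebra_simps)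
    finally show ?thesis .
  qed
  have "(LINT x|lebesgue. norm (v x) ^ 2 * norm (B x))
    \<le> (LINT x|lebesgue. 12 * (norm x ^ 2 * norm (B x) ^ 2 * norm (v x) ^ 2) + 12 * e * (norm (v x) ^ 2 * norm (B x) ^ 2)
      + 1/48 * (norm (v x) ^ 2 / (x \<bullet> x + e)))"
    by (intro integral_mono pw B_sq_integrable(2)[OF c b] Bochner_Integration.integrable_add integrable_mult_right i1 i2 H(1))
  also have "\<dots> = 12 * (LINT x|lebesgue. norm x ^ 2 * norm (B x) ^ 2 * norm (v x) ^ 2) + 12 * e * ?c
      + 1/48 * (LINT x|lebesgue. norm (v x) ^ 2 / (x \<bullet> x + e))"
    using i1 i2 H(1) by (simp only: Bochner_Integration.integral_add Bochner_Integration.integral_mult_right_zero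
        integrable_mult_right Bochner_Integration.integrable_add)
  also have "\<dots> \<le> 12 * (1/144 * kin v) + d + 1/48 * (4 * kin v)"
    by (intro add_mono mult_left_mono subordinate v ec H(2)) auto
  also have "\<dots> = kin v / 6 + d" by simp
  finally show "(LINT x|lebesgue. norm (v x) ^ 2 * norm (B x)) \<le> kin v / 6 + d" .
qed

lemma kin_le_T: "v \<in> C0_infinity \<Longrightarrow> kin v \<le> 2 * L2sq (T v)"
  using kin_le_T_plus_field[of v] field_term_le[of v] by linarith

text \<open>The sum over \<open>j\<close> and \<open>k\<close> of the weak commutators with weight \<open>\<Xi>\<^sub>k\<close>, applied to \<open>v\<close> and \<open>\<alpha>\<^sub>j w\<close>, is a weak
  form of the commutator of \<open>T\<close> with \<open>\<Xi> \<sqdot> D\<close>. What remains is the field term, at most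
  \<open>6 \<integral> \<bar>x\<bar> \<bar>B\<bar> \<bar>v\<bar> \<bar>w\<bar>\<close>, six being the number of pairs \<open>j \<noteq> k\<close>.\<close>

theorem virial_bound:
  assumes \<Xi>: "\<And>k. \<Xi> k \<in> C0_infinity" and le: "\<And>k x. \<bar>\<Xi> k x\<bar> \<le> norm x"
    and v: "v \<in> C0_infinity" and w: "w \<in> C0_infinity"
  shows "\<bar>LINT x|lebesgue. (\<Sum>k\<in>UNIV. \<Xi> k x * (T v x \<bullet> D k w x - D k v x \<bullet> T w x))
      + (\<Sum>j\<in>UNIV. \<Sum>k\<in>UNIV. partial j (\<Xi> k) x * (v x \<bullet> \<alpha> j (D k w x)))
      - (\<Sum>k\<in>UNIV. partial k (\<Xi> k) x) * (v x \<bullet> T w x)\<bar> \<le> 1/3 * L2sq (T v) + 3/8 * L2sq w"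
proof -
  let ?G = "\<lambda>j k x. \<Xi> k x * (D j v x \<bullet> D k (\<lambda>x. \<alpha> j (w x)) x - D k v x \<bullet> D j (\<lambda>x. \<alpha> j (w x)) x)
     + (partial j (\<Xi> k) x * (v x \<bullet> D k (\<lambda>x. \<alpha> j (w x)) x) - partial k (\<Xi> k) x * (v x \<bullet> D j (\<lambda>x. \<alpha> j (w x)) x))"
  have bd: "\<exists>C. \<forall>x. \<bar>f x\<bar> \<le> C" if f: "f \<in> C0_infinity" for f :: "real^3 \<Rightarrow> real"
    by (rule bounded_range_compact_support[OF C0_continuous[OF f] C0_bounded_support[OF f]]) auto
  have wi: "integrable lebesgue (\<lambda>x. f x * (g x \<bullet> h x))" if f: "f \<in> C0_infinity" and gh: "g \<in> L2" "h \<in> L2"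
    for f :: "real^3 \<Rightarrow> real" and g h :: "real^3 \<Rightarrow> 'a"
    using bd[OF f] L2_weighted_inner(1)[OF gh continuous_lebesgue_measurable[OF C0_continuous[OF f]]] by blast
  have iG: "integrable lebesgue (?G j k)" for j k
    unfolding right_diff_distrib
    by (intro Bochner_Integration.integrable_add Bochner_Integration.integrable_diff wi \<Xi> C0_partial D_L2 v \<alpha>_C0 w C0_L2)
  have G: "(LINT x|lebesgue. ?G j k x) = - (LINT x|lebesgue. \<Xi> k x * (v x \<bullet> J (\<alpha> j (w x))) * field j k x)" for j k
    by (rule magnetic_commutator[OF C0_C_k[OF \<Xi>] v \<alpha>_C0[OF w]])
  have sumG: "(\<Sum>k\<in>UNIV. \<Xi> k x * (T v x \<bullet> D k w x - D k v x \<bullet> T w x))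
      + (\<Sum>j\<in>UNIV. \<Sum>k\<in>UNIV. partial j (\<Xi> k) x * (v x \<bullet> \<alpha> j (D k w x)))
      - (\<Sum>k\<in>UNIV. partial k (\<Xi> k) x) * (v x \<bullet> T w x) = (\<Sum>j\<in>UNIV. \<Sum>k\<in>UNIV. ?G j k x)" for x
    unfolding D_\<alpha>[OF w]
    by (simp add: T_def sum_3 inner_add_left inner_add_right \<alpha>_symmetric algebra_simps)
  let ?r = "\<lambda>x. 4 * (norm x ^ 2 * norm (B x) ^ 2 * norm (v x) ^ 2) + 1/16 * norm (w x) ^ 2"
  note i1 = weighted_field_integrable[OF v]
  have ir: "integrable lebesgue ?r" using i1 L2_integrable[OF C0_L2[OF w]] by simp
  have r: "(LINT x|lebesgue. ?r x) \<le> 4 * (1/144 * kin v) + 1/16 * L2sq w"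
  proof -
    have "(LINT x|lebesgue. ?r x) = 4 * (LINT x|lebesgue. norm x ^ 2 * norm (B x) ^ 2 * norm (v x) ^ 2) + 1/16 * L2sq w"
      using i1 L2_integrable[OF C0_L2[OF w]] by (simp add: L2sq_def)
    then show ?thesis using subordinate[OF v] by linarith
  qed
  have Gle: "\<bar>LINT x|lebesgue. ?G j k x\<bar> \<le> (if j = k then 0 else LINT x|lebesgue. ?r x)" for j k
  proof (cases "j = k")
    case False
    have pw: "\<bar>\<Xi> k x * (v x \<bullet> J (\<alpha> j (w x))) * field j k x\<bar> \<le> ?r x" for x
    proof -
      have "\<bar>v x \<bullet> J (\<alpha> j (w x))\<bar> \<le> norm (v x) * norm (w x)"
        using Cauchy_Schwarz_ineq2[of "v x" "J (\<alpha> j (w x))"] by (simp add: norm_J norm_\<alpha>)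
      then have "\<bar>\<Xi> k x * (v x \<bullet> J (\<alpha> j (w x))) * field j k x\<bar> \<le> (norm x * (norm (v x) * norm (w x))) * norm (B x)"
        unfolding abs_mult by (intro mult_mono abs_field_le le) auto
      also have "\<dots> = (norm x * norm (B x) * norm (v x)) * norm (w x)" by simp
      \<comment> \<open>with the weight 8 the two parts of the bound add up to 1/3 + 3/8 < 1\<close>
      also have "\<dots> \<le> 8 / 2 * (norm x * norm (B x) * norm (v x)) ^ 2 + norm (w x) ^ 2 / (2 * 8)"
        by (rule mult_le_squares) simp
      also have "\<dots> = ?r x" by (simp add: power_mult_distrib)
      finally show ?thesis .
    qed
    have "\<bar>LINT x|lebesgue. ?G j k x\<bar> \<le> (LINT x|lebesgue. \<bar>\<Xi> k x * (v x \<bullet> J (\<alpha> j (w x))) * field j k x\<bar>)"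
      unfolding G abs_minus_cancel by (rule integral_abs_bound)
    also have "\<dots> \<le> (LINT x|lebesgue. ?r x)"
      by (rule integral_mono_AE'[OF ir]) (use pw in auto)
    finally show ?thesis using False by simp
  qed (simp add: G field_same)
  have "(LINT x|lebesgue. (\<Sum>j\<in>UNIV. \<Sum>k\<in>UNIV. ?G j k x)) = (\<Sum>j\<in>UNIV. \<Sum>k\<in>UNIV. LINT x|lebesgue. ?G j k x)"
    using iG by (simp only: Bochner_Integration.integral_sum Bochner_Integration.integrable_sum)
  then have "\<bar>LINT x|lebesgue. (\<Sum>j\<in>UNIV. \<Sum>k\<in>UNIV. ?G j k x)\<bar>
     \<le> (\<Sum>j\<in>UNIV. \<Sum>k\<in>(UNIV::3 set). (if j = (k::3) then 0 else LINT x|lebesgue. ?r x))"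
    by (simp only:) (intro order_trans[OF sum_abs] sum_mono Gle)
  also have "\<dots> = 6 * (LINT x|lebesgue. ?r x)" by (simp only: sum_3) simp
  also have "\<dots> \<le> 6 * (4 * (1/144 * kin v) + 1/16 * L2sq w)" using r by simp
  also have "\<dots> \<le> 1/3 * L2sq (T v) + 3/8 * L2sq w" using kin_le_T[OF v] by simp
  finally show ?thesis unfolding sumG .
qed

end

section \<open>Absence of eigenvalues\<close>

lemma L2_weight_tendsto:
  assumes f: "f \<in> L2" and g: "g \<in> L2" and bm[measurable]: "\<And>n. b n \<in> borel_measurable lebesgue"
    and C: "\<And>n x. \<bar>b n x\<bar> \<le> C" and lim: "\<And>x. (\<lambda>n. b n x) \<longlonglongrightarrow> c"
  shows "(\<lambda>n. LINT x|lebesgue. b n x * (f x \<bullet> g x)) \<longlonglongrightarrow> c * (LINT x|lebesgue. f x \<bullet> g x)"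
proof -
  note [measurable] = L2_measurable[OF f] L2_measurable[OF g]
  have "(\<lambda>n. LINT x|lebesgue. b n x * (f x \<bullet> g x)) \<longlonglongrightarrow> (LINT x|lebesgue. c * (f x \<bullet> g x))"
  proof (rule integral_dominated_convergence)
    show "integrable lebesgue (\<lambda>x. C * (norm (f x) * norm (g x)))"
      using L2_norm_mult_integrable[OF f g] by simp
    show "AE x in lebesgue. (\<lambda>n. b n x * (f x \<bullet> g x)) \<longlonglongrightarrow> c * (f x \<bullet> g x)"
      by (intro AE_I2 tendsto_intros lim)
    have C0: "C \<ge> 0" using C[of 0 0] by linarith
    show "AE x in lebesgue. norm (b n x * (f x \<bullet> g x)) \<le> C * (norm (f x) * norm (g x))" for n
      unfolding real_norm_def abs_mult by (intro AE_I2 mult_mono C Cauchy_Schwarz_ineq2 C0) auto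
  qed simp_all
  then show ?thesis by simp
qed

text \<open>The components of the generator \<open>x\<close> of dilations, cut off at radius \<open>n + 1\<close>.\<close>

definition dilation :: "nat \<Rightarrow> 3 \<Rightarrow> real^3 \<Rightarrow> real" where
  "dilation n k x = bump (inverse (real (Suc n)) *\<^sub>R x) * x $ k"

lemma dilation_C0: "dilation n k \<in> C0_infinity"
  unfolding dilation_def[abs_def] by (intro C0_mult scaled_bump_C0 C_k_coord) simp

lemma dilation_le: "\<bar>dilation n k x\<bar> \<le> norm x"
proof -
  have "\<bar>dilation n k x\<bar> \<le> 1 * norm x"
    unfolding dilation_def abs_mult
    by (intro mult_mono component_le_norm_cart) (auto simp: bump_nonneg bump_le_1)
  then show ?thesis by simp
qed

text \<open>The Jacobian at scale \<open>n + 1\<close> is the one at scale \<open>1\<close>, evaluated at the rescaled point. Hence it is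
  bounded uniformly in \<open>n\<close> and converges to its value at the origin, the identity.\<close>

lemma partial_dilation:
  "partial j (dilation n k) x = partial j (\<lambda>y. bump y * y $ k) (inverse (real (Suc n)) *\<^sub>R x)"
proof -
  let ?s = "inverse (real (Suc n))" and ?h = "\<lambda>y::real^3. bump y * y $ k"
  have h: "?h \<in> C0_infinity" by (intro C0_mult bump_C0 C_k_coord)
  have "dilation n k = (\<lambda>x. real (Suc n) * ?h (0 + ?s *\<^sub>R x))"
    by (rule ext) (simp add: dilation_def del: of_nat_Suc)
  then have "partial j (dilation n k) x = real (Suc n) * partial j (\<lambda>x. ?h (0 + ?s *\<^sub>R x)) x"
    using C_k_bounded_linear(2)[OF bounded_linear_mult_right[of "real (Suc n)"], of "\<lambda>x. ?h (0 + ?s *\<^sub>R x)" x j]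
      C0_differentiable[OF C0_affine[OF _ h, of ?s 0]] by simp
  also have "partial j (\<lambda>x. ?h (0 + ?s *\<^sub>R x)) x = ?s *\<^sub>R partial j ?h (0 + ?s *\<^sub>R x)"
    by (rule partial_affine[OF C0_differentiable[OF h]])
  finally show ?thesis by (simp del: of_nat_Suc)
qed

lemma partial_dilation_bounded: obtains C where "\<And>n x. \<bar>partial j (dilation n k) x\<bar> \<le> C"
proof -
  let ?h = "\<lambda>y::real^3. bump y * y $ k"
  have h: "partial j ?h \<in> C0_infinity" by (intro C0_partial C0_mult bump_C0 C_k_coord)
  obtain C where C: "\<And>x. norm (partial j ?h x) \<le> C"
    by (rule bounded_range_compact_support[OF C0_continuous[OF h] C0_bounded_support[OF h]]) blast
  show ?thesis by (rule that[of C]) (use C in \<open>simp add: partial_dilation\<close>)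
qed

lemma partial_dilation_tendsto: "(\<lambda>n. partial j (dilation n k) x) \<longlonglongrightarrow> (if j = k then 1 else 0)"
proof -
  let ?h = "\<lambda>y::real^3. bump y * y $ k"
  have "?h \<in> C0_infinity" by (intro C0_mult bump_C0 C_k_coord)
  then have "isCont (partial j ?h) 0"
    using C0_continuous[OF C0_partial] by (auto simp: continuous_on_eq_continuous_at)
  moreover have "(\<lambda>n. inverse (real (Suc n)) *\<^sub>R x) \<longlonglongrightarrow> 0"
    using tendsto_scaleR[OF LIMSEQ_inverse_real_of_nat tendsto_const[of x]] by simp
  ultimately have "(\<lambda>n. partial j ?h (inverse (real (Suc n)) *\<^sub>R x)) \<longlonglongrightarrow> partial j ?h 0"
    by (rule isCont_tendsto_compose)
  moreover have "partial j ?h 0 = (if j = k then 1 else 0)"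
    by (subst partial_mult[OF C0_differentiable[OF bump_C0] differentiableI[OF has_derivative_coord]])
       (simp add: bump_0 partial_coord)
  ultimately show ?thesis by (simp add: partial_dilation)
qed

context magnetic_dirac
begin

text \<open>The equation is \<open>T u = M u - b u\<close>, where \<open>M\<close> is skew with respect to the real inner product and \<open>a + i b\<close> is the
  eigenvalue. As \<open>T\<close> is skew too, \<open>b \<parallel>u\<parallel>\<^sup>2 = 0\<close>. For \<open>b = 0\<close> the test functions \<open>w\<^sub>n = M v\<^sub>n\<close> approximate
  \<open>M u\<close> together with their magnetic derivatives, because \<open>M\<close> is a constant matrix that commutes
  with \<open>J\<close>. The virial inequality for \<open>v\<^sub>n\<close> and \<open>w\<^sub>n\<close> is passed to the limit first in \<open>n\<close> and then in
  the scale \<open>m\<close> of the dilation field.\<close>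

theorem dirac_eigenfunction_zero:
  fixes \<beta> :: "'a \<Rightarrow> 'a" and a b :: real
  assumes \<beta>_bl: "bounded_linear \<beta>" and \<beta>_symmetric: "\<And>v w. \<beta> v \<bullet> w = v \<bullet> \<beta> w"
    and \<beta>_square: "\<And>v. \<beta> (\<beta> v) = v" and \<beta>_J: "\<And>v. \<beta> (J v) = J (\<beta> v)"
    and \<beta>_\<alpha>: "\<And>j v. \<alpha> j (\<beta> v) = - \<beta> (\<alpha> j v)"
    and w: "mag_weak A u g"
    and eq: "AE x in lebesgue. (\<Sum>j\<in>UNIV. \<alpha> j (g j x)) = a *\<^sub>R J (u x) - b *\<^sub>R u x - (1/2) *\<^sub>R J (\<beta> (u x))"
  shows "AE x in lebesgue. u x = 0"
proof -
  have u: "u \<in> L2" and g: "\<And>k. g k \<in> L2" using w by (auto simp: mag_weak_def)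
  note \<beta>_lin = bounded_linear.linear[OF \<beta>_bl]
  obtain v where v: "\<And>n. v n \<in> C0_infinity" and vu: "L2lim v u" and vg: "\<And>k. L2lim (\<lambda>n. D k (v n)) (g k)"
    using test_functions_dense[OF A w] unfolding approximable_def by blast
  have zero_imp: "AE x in lebesgue. u x = 0" if "L2sq u = 0"
    using that L2_integrable[OF u] integral_nonneg_eq_0_iff_AE[of lebesgue "\<lambda>x. norm (u x) ^ 2"]
    by (simp add: L2sq_def)
  define M where "M v = a *\<^sub>R J v - (1/2) *\<^sub>R J (\<beta> v)" for v
  define M' where "M' v = a *\<^sub>R J v + (1/2) *\<^sub>R J (\<beta> v)" for v
  define lam where "lam = a ^ 2 - 1/4"
  have J\<beta>_bl: "bounded_linear (\<lambda>v. J (\<beta> v))" by (rule bounded_linear_compose[OF J_bounded_linear \<beta>_bl])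
  have M_bl: "bounded_linear M" unfolding M_def[abs_def]
    by (intro bounded_linear_sub bounded_linear_compose[OF bounded_linear_scaleR_right] J_bounded_linear J\<beta>_bl)
  have M'_bl: "bounded_linear M'" unfolding M'_def[abs_def]
    by (intro bounded_linear_add bounded_linear_compose[OF bounded_linear_scaleR_right] J_bounded_linear J\<beta>_bl)
  have MJ: "M (J v) = J (M v)" for v
    by (simp add: M_def \<beta>_J linear_diff[OF J_linear] linear_cmul[OF J_linear])
  have \<alpha>M: "\<alpha> j (M v) = M' (\<alpha> j v)" for j v
    by (simp add: M_def M'_def linear_diff[OF \<alpha>_linear] linear_cmul[OF \<alpha>_linear] \<alpha>_J \<beta>_\<alpha> linear_neg[OF J_linear])
  have M'M: "M' (M v) = - (lam *\<^sub>R v)" for v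
    by (simp add: M_def M'_def lam_def \<beta>_J \<beta>_square J_J linear_diff[OF \<beta>_lin] linear_cmul[OF \<beta>_lin]
        linear_diff[OF J_linear] linear_cmul[OF J_linear] power2_eq_square algebra_simps)
  have inner_M: "v \<bullet> M v = 0" for v
  proof -
    have "v \<bullet> J (\<beta> v) = - (v \<bullet> J (\<beta> v))"
      using J_skew[of v "\<beta> v"] \<beta>_symmetric[of "J v" v] by (simp add: \<beta>_J inner_commute)
    then show ?thesis by (simp add: M_def inner_diff_right inner_J_self)
  qed
  have Tlim: "L2lim (\<lambda>n. T (v n)) (\<lambda>x. M (u x) - b *\<^sub>R u x)"
  proof (rule L2lim_cong_AE)
    show "L2lim (\<lambda>n. T (v n)) (\<lambda>x. \<Sum>j\<in>UNIV. \<alpha> j (g j x))"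
      unfolding T_def[abs_def] by (intro L2lim_sum L2lim_bounded_linear[OF \<alpha>_bounded_linear] vg)
    show "AE x in lebesgue. (\<Sum>j\<in>UNIV. \<alpha> j (g j x)) = M (u x) - b *\<^sub>R u x"
      using eq by eventually_elim (simp add: M_def)
    show "(\<lambda>x. M (u x) - b *\<^sub>R u x) \<in> borel_measurable lebesgue"
      by (intro L2_measurable L2_diff L2_bounded_linear[OF M_bl] L2_bounded_linear[OF bounded_linear_scaleR_right] u)
  qed
  have one: "(\<lambda>x::real^3. 1::real) \<in> borel_measurable lebesgue" "\<And>x::real^3. \<bar>1::real\<bar> \<le> 1" by auto
  note inner_lim = L2lim_inner[OF _ _ one, unfolded mult_1]
  have "b * L2sq u = 0"
  proof -
    have 0: "(LINT x|lebesgue. T (v n) x \<bullet> v n x) = 0" for n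
      using T_skew[OF v v, of n n] by (simp add: inner_commute)
    have "(\<lambda>n. 0) \<longlonglongrightarrow> (LINT x|lebesgue. (M (u x) - b *\<^sub>R u x) \<bullet> u x)"
      using inner_lim[OF Tlim vu] unfolding 0 .
    then have "(LINT x|lebesgue. (M (u x) - b *\<^sub>R u x) \<bullet> u x) = 0"
      by (rule LIMSEQ_unique[OF _ tendsto_const])
    then show ?thesis
      by (simp add: inner_diff_left inner_M inner_commute[of "M _"] L2sq_def power2_norm_eq_inner)
  qed
  then consider "L2sq u = 0" | "b = 0" by auto
  then show ?thesis
  proof cases
    case 1 then show ?thesis by (rule zero_imp)
  next
    case 2
    let ?w = "\<lambda>n x. M (v n x)"
    have wC: "?w n \<in> C0_infinity" for n by (rule C0_bounded_linear[OF M_bl v])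
    have Dw: "D k (?w n) = (\<lambda>x. M (D k (v n) x))" for k n
      by (rule ext) (rule D_bounded_linear[OF M_bl MJ v])
    have Tw: "T (?w n) = (\<lambda>x. M' (T (v n) x))" for n
      by (rule ext) (simp add: T_def Dw \<alpha>M linear_sum[OF bounded_linear.linear[OF M'_bl]])
    let ?W = "\<lambda>b f g :: real^3 \<Rightarrow> 'a. LINT x|lebesgue. b x * (f x \<bullet> g x)"
    let ?p = "\<lambda>m j k. partial j (dilation m k)"
    let ?Mu = "\<lambda>x. M (u x)" and ?Mg = "\<lambda>j k x. \<alpha> j (M (g k x))"
    let ?e = "\<lambda>n x. T (v n) x - ?w n x" and ?e' = "\<lambda>n x. T (?w n) x + lam *\<^sub>R v n x"
    have T_lim: "L2lim (\<lambda>n. T (v n)) (\<lambda>x. M (u x))" using Tlim 2 by simp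
    have w_lim: "L2lim ?w (\<lambda>x. M (u x))" by (rule L2lim_bounded_linear[OF M_bl vu])
    have Dw_lim: "L2lim (\<lambda>n. D k (?w n)) (\<lambda>x. M (g k x))" for k
      unfolding Dw by (rule L2lim_bounded_linear[OF M_bl vg])
    have Tw_lim: "L2lim (\<lambda>n. T (?w n)) (\<lambda>x. - (lam *\<^sub>R u x))"
      unfolding Tw M'M[symmetric] by (rule L2lim_bounded_linear[OF M'_bl T_lim])
    let ?P = "L2sq (\<lambda>x. M (u x))"
    have P: "?P = lam * L2sq u"
    proof -
      have "(LINT x|lebesgue. M (u x) \<bullet> M (u x)) = - (LINT x|lebesgue. u x \<bullet> - (lam *\<^sub>R u x))"
        using LIMSEQ_unique[OF inner_lim[OF T_lim w_lim]] tendsto_minus[OF inner_lim[OF vu Tw_lim]]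
        by (simp add: T_skew[OF v wC])
      then show ?thesis by (simp add: L2sq_def power2_norm_eq_inner)
    qed
    have Mg: "AE x in lebesgue. (\<Sum>k\<in>UNIV. \<alpha> k (M (g k x))) = - (lam *\<^sub>R u x)"
      using eq
    proof eventually_elim
      case (elim x)
      have "(\<Sum>k\<in>UNIV. \<alpha> k (M (g k x))) = M' (\<Sum>k\<in>UNIV. \<alpha> k (g k x))"
        by (simp add: \<alpha>M linear_sum[OF bounded_linear.linear[OF M'_bl]])
      also have "(\<Sum>k\<in>UNIV. \<alpha> k (g k x)) = M (u x)" using elim 2 by (simp add: M_def)
      finally show ?case by (simp add: M'M)
    qed
    have MgL: "(\<lambda>x. \<alpha> j (M (g k x))) \<in> L2" for j k
      by (intro L2_bounded_linear[OF \<alpha>_bounded_linear] L2_bounded_linear[OF M_bl] g)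
    have MuL: "(\<lambda>x. M (u x)) \<in> L2" by (intro L2_bounded_linear[OF M_bl] u)
    \<comment> \<open>this is the virial form of \<open>u\<close> and \<open>M u\<close> at scale \<open>m\<close>, after the radial derivatives have been integrated by parts\<close>
    define R where "R m = - 1/2 * (\<Sum>k\<in>UNIV. ?W (?p m k k) ?Mu ?Mu)
        + lam / 2 * (\<Sum>k\<in>UNIV. ?W (?p m k k) u u)
        + (\<Sum>j\<in>UNIV. \<Sum>k\<in>UNIV. ?W (?p m j k) u (?Mg j k))" for m
    have R_le: "\<bar>R m\<bar> \<le> 17/24 * ?P" for m
    proof -
      let ?\<Xi> = "dilation m"
      have \<Xi>m: "?\<Xi> k \<in> borel_measurable lebesgue" "partial j (?\<Xi> k) \<in> borel_measurable lebesgue" for j k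
        by (intro continuous_lebesgue_measurable C0_continuous C0_partial dilation_C0)+
      have "\<exists>C. \<forall>x. \<bar>f x\<bar> \<le> C" if f: "f \<in> C0_infinity" for f :: "real^3 \<Rightarrow> real"
        by (rule bounded_range_compact_support[OF C0_continuous[OF f] C0_bounded_support[OF f]]) auto
      from this[OF dilation_C0] this[OF C0_partial[OF dilation_C0]]
      have "\<exists>C. \<forall>x. \<bar>?\<Xi> k x\<bar> \<le> C" "\<exists>C. \<forall>x. \<bar>partial j (?\<Xi> k) x\<bar> \<le> C" for j k by blast+
      then obtain C C' where C: "\<And>k x. \<bar>?\<Xi> k x\<bar> \<le> C k" and C': "\<And>j k x. \<bar>partial j (?\<Xi> k) x\<bar> \<le> C' j k"
        by metis
      note lim = L2lim_inner[OF _ _ \<Xi>m(1) C]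
      note plim = L2lim_inner[OF _ _ \<Xi>m(2) C']
      note int = L2_weighted_inner(1)[OF _ _ \<Xi>m(1) C]
      note pint = L2_weighted_inner(1)[OF _ _ \<Xi>m(2) C']
      \<comment> \<open>the radial derivative of a square is half a divergence, which removes the factor \<open>\<Xi>\<close> that grows with the scale\<close>
      have half: "(?W (?\<Xi> k) (D k f) f) = - 1/2 * (?W (?p m k k) f f)"
        if f: "f \<in> C0_infinity" for f k
      proof -
        have "0 = (LINT x|lebesgue. ?\<Xi> k x * (D k f x \<bullet> f x) + ?\<Xi> k x * (f x \<bullet> D k f x) + partial k (?\<Xi> k) x * (f x \<bullet> f x))"
          using D_skew[OF C0_C_k[OF dilation_C0[of m k]] f f, of k] by simp
        also have "\<dots> = (?W (?\<Xi> k) (D k f) f) + (?W (?\<Xi> k) f (D k f))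
            + (?W (?p m k k) f f)"
          by (simp add: int pint D_L2[OF f] C0_L2[OF f])
        finally show ?thesis by (simp add: inner_commute[of "f _" "D _ _ _"])
      qed
      \<comment> \<open>in the third and the fourth sum the equation \<open>T u = M u\<close> is subtracted, so that they vanish in the limit\<close>
      define I where "I n = - 1/2 * (\<Sum>k\<in>UNIV. ?W (?p m k k) (?w n) (?w n))
         - (\<Sum>k\<in>UNIV. ?W (?p m k k) (v n) (T (?w n)))
         + (\<Sum>k\<in>UNIV. ?W (?\<Xi> k) (?e n) (D k (?w n)))
         - (\<Sum>k\<in>UNIV. ?W (?\<Xi> k) (D k (v n)) (?e' n))
         - lam / 2 * (\<Sum>k\<in>UNIV. ?W (?p m k k) (v n) (v n))
         + (\<Sum>j\<in>UNIV. \<Sum>k\<in>UNIV. ?W (?p m j k) (v n) (\<lambda>x. \<alpha> j (D k (?w n) x)))" for n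
      have I_eq: "(LINT x|lebesgue. (\<Sum>k\<in>UNIV. ?\<Xi> k x * (T (v n) x \<bullet> D k (?w n) x - D k (v n) x \<bullet> T (?w n) x))
          + (\<Sum>j\<in>UNIV. \<Sum>k\<in>UNIV. partial j (?\<Xi> k) x * (v n x \<bullet> \<alpha> j (D k (?w n) x)))
          - (\<Sum>k\<in>UNIV. partial k (?\<Xi> k) x) * (v n x \<bullet> T (?w n) x)) = I n" for n
      proof -
        have L: "v n \<in> L2" "?w n \<in> L2" "T (v n) \<in> L2" "T (?w n) \<in> L2" "D k (v n) \<in> L2" "D k (?w n) \<in> L2"
          "(\<lambda>x. \<alpha> j (D k (?w n) x)) \<in> L2" "(\<lambda>x. T (v n) x - ?w n x) \<in> L2" "(\<lambda>x. T (?w n) x + lam *\<^sub>R v n x) \<in> L2" for j k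
          by (intro C0_L2 v wC T_L2 D_L2 L2_bounded_linear[OF \<alpha>_bounded_linear] L2_diff L2_add(1)
              L2_bounded_linear[OF bounded_linear_scaleR_right])+
        have i1: "integrable lebesgue (\<lambda>x. ?\<Xi> k x * (T (v n) x \<bullet> D k (?w n) x))" for k by (intro int L)
        have i2: "integrable lebesgue (\<lambda>x. ?\<Xi> k x * (D k (v n) x \<bullet> T (?w n) x))" for k by (intro int L)
        have i3: "integrable lebesgue (\<lambda>x. partial j (?\<Xi> k) x * (v n x \<bullet> \<alpha> j (D k (?w n) x)))" for j k by (intro pint L)
        have i4: "integrable lebesgue (\<lambda>x. partial k (?\<Xi> k) x * (v n x \<bullet> T (?w n) x))" for k by (intro pint L)
        have s1: "(?W (?\<Xi> k) (T (v n)) (D k (?w n)))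
            = - 1/2 * (?W (?p m k k) (?w n) (?w n))
              + (?W (?\<Xi> k) (?e n) (D k (?w n)))" for k
        proof -
          have "(?W (?\<Xi> k) (T (v n)) (D k (?w n)))
             = (LINT x|lebesgue. ?\<Xi> k x * (D k (?w n) x \<bullet> ?w n x) + ?\<Xi> k x * ((T (v n) x - ?w n x) \<bullet> D k (?w n) x))"
            by (intro Bochner_Integration.integral_cong) (auto simp: inner_diff_left inner_commute algebra_simps)
          also have "\<dots> = (?W (?\<Xi> k) (D k (?w n)) (?w n)) + (?W (?\<Xi> k) (?e n) (D k (?w n)))"
            by (intro Bochner_Integration.integral_add int L)
          finally show ?thesis by (simp only: half[OF wC])
        qed
        have s2: "(?W (?\<Xi> k) (D k (v n)) (T (?w n)))
            = (?W (?\<Xi> k) (D k (v n)) (?e' n))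
              + lam / 2 * (?W (?p m k k) (v n) (v n))" for k
        proof -
          have "(?W (?\<Xi> k) (D k (v n)) (T (?w n)))
             = (LINT x|lebesgue. ?\<Xi> k x * (D k (v n) x \<bullet> ?e' n x) - lam * (?\<Xi> k x * (D k (v n) x \<bullet> v n x)))"
            by (intro Bochner_Integration.integral_cong) (auto simp: inner_add_right algebra_simps)
          also have "\<dots> = (?W (?\<Xi> k) (D k (v n)) (?e' n))
              - (LINT x|lebesgue. lam * (?\<Xi> k x * (D k (v n) x \<bullet> v n x)))"
            by (intro Bochner_Integration.integral_diff integrable_mult_right int L)
          also have "(LINT x|lebesgue. lam * (?\<Xi> k x * (D k (v n) x \<bullet> v n x))) = lam * (- 1/2 * (?W (?p m k k) (v n) (v n)))"
            unfolding half[OF v, symmetric] by simp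
          finally show ?thesis by simp
        qed
        have "(LINT x|lebesgue. (\<Sum>k\<in>UNIV. ?\<Xi> k x * (T (v n) x \<bullet> D k (?w n) x - D k (v n) x \<bullet> T (?w n) x))
          + (\<Sum>j\<in>UNIV. \<Sum>k\<in>UNIV. partial j (?\<Xi> k) x * (v n x \<bullet> \<alpha> j (D k (?w n) x)))
          - (\<Sum>k\<in>UNIV. partial k (?\<Xi> k) x) * (v n x \<bullet> T (?w n) x))
          = (\<Sum>k\<in>UNIV. (?W (?\<Xi> k) (T (v n)) (D k (?w n))) - (?W (?\<Xi> k) (D k (v n)) (T (?w n))))
          + (\<Sum>j\<in>UNIV. \<Sum>k\<in>UNIV. ?W (?p m j k) (v n) (\<lambda>x. \<alpha> j (D k (?w n) x)))
          - (\<Sum>k\<in>UNIV. ?W (?p m k k) (v n) (T (?w n)))"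
          unfolding right_diff_distrib sum_distrib_right using i1 i2 i3 i4
          by (simp only: Bochner_Integration.integral_diff Bochner_Integration.integral_add Bochner_Integration.integral_sum
              Bochner_Integration.integrable_diff Bochner_Integration.integrable_add Bochner_Integration.integrable_sum)
        then show ?thesis
          unfolding I_def s1 s2 by (simp only:) (simp add: sum.distrib sum_subtractf sum_distrib_left sum_negf algebra_simps)
      qed
      have I_le: "\<bar>I n\<bar> \<le> 1/3 * L2sq (T (v n)) + 3/8 * L2sq (?w n)" for n
        unfolding I_eq[symmetric]
        by (rule virial_bound[of "dilation m", OF dilation_C0 dilation_le v wC])
      have I_lim: "I \<longlonglongrightarrow> - 1/2 * (\<Sum>k\<in>UNIV. ?W (?p m k k) ?Mu ?Mu)
         - (\<Sum>k\<in>UNIV. ?W (?p m k k) u (\<lambda>x. - (lam *\<^sub>R u x)))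
         + (\<Sum>k\<in>UNIV. ?W (?\<Xi> k) (\<lambda>x. M (u x) + - 1 *\<^sub>R M (u x)) (\<lambda>x. M (g k x)))
         - (\<Sum>k\<in>UNIV. ?W (?\<Xi> k) (g k) (\<lambda>x. - (lam *\<^sub>R u x) + lam *\<^sub>R u x))
         - lam / 2 * (\<Sum>k\<in>UNIV. ?W (?p m k k) u u)
         + (\<Sum>j\<in>UNIV. \<Sum>k\<in>UNIV. ?W (?p m j k) u (?Mg j k))"
      proof -
        have d: "L2lim (\<lambda>n x. T (v n) x - ?w n x) (\<lambda>x. M (u x) + - 1 *\<^sub>R M (u x))"
          using L2lim_add[OF T_lim L2lim_bounded_linear[OF bounded_linear_scaleR_right[of "-1"] w_lim]] by simp
        show ?thesis
          unfolding I_def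
          by (intro tendsto_add tendsto_diff tendsto_mult tendsto_const tendsto_sum lim plim d
              L2lim_add Tw_lim Dw_lim w_lim vu vg L2lim_bounded_linear[OF bounded_linear_scaleR_right]
              L2lim_bounded_linear[OF \<alpha>_bounded_linear])
      qed
      have "I \<longlonglongrightarrow> R m"
      proof -
        have "(?W (?p m k k) u (\<lambda>x. - (lam *\<^sub>R u x)))
            = (LINT x|lebesgue. (- lam) * (partial k (?\<Xi> k) x * (u x \<bullet> u x)))" for k
          by (intro Bochner_Integration.integral_cong) auto
        then have e: "(\<Sum>k\<in>UNIV. ?W (?p m k k) u (\<lambda>x. - (lam *\<^sub>R u x)))
            = - lam * (\<Sum>k\<in>UNIV. ?W (?p m k k) u u)"
          by (simp only: Bochner_Integration.integral_mult_right_zero sum_distrib_left)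
        show ?thesis using I_lim unfolding e R_def by simp
      qed
      from tendsto_rabs[OF this] have "(\<lambda>n. \<bar>I n\<bar>) \<longlonglongrightarrow> \<bar>R m\<bar>" .
      moreover have "(\<lambda>n. 1/3 * L2sq (T (v n)) + 3/8 * L2sq (?w n)) \<longlonglongrightarrow> 1/3 * ?P + 3/8 * ?P"
        by (intro tendsto_add tendsto_mult tendsto_const L2lim_L2sq T_lim w_lim)
      ultimately have "\<bar>R m\<bar> \<le> 1/3 * ?P + 3/8 * ?P"
        by (rule LIMSEQ_le) (use I_le in blast)
      then show ?thesis by simp
    qed
    have R_lim: "R \<longlonglongrightarrow> - ?P"
    proof -
      have pm: "partial j (dilation m k) \<in> borel_measurable lebesgue" for j k m
        by (intro continuous_lebesgue_measurable C0_continuous C0_partial dilation_C0)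
      have lim: "(\<lambda>m. LINT x|lebesgue. partial j (dilation m k) x * (f x \<bullet> h x))
          \<longlonglongrightarrow> (if j = k then 1 else 0) * (LINT x|lebesgue. f x \<bullet> h x)"
        if "f \<in> L2" "h \<in> L2" for f h :: "real^3 \<Rightarrow> 'a" and j k
      proof (rule partial_dilation_bounded[of j k])
        fix C assume "\<And>n x. \<bar>partial j (dilation n k) x\<bar> \<le> C"
        then show ?thesis by (rule L2_weight_tendsto[OF that pm _ partial_dilation_tendsto])
      qed
      have i: "integrable lebesgue (\<lambda>x. u x \<bullet> \<alpha> k (M (g k x)))" for k by (rule L2_inner_integrable[OF u MgL])
      have "(\<Sum>k\<in>UNIV. LINT x|lebesgue. u x \<bullet> \<alpha> k (M (g k x))) = (LINT x|lebesgue. u x \<bullet> (\<Sum>k\<in>UNIV. \<alpha> k (M (g k x))))"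
        using i by (simp add: inner_sum_right Bochner_Integration.integral_sum)
      also have "\<dots> = (LINT x|lebesgue. u x \<bullet> - (lam *\<^sub>R u x))"
        using Mg L2_measurable[OF u] L2_measurable[OF L2_sum[of UNIV "\<lambda>k x. \<alpha> k (M (g k x))", OF MgL]]
        by (intro integral_cong_AE) auto
      also have "\<dots> = - (lam * L2sq u)" by (simp add: L2sq_def power2_norm_eq_inner)
      finally have S: "(\<Sum>k\<in>UNIV. LINT x|lebesgue. u x \<bullet> \<alpha> k (M (g k x))) = - (lam * L2sq u)" .
      have "R \<longlonglongrightarrow> - 1/2 * (\<Sum>k\<in>(UNIV::3 set). (if k = k then 1 else 0) * (LINT x|lebesgue. M (u x) \<bullet> M (u x)))
        + lam / 2 * (\<Sum>k\<in>(UNIV::3 set). (if k = k then 1 else 0) * (LINT x|lebesgue. u x \<bullet> u x))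
        + (\<Sum>j\<in>UNIV. \<Sum>k\<in>UNIV. (if j = k then 1 else 0) * (LINT x|lebesgue. u x \<bullet> \<alpha> j (M (g k x))))"
        unfolding R_def by (intro tendsto_add tendsto_mult tendsto_const tendsto_sum lim u MuL MgL)
      also have "(\<Sum>j\<in>UNIV. \<Sum>k\<in>UNIV. (if j = k then 1 else 0) * (LINT x|lebesgue. u x \<bullet> \<alpha> j (M (g k x)))) = - (lam * L2sq u)"
        unfolding S[symmetric] by (simp add: if_distrib if_distribR sum.delta cong: if_cong)
      \<comment> \<open>the trace of the limiting Jacobian is 3; with \<open>\<lambda> \<parallel>u\<parallel>\<^sup>2 = \<parallel>M u\<parallel>\<^sup>2\<close> the terms add up to \<open>- \<parallel>M u\<parallel>\<^sup>2\<close>\<close>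
      finally have "R \<longlonglongrightarrow> - 3/2 * ?P + 3/2 * (lam * L2sq u) - lam * L2sq u"
        by (simp add: L2sq_def power2_norm_eq_inner)
      then show ?thesis by (simp add: P)
    qed
    have "?P = 0"
    proof -
      have "\<bar>- ?P\<bar> \<le> 17/24 * ?P"
        using tendsto_rabs[OF R_lim] R_le by (intro tendsto_upperbound[of "\<lambda>m. \<bar>R m\<bar>" _ sequentially]) auto
      then show ?thesis using L2sq_nonneg[of "\<lambda>x. M (u x)"] by simp
    qed
    let ?wt = "\<lambda>x::real^3. 1 / (x \<bullet> x + 1)"
    have wt: "?wt \<in> borel_measurable lebesgue" "\<bar>?wt x\<bar> \<le> 1" "?wt x > 0" for x
    proof -
      have p: "y \<bullet> y + 1 > 0" for y :: "real^3" using inner_ge_zero[of y] by linarith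
      show "?wt \<in> borel_measurable lebesgue"
        by (intro continuous_lebesgue_measurable continuous_intros) (metis less_irrefl p)
      show "\<bar>?wt x\<bar> \<le> 1" "?wt x > 0" using p[of x] by (auto simp: abs_of_pos)
    qed
    have le: "(LINT x|lebesgue. ?wt x * (v n x \<bullet> v n x)) \<le> 8 * L2sq (T (v n))" for n
      using magnetic_Hardy(2)[OF zero_less_one v[of n]] kin_le_T[OF v[of n]] by (simp add: power2_norm_eq_inner)
    have "(\<lambda>n. 8 * L2sq (T (v n))) \<longlonglongrightarrow> 8 * ?P" by (intro tendsto_mult tendsto_const L2lim_L2sq T_lim)
    from LIMSEQ_le[OF L2lim_inner[OF vu vu wt(1,2)] this] le
    have "(LINT x|lebesgue. ?wt x * (u x \<bullet> u x)) \<le> 0" using \<open>?P = 0\<close> by auto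
    moreover have nn: "0 \<le> ?wt x * (u x \<bullet> u x)" for x using wt(3)[of x] by (intro mult_nonneg_nonneg) auto
    then have "0 \<le> (LINT x|lebesgue. ?wt x * (u x \<bullet> u x))" by (intro Bochner_Integration.integral_nonneg)
    ultimately have "(LINT x|lebesgue. ?wt x * (u x \<bullet> u x)) = 0" by linarith
    then have "AE x in lebesgue. ?wt x * (u x \<bullet> u x) = 0"
      using integral_nonneg_eq_0_iff_AE[OF L2_weighted_inner(1)[OF u u wt(1,2)]] nn by simp
    then show ?thesis
    proof eventually_elim
      case (elim x)
      then show ?case using wt(3)[of x] by (metis inner_eq_zero_iff less_irrefl mult_eq_0_iff)
    qed
  qed
qed

end

section \<open>The Dirac matrices and the theorem\<close>

lemma vector_4_nth [simp]:
  "(vector [a, b, c, d] :: ('a::zero)^4) $ 1 = a" "(vector [a, b, c, d] :: ('a::zero)^4) $ 2 = b"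
  "(vector [a, b, c, d] :: ('a::zero)^4) $ 3 = c" "(vector [a, b, c, d] :: ('a::zero)^4) $ 4 = d"
  unfolding vector_def by simp_all

definition times_i :: "complex^4 \<Rightarrow> complex^4" where
  "times_i v = \<i> *s v"

lemma inner_complex4:
  "(v::complex^4) \<bullet> w = v$1 \<bullet> w$1 + v$2 \<bullet> w$2 + v$3 \<bullet> w$3 + v$4 \<bullet> w$4"
  by (simp add: inner_vec_def sum_4)

lemma complex4_eqI:
  "(v::complex^4)$1 = w$1 \<Longrightarrow> v$2 = w$2 \<Longrightarrow> v$3 = w$3 \<Longrightarrow> v$4 = w$4 \<Longrightarrow> v = w"
  by (simp add: vec_eq_iff forall_4)

lemma dirac_alpha_nth:
  "(dirac_alpha 1 *v v) $ 1 = v $ 4" "(dirac_alpha 1 *v v) $ 2 = v $ 3"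
  "(dirac_alpha 1 *v v) $ 3 = v $ 2" "(dirac_alpha 1 *v v) $ 4 = v $ 1"
  "(dirac_alpha 2 *v v) $ 1 = - \<i> * v $ 4" "(dirac_alpha 2 *v v) $ 2 = \<i> * v $ 3"
  "(dirac_alpha 2 *v v) $ 3 = - \<i> * v $ 2" "(dirac_alpha 2 *v v) $ 4 = \<i> * v $ 1"
  "(dirac_alpha 3 *v v) $ 1 = v $ 3" "(dirac_alpha 3 *v v) $ 2 = - v $ 4"
  "(dirac_alpha 3 *v v) $ 3 = v $ 1" "(dirac_alpha 3 *v v) $ 4 = - v $ 2"
  by (simp_all add: dirac_alpha_def block_matrix_def pauli_def matrix_vector_mult_def sum_4)

lemma dirac_beta_nth:
  "(dirac_beta *v v) $ 1 = v $ 1" "(dirac_beta *v v) $ 2 = v $ 2"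
  "(dirac_beta *v v) $ 3 = - v $ 3" "(dirac_beta *v v) $ 4 = - v $ 4"
  by (simp_all add: dirac_beta_def block_matrix_def mat_def matrix_vector_mult_def sum_4)

lemma bounded_linear_matrix: "bounded_linear (\<lambda>v::complex^4. (P::complex^4^4) *v v)"
proof -
  have "linear (\<lambda>v::complex^4. P *v v)"
  proof (rule linearI)
    show "P *v (v + w) = P *v v + P *v w" for v w by (rule matrix_vector_right_distrib)
    show "P *v (r *\<^sub>R v) = r *\<^sub>R (P *v v)" for r and v :: "complex^4"
      by (simp add: vec_eq_iff matrix_vector_mult_def scaleR_sum_right)
  qed
  then show ?thesis by (rule linear_conv_bounded_linear[THEN iffD1])
qed

lemma forall_axis: "P 1 \<Longrightarrow> P 2 \<Longrightarrow> P 3 \<Longrightarrow> P (j::3)"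
  by (metis exhaust_3)

lemma dirac_alpha_symmetric: "(dirac_alpha j *v v) \<bullet> w = v \<bullet> (dirac_alpha j *v w)"
  by (rule forall_axis[of _ j]) (simp_all add: inner_complex4 dirac_alpha_nth inner_complex_def algebra_simps)

lemma dirac_alpha_square: "dirac_alpha j *v (dirac_alpha j *v v) = v"
  by (rule forall_axis[of _ j]) (rule complex4_eqI; simp add: dirac_alpha_nth)+

lemma dirac_alpha_anticommute:
  assumes "j \<noteq> k"
  shows "dirac_alpha j *v (dirac_alpha k *v v) = - (dirac_alpha k *v (dirac_alpha j *v v))"
proof -
  have "j \<noteq> k \<longrightarrow> dirac_alpha j *v (dirac_alpha k *v v) = - (dirac_alpha k *v (dirac_alpha j *v v))"
    by (rule forall_axis[of _ j]; rule forall_axis[of _ k])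
       (auto intro!: complex4_eqI simp: dirac_alpha_nth)
  then show ?thesis using assms by blast
qed

lemma matrix_times_i: "P *v times_i v = times_i (P *v v)"
  by (simp add: times_i_def vec_eq_iff matrix_vector_mult_def sum_distrib_left mult.left_commute)

lemma dirac_beta_symmetric: "(dirac_beta *v v) \<bullet> w = v \<bullet> (dirac_beta *v w)"
  by (simp add: inner_complex4 dirac_beta_nth)

lemma dirac_beta_square: "dirac_beta *v (dirac_beta *v v) = v"
  by (rule complex4_eqI; simp add: dirac_beta_nth)

lemma dirac_alpha_beta: "dirac_alpha j *v (dirac_beta *v v) = - (dirac_beta *v (dirac_alpha j *v v))"
  by (rule forall_axis[of _ j]) (rule complex4_eqI; simp add: dirac_alpha_nth dirac_beta_nth)+

interpretation spinor: complex_structure times_i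
proof (rule complex_structure.intro)
  have "linear times_i"
    by (rule linearI) (simp_all add: times_i_def vec_eq_iff algebra_simps)
  then show "bounded_linear times_i" by (rule linear_conv_bounded_linear[THEN iffD1])
  show "times_i v \<bullet> w = - (v \<bullet> times_i w)" for v w
    by (simp add: inner_complex4 times_i_def inner_complex_def algebra_simps)
  show "times_i (times_i v) = - v" for v
    by (simp add: times_i_def vec_eq_iff)
qed

lemma mag_grad_sq_eq:
  assumes u: "u \<in> C0_infinity"
  shows "mag_grad_sq A u x = (\<Sum>k\<in>UNIV. norm (spinor.mgrad A k u x) ^ 2)"
proof -
  have p: "partial k (\<lambda>y. u y $ j) x = partial k u x $ j" for k j
    by (rule C_k_bounded_linear(2)[OF bounded_linear_vec_nth C0_differentiable[OF u]])
  have n4: "norm w ^ 2 = (\<Sum>j\<in>UNIV. norm (w $ j) ^ 2)" for w :: "complex^4"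
    by (simp add: power2_norm_eq_inner inner_vec_def)
  have n3: "norm w ^ 2 = (\<Sum>j\<in>UNIV. norm (w $ j) ^ 2)" for w :: "complex^3"
    by (simp add: power2_norm_eq_inner inner_vec_def)
  have "mag_grad_sq A u x = (\<Sum>j\<in>UNIV. \<Sum>k\<in>UNIV. norm (spinor.mgrad A k u x $ j) ^ 2)"
    unfolding mag_grad_sq_def n3
    by (simp add: mag_grad_def spinor.mgrad_def times_i_def p scaleR_conv_of_real[where 'a = complex] mult.left_commute mult.assoc mult.commute)
  also have "\<dots> = (\<Sum>k\<in>UNIV. norm (spinor.mgrad A k u x) ^ 2)"
    unfolding n4 by (rule sum.swap)
  finally show ?thesis .
qed

theorem theorem1p3:
  fixes A B :: "real^3 \<Rightarrow> real^3" and c :: real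
  assumes "A \<in> Lloc 2"
    and "weak_curl A B" and "B \<in> Lloc 2"
    and "0 \<le> c" and "c < 1"
    and "4 * sqrt 3 * c < 1"
    and "2 * c + 6 * sqrt 3 * c + sqrt 2 * (sqrt 3 * c) powr (3/2) < 1"
    and "\<And>u :: real^3 \<Rightarrow> complex^4. (\<And>j. (\<lambda>x. u x $ j) \<in> C0_infinity) \<Longrightarrow>
        (LINT x|lebesgue. norm x ^ 2 * norm (B x) ^ 2 * norm (u x) ^ 2)
          \<le> c ^ 2 * (LINT x|lebesgue. mag_grad_sq A u x)"
    and "A \<in> W1loc 3"
  shows "point_spectrum (H1_mag A) (dirac_op A) = {}"
proof -
  have c: "c \<le> 1 / 12"
  proof -
    have "sqrt 2 * (sqrt 3 * c) powr (3/2) \<ge> 0" by simp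
    then have 1: "2 * c + 6 * sqrt 3 * c < 1" using assms(7) by linarith
    \<comment> \<open>this estimate suffices for \<open>2 + 6 sqrt 3 > 12\<close>\<close>
    have "17 / 10 \<le> sqrt 3" by (rule real_le_rsqrt) (simp add: power2_eq_square)
    then have "(17 / 10) * c \<le> sqrt 3 * c" using assms(4) by (rule mult_right_mono)
    with 1 show ?thesis using assms(4) by linarith
  qed
  interpret magnetic_field times_i A B
    by unfold_locales (use assms in auto)
  interpret magnetic_dirac times_i A B "\<lambda>j v. dirac_alpha j *v v"
  proof (intro magnetic_dirac.intro magnetic_dirac_axioms.intro magnetic_field_axioms)
    fix f :: "real^3 \<Rightarrow> complex^4" assume f: "f \<in> C0_infinity"
    have "(\<lambda>x. f x $ j) \<in> C0_infinity" for j by (rule C0_bounded_linear[OF bounded_linear_vec_nth f])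
    then have "(LINT x|lebesgue. norm x ^ 2 * norm (B x) ^ 2 * norm (f x) ^ 2) \<le> c ^ 2 * (LINT x|lebesgue. mag_grad_sq A f x)"
      by (rule assms(8))
    also have "(LINT x|lebesgue. mag_grad_sq A f x) = kin f"
      by (simp add: kin_integral(2)[OF f] mag_grad_sq_eq[OF f])
    also have "c ^ 2 * kin f \<le> (1 / 12) ^ 2 * kin f"
      using c assms(4) by (intro mult_right_mono power_mono kin_nonneg)
    finally show "(LINT x|lebesgue. norm x ^ 2 * norm (B x) ^ 2 * norm (f x) ^ 2) \<le> 1 / 144 * kin f"
      by (simp add: power2_eq_square)
  qed (rule bounded_linear_matrix dirac_alpha_symmetric dirac_alpha_square dirac_alpha_anticommute matrix_times_i, assumption?)+
  have "AE x in lebesgue. u x = 0" if u: "u \<in> H1_mag A" and ev: "AE x in lebesgue. dirac_op A u x = z *s u x" for u z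
  proof -
    \<comment> \<open>on the domain some square integrable magnetic derivative exists, so the choice in \<open>mag_deriv\<close> picks one\<close>
    define g where "g k = mag_deriv A k u" for k
    have g: "g k \<in> L2 \<and> is_mag_deriv A k u (g k)" for k
    proof -
      have "\<exists>g. g \<in> L2 \<and> is_mag_deriv A k u g" using u by (auto simp: H1_mag_def)
      then show ?thesis unfolding g_def mag_deriv_def by (rule someI_ex)
    qed
    have "(\<i> * complex_of_real r) *s v = r *\<^sub>R times_i v" for r v
      by (simp add: times_i_def vec_eq_iff scaleR_conv_of_real[where 'a = complex])
    then have w: "spinor.mag_weak A u g"
      using u g by (simp add: spinor.mag_weak_def H1_mag_def is_mag_deriv_def)
    show ?thesis
    proof (rule dirac_eigenfunction_zero[OF bounded_linear_matrix dirac_beta_symmetric dirac_beta_square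
          matrix_times_i dirac_alpha_beta w])
      show "AE x in lebesgue. (\<Sum>j\<in>UNIV. dirac_alpha j *v g j x)
          = Re z *\<^sub>R times_i (u x) - Im z *\<^sub>R u x - (1/2) *\<^sub>R times_i (dirac_beta *v u x)"
        using ev
      proof eventually_elim
        case (elim x)
        let ?S = "\<Sum>j\<in>UNIV. dirac_alpha j *v g j x"
        have e: "(- \<i>) *s ?S + (1/2) *s (dirac_beta *v u x) = z *s u x"
          using elim by (simp add: dirac_op_def g_def)
        have z: "z = complex_of_real (Re z) + \<i> * complex_of_real (Im z)" by (simp add: complex_eq)
        show ?case
        proof (rule vec_eq_iff[THEN iffD2], intro allI)
          fix i
          have "(- \<i>) * ?S $ i + (1/2) * (dirac_beta *v u x) $ i = z * u x $ i"
            using e by (simp add: vec_eq_iff)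
          then have "?S $ i = \<i> * (z * u x $ i) - \<i> * ((1/2) * (dirac_beta *v u x) $ i)"
            by (simp add: algebra_simps)
          also have "\<i> * (z * u x $ i) = (Re z *\<^sub>R times_i (u x) - Im z *\<^sub>R u x) $ i"
            by (subst z) (simp add: times_i_def scaleR_conv_of_real[where 'a = complex] algebra_simps)
          finally show "?S $ i = (Re z *\<^sub>R times_i (u x) - Im z *\<^sub>R u x - (1/2) *\<^sub>R times_i (dirac_beta *v u x)) $ i"
            by (simp add: times_i_def scaleR_conv_of_real[where 'a = complex])
        qed
      qed
    qed
  qed
  then show ?thesis by (auto simp: point_spectrum_def)
qed

end
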